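(* For every integer $\ell>0$ there is a polynomial-time reduction that, given a monotone circuit $C$ of depth $\ell$, produces samples $\{(\mathbf{x}_i,y_i)\}_{i\in[m]}$ with $\mathbf{x}_i\in\mathbb{R}^n$, $y_i\in\mathbb{R}$, such that $$\min_{\mathbf{w}\in\mathbb{R}^n}\sum_{i=1}^m\big([\langle\mathbf{w},\mathbf{x}_i\rangle]_+-y_i\big)^2=\frac{\mathrm{opt}(C)}{(10|C|)^{2\ell+2}}.$$
   Context: $[z]_+:=\max(0,z)$. A monotone circuit is a Boolean circuit in which every gate is an OR gate or an AND gate (of arbitrary fan-in); $|C|$ denotes the number of wires of $C$. For a monotone circuit $C$, $\mathrm{opt}(C)$ is the minimum number of input wires that must be set to True so that the output wire of $C$ evaluates to True (the Minimum Monotone Circuit Satisfiability optimum). The minimum is over single ReLUs with coefficient $+1$ and zero bias. *)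

theory Defs
  imports Complex_Main
begin

text \<open>A gate is an AND or an OR gate; its argument is the list of the wires feeding it.
  Wires are numbered: wires 0 ..< ninputs are the input wires, wire ninputs + j is the
  output wire of gate j.  Gate j may only read wires with smaller number (acyclicity).
  The output wire of the circuit is the output wire of the last gate.\<close>

datatype gate = AndG "nat list" | OrG "nat list"

fun gate_args :: "gate \<Rightarrow> nat list" where
  "gate_args (AndG cs) = cs"
| "gate_args (OrG cs) = cs"

datatype circuit = Circuit (ninputs: nat) (gates: "gate list")

definition circuit_wf :: "circuit \<Rightarrow> bool" where
  "circuit_wf C \<longleftrightarrow> gates C \<noteq> [] \<and>
     (\<forall>j < length (gates C). gate_args (gates C ! j) \<noteq> [] \<and>
        (\<forall>c \<in> set (gate_args (gates C ! j)). c < ninputs C + j))"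

definition csize :: "circuit \<Rightarrow> nat" where
  "csize C = ninputs C + length (gates C)"

fun gate_val :: "bool list \<Rightarrow> gate \<Rightarrow> bool" where
  "gate_val vs (AndG cs) = list_all (\<lambda>c. vs ! c) cs"
| "gate_val vs (OrG cs) = list_ex (\<lambda>c. vs ! c) cs"

definition wire_vals :: "circuit \<Rightarrow> (nat \<Rightarrow> bool) \<Rightarrow> bool list" where
  "wire_vals C a = foldl (\<lambda>vs g. vs @ [gate_val vs g]) (map a [0..<ninputs C]) (gates C)"

definition circuit_eval :: "circuit \<Rightarrow> (nat \<Rightarrow> bool) \<Rightarrow> bool" where
  "circuit_eval C a = last (wire_vals C a)"

definition wire_depths :: "circuit \<Rightarrow> nat list" where
  "wire_depths C = foldl (\<lambda>ds g. ds @ [Suc (foldl (\<lambda>m c. max m (ds ! c)) 0 (gate_args g))])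
                         (replicate (ninputs C) 0) (gates C)"

definition circuit_depth :: "circuit \<Rightarrow> nat" where
  "circuit_depth C = last (wire_depths C)"

definition opt :: "circuit \<Rightarrow> nat" where
  "opt C = Min {card S | S. S \<subseteq> {..<ninputs C} \<and> circuit_eval C (\<lambda>i. i \<in> S)}"

definition relu :: "real \<Rightarrow> real" where
  "relu z = max 0 z"

definition samples_ok :: "nat \<Rightarrow> (rat list \<times> rat) list \<Rightarrow> bool" where
  "samples_ok n S \<longleftrightarrow> (\<forall>(x, y) \<in> set S. length x = n)"

definition relu_loss :: "nat \<Rightarrow> (rat list \<times> rat) list \<Rightarrow> real list \<Rightarrow> real" where
  "relu_loss n S w =
     sum_list (map (\<lambda>(x, y). (relu (\<Sum>j<n. w ! j * real_of_rat (x ! j)) - real_of_rat y)\<^sup>2) S)"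

definition relu_min_is :: "nat \<Rightarrow> (rat list \<times> rat) list \<Rightarrow> real \<Rightarrow> bool" where
  "relu_min_is n S v \<longleftrightarrow>
     (\<exists>w. length w = n \<and> relu_loss n S w = v) \<and>
     (\<forall>w. length w = n \<longrightarrow> v \<le> relu_loss n S w)"

section \<open>Encodings over a finite alphabet (symbol 0 is the blank)\<close>

fun bits :: "nat \<Rightarrow> nat list" where
  "bits n = (if n = 0 then [] else (if even n then 1 else 2) # bits (n div 2))"

definition enc_nat :: "nat \<Rightarrow> nat list" where
  "enc_nat n = bits n @ [3]"

definition enc_int :: "int \<Rightarrow> nat list" where
  "enc_int i = (if i < 0 then [6] else [7]) @ enc_nat (nat \<bar>i\<bar>)"

definition enc_rat :: "rat \<Rightarrow> nat list" where
  "enc_rat r = (case quotient_of r of (p, q) \<Rightarrow> enc_int p @ enc_nat (nat q))"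

definition enc_sample :: "rat list \<times> rat \<Rightarrow> nat list" where
  "enc_sample xy = (case xy of (x, y) \<Rightarrow> concat (map enc_rat x) @ [4] @ enc_rat y @ [5])"

definition enc_output :: "nat \<Rightarrow> (rat list \<times> rat) list \<Rightarrow> nat list" where
  "enc_output n S = enc_nat n @ concat (map enc_sample S)"

fun enc_gate :: "gate \<Rightarrow> nat list" where
  "enc_gate (AndG cs) = [4] @ concat (map enc_nat cs) @ [5]"
| "enc_gate (OrG cs) = [6] @ concat (map enc_nat cs) @ [5]"

definition enc_circuit :: "circuit \<Rightarrow> nat list" where
  "enc_circuit C = enc_nat (ninputs C) @ concat (map enc_gate (gates C))"

datatype dir = Lft | Rgt | Stay

record tm =
  nstates :: nat
  nsym :: nat
  delta :: "nat \<Rightarrow> nat \<Rightarrow> nat \<times> nat \<times> dir"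
  halt_state :: nat

text \<open>Finite state set {0..<nstates} (start state 0), finite alphabet {0..<nsym}
  containing the encoding symbols 0..7 (0 = blank).\<close>
definition tm_wf :: "tm \<Rightarrow> bool" where
  "tm_wf M \<longleftrightarrow> halt_state M < nstates M \<and> 8 \<le> nsym M \<and>
     (\<forall>q < nstates M. \<forall>s < nsym M. case delta M q s of (q', s', d) \<Rightarrow>
        q' < nstates M \<and> s' < nsym M)"

type_synonym config = "nat \<times> (int \<Rightarrow> nat) \<times> int"

definition tm_step :: "tm \<Rightarrow> config \<Rightarrow> config" where
  "tm_step M c = (case c of (q, tp, h) \<Rightarrow>
     if q = halt_state M then c
     else (case delta M q (tp h) of (q', s', d) \<Rightarrow>
       (q', tp(h := s'), h + (case d of Lft \<Rightarrow> -1 | Rgt \<Rightarrow> 1 | Stay \<Rightarrow> 0))))"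

definition tm_init :: "nat list \<Rightarrow> config" where
  "tm_init w = (0, \<lambda>i. if 0 \<le> i \<and> i < int (length w) then w ! nat i else 0, 0)"

definition tm_halts_with :: "tm \<Rightarrow> nat list \<Rightarrow> nat \<Rightarrow> nat list \<Rightarrow> bool" where
  "tm_halts_with M w t out \<longleftrightarrow>
     (\<exists>k \<le> t. case (tm_step M ^^ k) (tm_init w) of (q, tp, h) \<Rightarrow>
        q = halt_state M \<and> 0 \<notin> set out \<and>
        (\<forall>i < length out. tp (int i) = out ! i) \<and> tp (int (length out)) = 0)"

end

theory Submission
  imports Defs
begin

text \<open>
  Let \<open>N\<close> be the size of the circuit and \<open>y = 1 / (10 N)^(l+1)\<close>. Every wire \<open>c\<close> gets a real value \<open>v c\<close>;
  a nonpositive value means True. The samples are: \<open>relu (v c) = y\<close> for every input wire \<open>c\<close> that some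
  gate reads (making \<open>c\<close> true costs \<open>y^2\<close>); \<open>relu (v c - v j) = 0\<close> for every argument \<open>c\<close> of an AND gate
  \<open>j\<close>; \<open>relu ((\<Sum>c. v c) - v j) = 0\<close> for an OR gate \<open>j\<close>, the sum ranging over its distinct arguments; and
  \<open>relu (- v out) = 1\<close>. If the loss is below \<open>opt * y^2\<close>, all errors are at most \<open>N y\<close>, so \<open>v out\<close> is
  close to \<open>-1\<close>, and a negative margin, shrinking at most by a factor of about \<open>2 N\<close> per layer, propagates
  down to inputs of nonpositive value. These satisfy the circuit, so at least \<open>opt\<close> of them
  pay \<open>y^2\<close> each. Conversely, values of true wires growing fast enough towards the inputs attain \<open>opt * y^2\<close>.

  The number of input wires is written in binary, so there cannot be a coordinate for each of them.
  Coordinates are the occurrences of wire names in the circuit description, and \<open>v c\<close> is the sum of the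
  coordinates of all occurrences of \<open>c\<close>.

  For polynomial time, functions on words obtained by composition and by recursion on
  words with additively bounded growth (in the style of Cobham) are compiled to programs on
  finitely many stacks, and these to a Turing machine with one tape track per stack.
\<close>

section \<open>Stack programs on a Turing machine\<close>

text \<open>The minimum must be hit exactly, so the paid samples have to carry the whole loss. An
  input value \<open>y\<close> costs nothing, a nonpositive one exactly \<open>y^2\<close>, and all
  other samples can be met without error. The values this takes grow like \<open>(N+1)^N\<close>,
  which is harmless: only the samples are written down, not the weights. The exponent of
  \<open>y\<close> comes from the lower bound. A loss below \<open>opt * y^2\<close>, which is at
  most \<open>N * y^2\<close> and hence at most \<open>(N * y)^2\<close>, bounds the error of each
  gate sample and of the output sample by \<open>d = N * y\<close>. Through \<open>l\<close> layers
  such errors add up to at most \<open>(2 * N)^l * d\<close>, and this must stay below the target 1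
  of the output sample: \<open>l\<close> factors for the layers and one for \<open>d\<close>, with
  the 2 absorbed by the 10. Input wires that no gate reads get no sample, as there may be
  exponentially many; the solution extracted from a small loss uses read inputs only. For the same
  reason \<open>N\<close> itself can be exponential in the length of the description, so
  \<open>y\<close> is computed by binary arithmetic. That \<open>l\<close> is fixed makes the power
  a constant number of multiplications.\<close>

datatype com = Skip | Push nat nat | Seq com com | Loop nat "nat \<Rightarrow> com"

type_synonym store = "nat \<Rightarrow> nat list"

fun step :: "com list \<times> store \<Rightarrow> com list \<times> store" where
  "step ([], s) = ([], s)"
| "step (Skip # K, s) = (K, s)"
| "step (Push r a # K, s) = (K, s(r := a # s r))"
| "step (Seq c d # K, s) = (c # d # K, s)"
| "step (Loop r f # K, s) =
    (case s r of [] \<Rightarrow> (K, s) | a # x \<Rightarrow> (f a # Loop r f # K, s(r := x)))"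

text \<open>Symbol 0 is kept out of the stacks: as a digit of a tape symbol it marks the cells that
  a stack does not occupy.\<close>

definition valid :: "nat list \<Rightarrow> bool" where
  "valid xs \<longleftrightarrow> set xs \<subseteq> {1..<8}"

lemma valid_simps [simp]:
  "valid []" "valid (a # x) \<longleftrightarrow> 1 \<le> a \<and> a < 8 \<and> valid x" "valid (x @ y) \<longleftrightarrow> valid x \<and> valid y"
  "valid (rev x) = valid x"
  by (auto simp: valid_def)

text \<open>Only the loop bodies for the symbols 1 to 7 are constrained, since a valid stack can pop
  nothing else. This is what makes the control finite although a body is an arbitrary function of
  the popped symbol.\<close>

primrec wfc :: "nat \<Rightarrow> com \<Rightarrow> bool" where
  "wfc m Skip = True"
| "wfc m (Push r a) = (r < m \<and> 1 \<le> a \<and> a < 8)"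
| "wfc m (Seq c d) = (wfc m c \<and> wfc m d)"
| "wfc m (Loop r f) = (r < m \<and> (\<forall>a\<in>{1..<8}. wfc m (f a)))"

text \<open>An overapproximation of the continuation lists that arise while \<open>c\<close> runs in
  front of \<open>K\<close>. A loop body runs in front of the loop itself, so iterating does not
  deepen the list and the set stays finite; its members become the control states of the Turing
  machine.\<close>

primrec conts :: "com \<Rightarrow> com list \<Rightarrow> com list set" where
  "conts Skip K = {Skip # K}"
| "conts (Push r a) K = {Push r a # K}"
| "conts (Seq c d) K = insert (Seq c d # K) (conts c (d # K) \<union> conts d K)"
| "conts (Loop r f) K = insert (Loop r f # K) (\<Union>a\<in>{1..<8}. conts (f a) (Loop r f # K))"

lemma conts_self: "c # K \<in> conts c K"
  by (cases c) auto

lemma finite_conts: "finite (conts c K)"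
  by (induction c arbitrary: K) auto

lemma conts_wfc:
  assumes "wfc m c" "list_all (wfc m) K" "K' \<in> conts c K"
  shows "list_all (wfc m) K'"
  using assms
proof (induction c arbitrary: K)
  case (Seq c d)
  then show ?case using Seq.IH(1)[of "d # K"] Seq.IH(2)[of K] by auto
next
  case (Loop r f)
  from Loop.prems(3) consider "K' = Loop r f # K"
    | a where "a \<in> {1..<8}" "K' \<in> conts (f a) (Loop r f # K)"
    by auto
  then show ?case
  proof cases
    case 2
    then have "wfc m (f a)" using Loop.prems(1) by simp
    with 2(2) show ?thesis using Loop.prems(1,2) Loop.IH[OF rangeI, of a "Loop r f # K"] by simp
  qed (use Loop.prems in simp)
qed auto

text \<open>\<open>K\<close> has to be added because it is what remains once \<open>c\<close> is
  finished.\<close>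

lemma conts_step:
  assumes "K' \<in> conts c K" "\<forall>r. valid (s r)"
  shows "fst (step (K', s)) \<in> insert K (conts c K)"
  using assms(1)
proof (induction c arbitrary: K)
  case (Seq c d)
  show ?case
    using Seq.prems Seq.IH(1)[of "d # K"] Seq.IH(2)[of K] conts_self[of c "d # K"] conts_self[of d K]
    by auto
next
  case (Loop r f)
  from Loop.prems consider "K' = Loop r f # K"
    | a where "a \<in> {1..<8}" "K' \<in> conts (f a) (Loop r f # K)"
    by auto
  then show ?case
  proof cases
    case 1
    show ?thesis
    proof (cases "s r")
      case Nil
      then show ?thesis using 1 by simp
    next
      case (Cons a x)
      with assms(2)[rule_format, of r] have "a \<in> {1..<8}" by simp
      then have "f a # Loop r f # K \<in> (\<Union>a\<in>{1..<8}. conts (f a) (Loop r f # K))"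
        using conts_self by blast
      then show ?thesis using 1 Cons by simp
    qed
  next
    case 2
    then have "fst (step (K', s)) \<in> insert (Loop r f # K) (conts (f a) (Loop r f # K))"
      using Loop.IH by blast
    with 2(1) show ?thesis by auto
  qed
qed auto

lemma step_valid:
  assumes "\<forall>r. valid (s r)" "list_all (wfc m) K" "step (K, s) = (K', s')"
  shows "valid (s' r)"
  using assms by (cases "(K, s)" rule: step.cases) (auto split: list.splits, (metis valid_simps(2))+)

lemma step_length:
  assumes "step (K, s) = (K', s')"
  shows "length (s' r) \<le> Suc (length (s r))"
  using assms by (cases "(K, s)" rule: step.cases) (auto split: list.splits)

text \<open>Between two simulated steps the machine is in \<open>Scan K\<close> with the head on
  cell 0. \<open>Scan\<close> also walks right to the first free cell of the relevant track,
  \<open>Top\<close> inspects the cell just below it, and \<open>Ret\<close> walks back to the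
  start.\<close>

datatype st = Scan "com list" | Top "com list" | Ret nat "com list"

definition track :: "nat \<Rightarrow> nat \<Rightarrow> nat" where
  "track r v = v div 8 ^ r mod 8"

text \<open>A nonempty stack fills its track contiguously from cell 0, so \<open>Ret\<close> finds cell \<open>-1\<close>, and with it the
  start of the tape, as the first blank of the track to the left.\<close>
fun tm_trans :: "st \<Rightarrow> nat \<Rightarrow> st \<times> nat \<times> dir" where
  "tm_trans (Scan (Skip # K)) v = (Scan K, v, Stay)"
| "tm_trans (Scan (Seq c d # K)) v = (Scan (c # d # K), v, Stay)"
| "tm_trans (Scan (Push r a # K)) v =
    (if track r v = 0 then (Ret r K, v + a * 8 ^ r, Lft) else (Scan (Push r a # K), v, Rgt))"
| "tm_trans (Scan (Loop r f # K)) v =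
    (if track r v = 0 then (Top (Loop r f # K), v, Lft) else (Scan (Loop r f # K), v, Rgt))"
| "tm_trans (Top (Loop r f # K)) v =
    (if track r v = 0 then (Scan K, v, Rgt)
     else (Ret r (f (track r v) # Loop r f # K), v - track r v * 8 ^ r, Lft))"
| "tm_trans (Ret r K) v = (if track r v = 0 then (Scan K, v, Rgt) else (Ret r K, v, Lft))"
| "tm_trans q v = (q, v, Stay)"

section \<open>Tape tracks as base-8 digits\<close>

definition cell :: "nat list \<Rightarrow> int \<Rightarrow> nat" where
  "cell x p = (if 0 \<le> p \<and> p < int (length x) then rev x ! nat p else 0)"

text \<open>Stack \<open>r\<close> occupies the \<open>r\<close>-th base-8 digits of the tape symbols, with its bottom in cell 0. Hence a
  tape over the symbols below 8 is stack 0 with all other stacks empty, and neither input nor output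
  needs recoding.\<close>
definition tape :: "nat \<Rightarrow> store \<Rightarrow> int \<Rightarrow> nat" where
  "tape m s p = (\<Sum>r<m. cell (s r) p * 8 ^ r)"

lemma digit_sum_less:
  fixes d :: "nat \<Rightarrow> nat"
  assumes "\<And>r. d r < 8"
  shows "(\<Sum>r<m. d r * 8 ^ r) < 8 ^ m"
proof (induction m)
  case (Suc m)
  have "d m * 8 ^ m \<le> 7 * 8 ^ m" using assms[of m] by (intro mult_right_mono) auto
  with Suc show ?case unfolding sum.lessThan_Suc power_Suc by linarith
qed simp

lemma track_digit_sum:
  fixes d :: "nat \<Rightarrow> nat"
  assumes "\<And>r. d r < 8" "r < m"
  shows "track r (\<Sum>r<m. d r * 8 ^ r) = d r"
  using assms(2)
proof (induction m)
  case (Suc m)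
  show ?case
  proof (cases "r = m")
    case True
    have "(\<Sum>r<m. d r * 8 ^ r) < 8 ^ m" by (rule digit_sum_less) (rule assms)
    then show ?thesis using assms(1)[of m] True by (simp add: track_def)
  next
    case False
    then have "r < m" using Suc.prems by simp
    then obtain i where i: "m = r + Suc i" using less_imp_add_positive by (metis less_iff_Suc_add add_Suc_right)
    have "d m * 8 ^ m = (d m * 8 ^ i * 8) * 8 ^ r"
      unfolding i by (simp add: power_add)
    then have "(\<Sum>r<Suc m. d r * 8 ^ r) div 8 ^ r = d m * 8 ^ i * 8 + (\<Sum>r<m. d r * 8 ^ r) div 8 ^ r"
      by (simp only: sum.lessThan_Suc) (rule div_mult_self1, simp)
    then show ?thesis using Suc.IH[OF \<open>r < m\<close>] by (simp add: track_def)
  qed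
qed simp

lemma valid_nth: "valid x \<Longrightarrow> i < length x \<Longrightarrow> 1 \<le> x ! i \<and> x ! i < 8"
  by (auto simp: valid_def dest!: subsetD[OF _ nth_mem])

lemma cell_bounds:
  assumes "valid x"
  shows "cell x p < 8" "cell x p = 0 \<longleftrightarrow> p < 0 \<or> int (length x) \<le> p"
proof -
  have "1 \<le> rev x ! nat p \<and> rev x ! nat p < 8" if "0 \<le> p" "p < int (length x)"
    using that assms by (intro valid_nth) (auto simp: nat_less_iff)
  then show "cell x p < 8" "cell x p = 0 \<longleftrightarrow> p < 0 \<or> int (length x) \<le> p"
    by (auto simp: cell_def)
qed

lemma cell_Cons:
  "cell (a # x) p = (if p = int (length x) then a else cell x p)"
  by (auto simp: cell_def nth_append nat_less_iff nat_eq_iff)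

lemma tape_less: "\<forall>r. valid (s r) \<Longrightarrow> tape m s p < 8 ^ m"
  unfolding tape_def by (auto intro!: digit_sum_less cell_bounds)

lemma track_tape: "\<forall>r. valid (s r) \<Longrightarrow> r < m \<Longrightarrow> track r (tape m s p) = cell (s r) p"
  unfolding tape_def by (auto intro!: track_digit_sum cell_bounds)

lemma tape_push:
  assumes "r < m"
  shows "tape m (s(r := a # s r)) =
    (tape m s)(int (length (s r)) := tape m s (int (length (s r))) + a * 8 ^ r)"
proof
  fix p
  let ?g = "\<lambda>i. (if i = r \<and> p = int (length (s r)) then a * 8 ^ r else 0)"
  have "tape m (s(r := a # s r)) p = (\<Sum>i<m. cell (s i) p * 8 ^ i + ?g i)"
    unfolding tape_def by (intro sum.cong) (auto simp: cell_Cons, simp add: cell_def)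
  also have "\<dots> = tape m s p + (\<Sum>i<m. ?g i)" by (simp add: tape_def sum.distrib)
  also have "(\<Sum>i<m. ?g i) = (if p = int (length (s r)) then a * 8 ^ r else 0)"
    using assms by (auto simp: sum.delta)
  finally show "tape m (s(r := a # s r)) p = ((tape m s)(int (length (s r)) :=
      tape m s (int (length (s r))) + a * 8 ^ r)) p"
    by (cases "p = int (length (s r))") (simp_all del: fun_upd_apply add: fun_upd_same fun_upd_other)
qed

lemma tape_pop:
  assumes "r < m" "s r = a # x"
  shows "tape m (s(r := x)) = (tape m s)(int (length x) := tape m s (int (length x)) - a * 8 ^ r)"
proof -
  have "s = (s(r := x))(r := a # (s(r := x)) r)" using assms(2) by (auto simp: fun_eq_iff)
  then have "tape m s = (tape m (s(r := x)))(int (length x) := tape m (s(r := x)) (int (length x)) + a * 8 ^ r)"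
    using tape_push[OF assms(1), of "s(r := x)" a] by simp
  then show ?thesis by (simp add: fun_eq_iff)
qed

text \<open>The simulation only needs a numbering \<open>f\<close> of the machine states, decoded by
  \<open>g\<close>, and a set \<open>Q\<close> of continuations closed under \<open>step\<close>.
  Finiteness matters only for obtaining the numbering, in \<open>ex_numbering\<close>.\<close>

locale simulation =
  fixes m :: nat and Q :: "com list set" and f :: "st \<Rightarrow> nat" and g :: "nat \<Rightarrow> st" and n :: nat
  assumes gf: "\<And>q. q \<in> Scan ` Q \<union> Top ` Q \<union> case_prod Ret ` ({..<m} \<times> Q) \<Longrightarrow> g (f q) = q \<and> f q < n"
    and Q_wfc: "\<And>K. K \<in> Q \<Longrightarrow> list_all (wfc m) K"
    and Q_step: "\<And>K s. K \<in> Q \<Longrightarrow> \<forall>r. valid (s r) \<Longrightarrow> fst (step (K, s)) \<in> Q"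
    and Q_Nil: "[] \<in> Q"
begin

definition states :: "st set" where
  "states = Scan ` Q \<union> Top ` Q \<union> case_prod Ret ` ({..<m} \<times> Q)"

lemma states_iff [simp]:
  "Scan K \<in> states \<longleftrightarrow> K \<in> Q" "Top K \<in> states \<longleftrightarrow> K \<in> Q" "Ret r K \<in> states \<longleftrightarrow> r < m \<and> K \<in> Q"
  by (auto simp: states_def)

text \<open>Values that no reachable configuration produces are clipped, so that the machine is
  well-formed for trivial reasons.\<close>
definition machine :: tm where
  "machine = \<lparr>nstates = Suc n, nsym = 8 ^ Suc m,
     delta = (\<lambda>i v. case tm_trans (g i) v of (q, v', d) \<Rightarrow>
       (if f q < Suc n then f q else 0, if v' < 8 ^ Suc m then v' else 0, d)),
     halt_state = f (Scan [])\<rparr>"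

lemma machine_wf: "tm_wf machine"
  using gf[of "Scan []"] Q_Nil
  by (auto simp: tm_wf_def machine_def less_Suc_eq split: prod.splits)

definition reach :: "nat \<Rightarrow> st \<times> (int \<Rightarrow> nat) \<times> int \<Rightarrow> st \<times> (int \<Rightarrow> nat) \<times> int \<Rightarrow> bool" where
  "reach t c c' \<longleftrightarrow> (tm_step machine ^^ t) (apfst f c) = apfst f c'"

lemma reach_trans: "reach t c c' \<Longrightarrow> reach u c' c'' \<Longrightarrow> reach (t + u) c c''"
  unfolding reach_def by (subst add.commute) (simp add: funpow_add)

lemma reach_0: "reach 0 c c"
  by (simp add: reach_def)

text \<open>The premises ensure that the machine has not halted, because \<open>f\<close> is
  injective on \<open>states\<close>, and that neither of the clippings in \<open>delta\<close>
  takes effect.\<close>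

lemma reach_1:
  assumes "q \<in> states" "q \<noteq> Scan []" "tm_trans q (tp h) = (q', v', d)" "q' \<in> states" "v' < 8 ^ m"
    "tp' = tp(h := v')" "h' = h + (case d of Lft \<Rightarrow> -1 | Rgt \<Rightarrow> 1 | Stay \<Rightarrow> 0)"
  shows "reach 1 (q, tp, h) (q', tp', h')"
proof -
  have "f q \<noteq> f (Scan [])"
    using gf[of q] gf[of "Scan []"] assms(1,2) Q_Nil unfolding states_def by auto
  moreover have "g (f q) = q" "f q' < Suc n"
    using gf[of q] gf[of q'] assms(1,4) unfolding states_def by auto
  moreover have "v' < 8 * 8 ^ m" using assms(5) by simp
  ultimately show ?thesis
    using assms(3,6,7) by (simp add: reach_def tm_step_def machine_def)
qed

lemma reach_scan:
  assumes "K \<in> Q" "K = Push r a # K' \<or> K = Loop r e # K'" "\<forall>r. valid (s r)" "r < m"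
  shows "j \<le> length (s r) \<Longrightarrow> reach j (Scan K, tape m s, 0) (Scan K, tape m s, int j)"
proof (induction j)
  case (Suc j)
  then have "track r (tape m s (int j)) \<noteq> 0"
    using assms(3,4) by (simp add: track_tape cell_bounds)
  then have "reach 1 (Scan K, tape m s, int j) (Scan K, tape m s, int (Suc j))"
    using assms(1-3) by (intro reach_1[where v' = "tape m s (int j)" and d = Rgt]) (auto simp: tape_less)
  with Suc reach_trans[of j _ _ 1] show ?case by simp
qed (simp add: reach_0)

text \<open>The head starts one cell further left because the preceding push or pop already moved
  it; for \<open>j = 0\<close> it is then on the blank cell \<open>-1\<close>.\<close>

lemma reach_ret:
  assumes "K \<in> Q" "\<forall>r. valid (s r)" "r < m"
  shows "j \<le> length (s r) \<Longrightarrow> reach (Suc j) (Ret r K, tape m s, int j - 1) (Scan K, tape m s, 0)"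
proof (induction j)
  case 0
  have "track r (tape m s (-1)) = 0" using assms(2,3) by (simp add: track_tape cell_bounds)
  then show ?case
    using assms reach_1[of "Ret r K" "tape m s" "-1" "Scan K" "tape m s (-1)" Rgt]
    by (simp add: tape_less)
next
  case (Suc j)
  then have "track r (tape m s (int j)) \<noteq> 0"
    using assms(2,3) by (simp add: track_tape cell_bounds)
  then have "reach 1 (Ret r K, tape m s, int j) (Ret r K, tape m s, int j - 1)"
    using assms by (intro reach_1[where v' = "tape m s (int j)" and d = Lft]) (auto simp: tape_less)
  with Suc reach_trans[of 1] show ?case by fastforce
qed

text \<open>Walk to the end of one stack, act there, walk back to cell \<open>-1\<close> and turn:
  \<open>2 * L + 2\<close> machine steps in the worst case.\<close>

lemma reach_step:
  assumes K: "K \<in> Q" "K \<noteq> []" and val: "\<forall>r. valid (s r)" and st: "step (K, s) = (K', s')"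
    and L: "\<And>r. length (s r) \<le> L"
  shows "\<exists>t \<le> 2 * L + 2. reach t (Scan K, tape m s, 0) (Scan K', tape m s', 0)"
proof -
  have K': "K' \<in> Q" using Q_step[OF K(1) val] st by simp
  have val': "\<forall>r. valid (s' r)"
    using step_valid[OF val Q_wfc[OF K(1)] st] by blast
  note w = Q_wfc[OF K(1)]
  obtain c K0 where Kc: "K = c # K0" using K(2) by (cases K) auto
  show ?thesis
  proof (cases c)
    case Skip
    then have "reach 1 (Scan K, tape m s, 0) (Scan K', tape m s', 0)"
      using st Kc K(1) K' val
      by (intro reach_1[where v' = "tape m s 0" and d = Stay]) (auto simp: tape_less)
    then show ?thesis by (intro exI[of _ 1]) simp
  next
    case (Seq c1 c2)
    then have "reach 1 (Scan K, tape m s, 0) (Scan K', tape m s', 0)"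
      using st Kc K(1) K' val
      by (intro reach_1[where v' = "tape m s 0" and d = Stay]) (auto simp: tape_less)
    then show ?thesis by (intro exI[of _ 1]) simp
  next
    case (Push r a)
    have rm: "r < m" and K0: "K' = K0" and s': "s' = s(r := a # s r)"
      using w st Kc Push by auto
    let ?l = "length (s r)"
    have 1: "reach ?l (Scan K, tape m s, 0) (Scan K, tape m s, int ?l)"
      by (rule reach_scan[OF K(1) _ val rm, where a = a and K' = K0]) (use Kc Push in auto)
    have "track r (tape m s (int ?l)) = 0" using val rm by (simp add: track_tape cell_bounds)
    moreover have tp: "tape m s' = (tape m s)(int ?l := tape m s (int ?l) + a * 8 ^ r)"
      unfolding s' by (rule tape_push[OF rm])
    moreover have "tape m s' (int ?l) < 8 ^ m" using val' by (rule tape_less)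
    ultimately have 2: "reach 1 (Scan K, tape m s, int ?l) (Ret r K', tape m s', int ?l - 1)"
      using Kc Push K(1) K' rm K0
      by (intro reach_1[where v' = "tape m s (int ?l) + a * 8 ^ r" and d = Lft]) auto
    have 3: "reach (Suc ?l) (Ret r K', tape m s', int ?l - 1) (Scan K', tape m s', 0)"
      by (rule reach_ret[OF K' val' rm]) (simp add: s')
    show ?thesis using reach_trans[OF reach_trans[OF 1 2] 3] L[of r] by (intro exI[of _ "?l + 1 + Suc ?l"]) simp
  next
    case (Loop r e)
    have rm: "r < m" using w Kc Loop by auto
    let ?l = "length (s r)"
    have 1: "reach ?l (Scan K, tape m s, 0) (Scan K, tape m s, int ?l)"
      by (rule reach_scan[OF K(1) _ val rm, where e = e and K' = K0]) (use Kc Loop in auto)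
    have "track r (tape m s (int ?l)) = 0" using val rm by (simp add: track_tape cell_bounds)
    then have 2: "reach 1 (Scan K, tape m s, int ?l) (Top K, tape m s, int ?l - 1)"
      using Kc Loop K(1) val
      by (intro reach_1[where v' = "tape m s (int ?l)" and d = Lft]) (auto simp: tape_less)
    show ?thesis
    proof (cases "s r")
      case Nil
      have "K' = K0" "s' = s" using st Kc Loop Nil by auto
      moreover have "track r (tape m s (-1)) = 0" using val rm by (simp add: track_tape cell_bounds)
      ultimately have 3: "reach 1 (Top K, tape m s, int ?l - 1) (Scan K', tape m s', 0)"
        using Kc Loop Nil K(1) K' val
        by (intro reach_1[where v' = "tape m s (-1)" and d = Rgt]) (auto simp: tape_less)
      show ?thesis using reach_trans[OF reach_trans[OF 1 2] 3] Nil by (intro exI[of _ "?l + 1 + 1"]) simp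
    next
      case (Cons a x)
      have K'e: "K' = e a # K" and s': "s' = s(r := x)" using st Kc Loop Cons by auto
      have cell: "cell (s r) (int (length x)) = a" using Cons by (simp add: cell_Cons)
      have track: "track r (tape m s (int (length x))) = a" using val rm cell by (simp add: track_tape)
      have a: "a \<noteq> 0" using val[rule_format, of r] Cons by auto
      have tp: "tape m s' = (tape m s)(int (length x) := tape m s (int (length x)) - a * 8 ^ r)"
        unfolding s' by (rule tape_pop[of r m s a x, OF rm Cons])
      moreover have "tape m s' (int (length x)) < 8 ^ m" using val' by (rule tape_less)
      ultimately have 3: "reach 1 (Top K, tape m s, int ?l - 1) (Ret r K', tape m s', int (length x) - 1)"
        using Kc Loop Cons K(1) K' rm K'e track a
        by (intro reach_1[where v' = "tape m s (int (length x)) - a * 8 ^ r" and d = Lft]) auto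
      have 4: "reach (Suc (length x)) (Ret r K', tape m s', int (length x) - 1) (Scan K', tape m s', 0)"
        by (rule reach_ret[OF K' val' rm]) (simp add: s')
      show ?thesis
        using reach_trans[OF reach_trans[OF reach_trans[OF 1 2] 3] 4] L[of r] Cons
        by (intro exI[of _ "?l + 1 + 1 + Suc (length x)"]) simp
    qed
  qed
qed

text \<open>A step lengthens a stack by at most one symbol, so no stack exceeds \<open>L + t\<close>
  and every step costs at most \<open>2 * (L + t) + 2\<close>.\<close>

lemma reach_steps:
  assumes "K \<in> Q" "\<forall>r. valid (s r)" "(step ^^ t) (K, s) = ([], s')" "\<And>r. length (s r) \<le> L"
  shows "\<exists>u \<le> t * (2 * (L + t) + 2). reach u (Scan K, tape m s, 0) (Scan [], tape m s', 0)"
  using assms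
proof (induction t arbitrary: K s L)
  case 0
  then show ?case using reach_0 by auto
next
  case (Suc t)
  show ?case
  proof (cases "K = []")
    case True
    have "(step ^^ Suc t) ([], s) = ([], s)" by (induction t) auto
    with True Suc.prems(3) show ?thesis using reach_0 by auto
  next
    case False
    obtain K1 s1 where st: "step (K, s) = (K1, s1)" by fastforce
    obtain u1 where u1: "u1 \<le> 2 * L + 2" "reach u1 (Scan K, tape m s, 0) (Scan K1, tape m s1, 0)"
      using reach_step[OF Suc.prems(1) False Suc.prems(2) st Suc.prems(4)] by auto
    have "(step ^^ t) (K1, s1) = ([], s')"
      using Suc.prems(3) st by (metis comp_apply funpow_Suc_right)
    moreover have "K1 \<in> Q" using Q_step[OF Suc.prems(1,2)] st by (metis fst_conv)
    moreover have "\<forall>r. valid (s1 r)" using step_valid[OF Suc.prems(2) Q_wfc[OF Suc.prems(1)] st] by blast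
    moreover have "length (s1 r) \<le> Suc L" for r
      using step_length[OF st, of r] Suc.prems(4)[of r] by simp
    ultimately obtain u2 where u2: "u2 \<le> t * (2 * (Suc L + t) + 2)"
        "reach u2 (Scan K1, tape m s1, 0) (Scan [], tape m s', 0)"
      using Suc.IH by meson
    have "u1 + u2 \<le> Suc t * (2 * (L + Suc t) + 2)" using u1(1) u2(1) by simp
    with reach_trans[OF u1(2) u2(2)] show ?thesis by blast
  qed
qed

end

text \<open>The distinguished element gets number 0, the start state fixed by
  \<open>tm_init\<close>.\<close>

lemma ex_numbering:
  assumes "finite A" "a \<in> A"
  shows "\<exists>f g n. f a = (0::nat) \<and> (\<forall>q\<in>A. g (f q) = q \<and> f q < n)"
proof -
  obtain h where h: "bij_betw h (A - {a}) {0..<card (A - {a})}"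
    using ex_bij_betw_finite_nat[of "A - {a}"] assms(1) by auto
  define f where "f q = (if q = a then 0 else Suc (h q))" for q
  have "inj_on f A" using h by (auto simp: f_def inj_on_def bij_betw_def)
  then have "\<forall>q\<in>A. inv_into A f (f q) = q" by simp
  moreover have "\<forall>q\<in>A. f q < Suc (card (A - {a}))" using h by (auto simp: f_def bij_betw_def)
  ultimately show ?thesis by (metis f_def)
qed

text \<open>The bottom of a stack lies in cell 0 while the head of the list is the top, so a tape
  word is the reverse of stack 0. The other stacks must end empty, since otherwise their digits
  would remain in the output symbols.\<close>

theorem stack_program_machine:
  assumes "wfc m c" "0 < m"
  shows "\<exists>M. tm_wf M \<and> (\<forall>w t s'. valid w \<and> (step ^^ t) ([c], (\<lambda>_. [])(0 := rev w)) = ([], s') \<and>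
      (\<forall>r>0. s' r = []) \<longrightarrow> tm_halts_with M w (t * (2 * (length w + t) + 2)) (rev (s' 0)))"
proof -
  define Q where "Q = insert [] (conts c [])"
  let ?A = "Scan ` Q \<union> Top ` Q \<union> case_prod Ret ` ({..<m} \<times> Q)"
  have "finite ?A" by (simp add: Q_def finite_conts)
  have cQ: "[c] \<in> Q" using conts_self[of c "[]"] by (simp add: Q_def)
  then have "Scan [c] \<in> ?A" by simp
  from ex_numbering[OF \<open>finite ?A\<close> this]
  obtain f g n where f: "f (Scan [c]) = (0::nat)" and fg: "\<forall>q\<in>?A. g (f q) = q \<and> f q < n"
    by blast
  interpret simulation m Q f g n
  proof
    show "list_all (wfc m) K" if "K \<in> Q" for K
      using that conts_wfc[OF assms(1)] unfolding Q_def by (metis insert_iff list.pred_inject(1))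
    show "fst (step (K, s)) \<in> Q" if "K \<in> Q" "\<forall>r. valid (s r)" for K s
      using that conts_step[of K c "[]" s] unfolding Q_def by auto
  qed (use fg in \<open>auto simp: Q_def\<close>)
  have "tm_halts_with machine w (t * (2 * (length w + t) + 2)) (rev (s' 0))"
    if w: "valid w" and run: "(step ^^ t) ([c], (\<lambda>_. [])(0 := rev w)) = ([], s')" and s': "\<forall>r>0. s' r = []" for w t s'
  proof -
    let ?s = "(\<lambda>_. [])(0 := rev w) :: store"
    have val: "\<forall>r. valid (?s r)" using w by simp
    have tape0: "tape m s p = cell (s 0) p" if "\<forall>r>0. s r = []" for s p
    proof -
      have "tape m s p = (\<Sum>r<m. if r = 0 then cell (s 0) p else 0)"
        unfolding tape_def using that by (intro sum.cong) (auto simp: cell_def)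
      then show ?thesis using assms(2) by (simp add: sum.delta)
    qed
    \<comment> \<open>Validity is carried along the run because the output may not contain the
      blank.\<close>
    have invs: "\<forall>r. valid (s r) \<Longrightarrow> K \<in> Q \<Longrightarrow> (step ^^ t) (K, s) = (K', s') \<Longrightarrow> valid (s' r)" for t K s K' s' r
    proof (induction t arbitrary: K s)
      case (Suc t)
      obtain K1 s1 where st: "step (K, s) = (K1, s1)" by fastforce
      show ?case
      proof (rule Suc.IH[of s1 K1])
        show "\<forall>r. valid (s1 r)" using step_valid[OF Suc.prems(1) Q_wfc[OF Suc.prems(2)] st] by blast
        show "K1 \<in> Q" using Q_step[OF Suc.prems(2,1)] st by (metis fst_conv)
        show "(step ^^ t) (K1, s1) = (K', s')" using Suc.prems(3) st by (metis comp_apply funpow_Suc_right)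
      qed
    qed simp
    have val': "valid (s' 0)" using invs[OF val cQ run] .
    have len: "length (?s r) \<le> length w" for r by simp
    obtain u where u: "u \<le> t * (2 * (length w + t) + 2)"
        "reach u (Scan [c], tape m ?s, 0) (Scan [], tape m s', 0)"
      using reach_steps[OF cQ val run len] by blast
    have "tm_init w = (f (Scan [c]), tape m ?s, 0)"
      by (auto simp: tm_init_def f tape0 cell_def fun_eq_iff)
    then have "(tm_step machine ^^ u) (tm_init w) = (f (Scan []), tape m s', 0)"
      using u(2) by (simp add: reach_def)
    moreover have "0 \<notin> set (rev (s' 0))" using val' by (auto simp: valid_def)
    moreover have "tape m s' = cell (s' 0)" using tape0[of s'] s' by auto
    ultimately show ?thesis
      unfolding tm_halts_with_def using u(1)
      by (intro exI[of _ u]) (auto simp: cell_def machine_def)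
  qed
  then show ?thesis using machine_wf by blast
qed

section \<open>Polynomial-time functions on words\<close>

text \<open>Quantifying over the rest \<open>K\<close> of the program makes the notion composable,
  and \<open>t\<close> is only an upper bound so that estimates can be weakened freely.\<close>

definition runs :: "com \<Rightarrow> store \<Rightarrow> nat \<Rightarrow> store \<Rightarrow> bool" where
  "runs c s t s' \<longleftrightarrow> (\<forall>K. \<exists>u\<le>t. (step ^^ u) (c # K, s) = (K, s'))"

lemma runs_mono: "runs c s t s' \<Longrightarrow> t \<le> t' \<Longrightarrow> runs c s t' s'"
  unfolding runs_def by (meson le_trans)

lemma runs_step:
  assumes "\<And>K. step (c # K, s) = (K' @ K, s1)"
    and "\<And>K. \<exists>u\<le>t. (step ^^ u) (K' @ K, s1) = (K, s')"
  shows "runs c s (Suc t) s'"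
  unfolding runs_def
proof
  fix K
  obtain u where "u \<le> t" "(step ^^ u) (K' @ K, s1) = (K, s')" using assms(2) by blast
  then show "\<exists>u\<le>Suc t. (step ^^ u) (c # K, s) = (K, s')"
    using assms(1) by (intro exI[of _ "Suc u"]) (simp add: funpow_swap1)
qed

lemma runs_seq_aux:
  assumes "runs c s t s1" "runs d s1 u s2"
  shows "\<exists>v\<le>t + u. (step ^^ v) (c # d # K, s) = (K, s2)"
proof -
  obtain v where v: "v \<le> t" "(step ^^ v) (c # d # K, s) = (d # K, s1)"
    using assms(1) unfolding runs_def by blast
  obtain v' where v': "v' \<le> u" "(step ^^ v') (d # K, s1) = (K, s2)"
    using assms(2) unfolding runs_def by blast
  have "(step ^^ (v' + v)) (c # d # K, s) = (K, s2)"
    unfolding funpow_add o_apply v v' ..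
  then show ?thesis using v(1) v'(1) by (intro exI[of _ "v' + v"]) simp
qed

lemma runs_Skip: "runs Skip s 1 s"
  using runs_step[of Skip s "[]" s 0 s] by simp

lemma runs_Push: "runs (Push r a) s 1 (s(r := a # s r))"
  using runs_step[of "Push r a" s "[]" "s(r := a # s r)" 0 "s(r := a # s r)"] by simp

lemma runs_Seq:
  assumes "runs c s t s1" "runs d s1 u s2"
  shows "runs (Seq c d) s (Suc (t + u)) s2"
  by (rule runs_step[of _ _ "[c, d]" s]) (use runs_seq_aux[OF assms] in auto)

lemma runs_Loop_Nil:
  assumes "s r = []"
  shows "runs (Loop r f) s 1 s"
  using runs_step[of "Loop r f" s "[]" s 0 s] assms by simp

lemma runs_Loop_Cons:
  assumes "s r = a # x" "runs (f a) (s(r := x)) t s1" "runs (Loop r f) s1 u s2"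
  shows "runs (Loop r f) s (Suc (t + u)) s2"
  by (rule runs_step[of _ _ "[f a, Loop r f]" "s(r := x)"])
    (use assms(1) runs_seq_aux[OF assms(2,3)] in auto)

lemma runs_length:
  assumes "runs c s t s'"
  shows "length (s' r) \<le> length (s r) + t"
proof -
  have "(step ^^ u) (K, s) = (K', s') \<Longrightarrow> length (s' r) \<le> length (s r) + u" for u K s K'
  proof (induction u arbitrary: K s)
    case (Suc u)
    obtain K1 s1 where st: "step (K, s) = (K1, s1)" by fastforce
    then have "(step ^^ u) (K1, s1) = (K', s')"
      using Suc.prems by (metis comp_apply funpow_Suc_right)
    from Suc.IH[OF this] step_length[OF st, of r] show ?case by simp
  qed simp
  moreover obtain u where "u \<le> t" "(step ^^ u) ([c], s) = ([], s')"
    using assms unfolding runs_def by blast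
  ultimately show ?thesis by fastforce
qed

text \<open>Pouring a stack into another reverses it. Moves that keep the order therefore take two
  passes, and a copy takes \<open>mv\<close> into a scratch register followed by
  \<open>mv2\<close>.\<close>

definition mv :: "nat \<Rightarrow> nat \<Rightarrow> com" where
  "mv r t = Loop r (Push t)"

definition mv2 :: "nat \<Rightarrow> nat \<Rightarrow> nat \<Rightarrow> com" where
  "mv2 r t u = Loop r (\<lambda>a. Seq (Push t a) (Push u a))"

definition clear :: "nat \<Rightarrow> com" where
  "clear r = Loop r (\<lambda>_. Skip)"

lemma runs_mv:
  assumes "r \<noteq> t"
  shows "runs (mv r t) s (2 * length (s r) + 1) (s(r := [], t := rev (s r) @ s t))"
proof (induction "s r" arbitrary: s)
  case Nil
  then have upd: "s(r := [], t := rev (s r) @ s t) = s" by auto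
  show ?case unfolding upd mv_def by (rule runs_mono[OF runs_Loop_Nil]) (use Nil in auto)
next
  case (Cons a x)
  let ?s = "s(r := x, t := a # s t)"
  have x: "x = ?s r" using assms by simp
  have "runs (Push t a) (s(r := x)) 1 ?s"
    using runs_Push[of t a "s(r := x)"] assms by (simp add: fun_upd_twist)
  moreover have "runs (Loop r (Push t)) ?s (2 * length x + 1) (s(r := [], t := rev (s r) @ s t))"
  proof -
    have "?s(r := [], t := rev (?s r) @ ?s t) = s(r := [], t := rev (s r) @ s t)"
      using assms Cons.hyps(2)[symmetric] by (auto simp: fun_eq_iff)
    with Cons.hyps(1)[of ?s, OF x] x show ?thesis unfolding mv_def by metis
  qed
  ultimately show ?case
    using runs_Loop_Cons[of s r a x, OF Cons.hyps(2)[symmetric]] Cons.hyps(2)[symmetric] unfolding mv_def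
    by fastforce
qed

lemma runs_mv2:
  assumes "r \<noteq> t" "r \<noteq> u" "t \<noteq> u"
  shows "runs (mv2 r t u) s (4 * length (s r) + 1)
    (s(r := [], t := rev (s r) @ s t, u := rev (s r) @ s u))"
proof (induction "s r" arbitrary: s)
  case Nil
  then have upd: "s(r := [], t := rev (s r) @ s t, u := rev (s r) @ s u) = s" by auto
  show ?case unfolding upd mv2_def by (rule runs_mono[OF runs_Loop_Nil]) (use Nil in auto)
next
  case (Cons a x)
  let ?s = "s(r := x, t := a # s t, u := a # s u)"
  have x: "x = ?s r" using assms by simp
  have "runs (Seq (Push t a) (Push u a)) (s(r := x)) 3 ?s"
    using runs_Seq[OF runs_Push[of t a "s(r := x)"] runs_Push[of u a]] assms
    by (simp add: numeral_3_eq_3)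
  moreover have "runs (mv2 r t u) ?s (4 * length x + 1)
      (s(r := [], t := rev (s r) @ s t, u := rev (s r) @ s u))"
  proof -
    have "?s(r := [], t := rev (?s r) @ ?s t, u := rev (?s r) @ ?s u) =
        s(r := [], t := rev (s r) @ s t, u := rev (s r) @ s u)"
      using assms Cons.hyps(2)[symmetric] by (auto simp: fun_eq_iff)
    with Cons.hyps(1)[of ?s, OF x] x show ?thesis by metis
  qed
  ultimately have "runs (mv2 r t u) s (Suc (3 + (4 * length x + 1)))
      (s(r := [], t := rev (s r) @ s t, u := rev (s r) @ s u))"
    unfolding mv2_def by (intro runs_Loop_Cons[of s r a x, OF Cons.hyps(2)[symmetric]])
  moreover have "Suc (3 + (4 * length x + 1)) = 4 * length (s r) + 1"
    using Cons.hyps(2)[symmetric] by simp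
  ultimately show ?case by metis
qed

lemma runs_clear: "runs (clear r) s (2 * length (s r) + 1) (s(r := []))"
proof (induction "s r" arbitrary: s)
  case Nil
  then have upd: "s(r := []) = s" by auto
  show ?case unfolding upd clear_def by (rule runs_mono[OF runs_Loop_Nil]) (use Nil in auto)
next
  case (Cons a x)
  have x: "x = (s(r := x)) r" by simp
  have "runs (Loop r (\<lambda>_. Skip)) (s(r := x)) (2 * length x + 1) (s(r := []))"
    using Cons.hyps(1)[of "s(r := x)", OF x] unfolding clear_def by simp
  then show ?case
    using runs_Loop_Cons[of s r a x "\<lambda>_. Skip", OF Cons.hyps(2)[symmetric] runs_Skip] Cons.hyps(2)[symmetric]
    unfolding clear_def by fastforce
qed

text \<open>Well-formedness without a bound on the registers. The bound is recovered once for the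
  finished program in \<open>wfs_wfc\<close>, again because only seven bodies of each loop
  count.\<close>

primrec wfs :: "com \<Rightarrow> bool" where
  "wfs Skip = True"
| "wfs (Push r a) = (1 \<le> a \<and> a < 8)"
| "wfs (Seq c d) = (wfs c \<and> wfs d)"
| "wfs (Loop r f) = (\<forall>a\<in>{1..<8}. wfs (f a))"

lemma wfc_mono: "wfc m c \<Longrightarrow> m \<le> m' \<Longrightarrow> wfc m' c"
  by (induction c) auto

lemma wfs_wfc: "wfs c \<Longrightarrow> \<exists>m. wfc m c"
proof (induction c)
  case (Push r a)
  then show ?case by (intro exI[of _ "Suc r"]) simp
next
  case (Seq c d)
  then obtain m m' where "wfc m c" "wfc m' d" by auto
  then have "wfc (max m m') (Seq c d)"
    using wfc_mono[of m c "max m m'"] wfc_mono[of m' d "max m m'"] by simp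
  then show ?case by blast
next
  case (Loop r f)
  then have "\<forall>a\<in>{1..<8}. \<exists>m. wfc m (f a)" by simp
  from bchoice[OF this] obtain M where M: "\<forall>a\<in>{1..<8}. wfc (M a) (f a)" by blast
  have "wfc (Suc r + sum M {1..<8}) (f a)" if a: "a \<in> {1..<8}" for a
  proof (rule wfc_mono)
    show "wfc (M a) (f a)" using M a by blast
    have "M a \<le> sum M {1..<8}" by (rule member_le_sum[OF a]) auto
    then show "M a \<le> Suc r + sum M {1..<8}" by linarith
  qed
  then have "wfc (Suc r + sum M {1..<8}) (Loop r f)" by (simp only: wfc.simps) simp
  then show ?case by blast
qed simp

lemma wfs_basic [simp]: "wfs (mv r t)" "wfs (mv2 r t u)" "wfs (clear r)"
  by (simp_all add: mv_def mv2_def clear_def)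

text \<open>Monotonicity is included since bounds are constantly evaluated at overestimates of
  lengths.\<close>

definition polyb :: "(nat \<Rightarrow> nat) \<Rightarrow> bool" where
  "polyb p \<longleftrightarrow> mono p \<and> (\<exists>c d. \<forall>n. p n \<le> c * (n + 1) ^ d)"

lemma polyb_mono: "polyb p \<Longrightarrow> m \<le> n \<Longrightarrow> p m \<le> p n"
  by (auto simp: polyb_def mono_def)

lemma polyb_const: "polyb (\<lambda>n. a)"
  unfolding polyb_def mono_def by (intro conjI exI[of _ a] exI[of _ 0]) simp_all

lemma polyb_id: "polyb (\<lambda>n. n)"
  unfolding polyb_def mono_def by (intro conjI exI[of _ 1]) simp_all

lemma polyb_add:
  assumes "polyb p" "polyb q"
  shows "polyb (\<lambda>n. p n + q n)"
proof -
  obtain c d c' d' where p: "\<And>n. p n \<le> c * (n + 1) ^ d" and q: "\<And>n. q n \<le> c' * (n + 1) ^ d'"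
    using assms unfolding polyb_def by blast
  have "p n + q n \<le> (c + c') * (n + 1) ^ (d + d')" for n
  proof -
    have "c * (n + 1) ^ d \<le> c * (n + 1) ^ (d + d')" "c' * (n + 1) ^ d' \<le> c' * (n + 1) ^ (d + d')"
      by (intro mult_left_mono power_increasing; simp; fail)+
    then show ?thesis using p[of n] q[of n] unfolding add_mult_distrib by linarith
  qed
  then show ?thesis using assms unfolding polyb_def by (auto simp: mono_def intro: add_mono)
qed

lemma polyb_mult:
  assumes "polyb p" "polyb q"
  shows "polyb (\<lambda>n. p n * q n)"
proof -
  obtain c d c' d' where p: "\<And>n. p n \<le> c * (n + 1) ^ d" and q: "\<And>n. q n \<le> c' * (n + 1) ^ d'"
    using assms unfolding polyb_def by blast
  have "p n * q n \<le> (c * c') * (n + 1) ^ (d + d')" for n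
    using mult_le_mono[OF p[of n] q[of n]] by (simp add: power_add mult_ac)
  then show ?thesis using assms unfolding polyb_def by (auto simp: mono_def intro: mult_le_mono)
qed

lemma polyb_comp:
  assumes "polyb p" "polyb q"
  shows "polyb (\<lambda>n. p (q n))"
proof -
  obtain c d c' d' where p: "\<And>n. p n \<le> c * (n + 1) ^ d" and q: "\<And>n. q n \<le> c' * (n + 1) ^ d'"
    using assms unfolding polyb_def by blast
  have "p (q n) \<le> (c * (c' + 1) ^ d) * (n + 1) ^ (d' * d)" for n
  proof -
    have "q n + 1 \<le> (c' + 1) * (n + 1) ^ d'"
      using q[of n] one_le_power[of "n + 1" d'] unfolding add_mult_distrib by linarith
    then have "(q n + 1) ^ d \<le> ((c' + 1) * (n + 1) ^ d') ^ d" by (rule power_mono) simp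
    then have "c * (q n + 1) ^ d \<le> c * ((c' + 1) * (n + 1) ^ d') ^ d" by (rule mult_left_mono) simp
    with p[of "q n"] show ?thesis unfolding power_mult_distrib power_mult mult.assoc by linarith
  qed
  then show ?thesis using assms unfolding polyb_def by (auto simp: mono_def)
qed

lemma polyb_sum:
  assumes "finite A" "\<And>a. a \<in> A \<Longrightarrow> polyb (p a)"
  shows "polyb (\<lambda>n. \<Sum>a\<in>A. p a n)"
  using assms by (induction A rule: finite_induct) (auto intro: polyb_add polyb_const)

section \<open>Polynomial-time functions of several words\<close>

definition env :: "nat \<Rightarrow> nat list list \<Rightarrow> bool" where
  "env k e \<longleftrightarrow> length e = k \<and> (\<forall>x\<in>set e. valid x)"

definition esize :: "nat list list \<Rightarrow> nat" where
  "esize e = sum_list (map length e)"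

lemma env_Cons [simp]: "env (Suc k) (x # e) \<longleftrightarrow> valid x \<and> env k e"
  by (auto simp: env_def)

lemma env_map: "\<forall>r. valid (s r) \<Longrightarrow> length rs = k \<Longrightarrow> env k (map s rs)"
  by (auto simp: env_def)

lemma esize_Cons [simp]: "esize (x # e) = length x + esize e"
  by (simp add: esize_def)

lemma esize_nth: "i < length e \<Longrightarrow> length (e ! i) \<le> esize e"
  by (simp add: esize_def) (metis elem_le_sum_list length_map nth_map)

text \<open>The registers from \<open>m\<close> on are scratch space, empty before the run and, for
  a target \<open>v < m\<close>, empty again after it. The arguments survive, so they can be read
  any number of times, and several arguments may share one register.\<close>

definition computes :: "nat list \<Rightarrow> nat \<Rightarrow> nat \<Rightarrow> (nat \<Rightarrow> nat) \<Rightarrow> (nat list list \<Rightarrow> nat list) \<Rightarrow> com \<Rightarrow> bool" where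
  "computes rs v m p F c \<longleftrightarrow> wfs c \<and> (\<forall>s. (\<forall>r. valid (s r)) \<and> (\<forall>r\<ge>m. s r = []) \<and> s v = [] \<longrightarrow>
     runs c s (p (esize (map s rs))) (s(v := F (map s rs))))"

text \<open>The time bound must not depend on the choice of the registers; this is what makes composition work.\<close>
definition FP :: "nat \<Rightarrow> (nat list list \<Rightarrow> nat list) \<Rightarrow> bool" where
  "FP k F \<longleftrightarrow> (\<forall>e. env k e \<longrightarrow> valid (F e)) \<and>
     (\<exists>p. polyb p \<and> (\<forall>rs v m. length rs = k \<and> (\<forall>r\<in>set rs. r < m \<and> r \<noteq> v) \<and> v < m \<longrightarrow>
        (\<exists>c. computes rs v m p F c)))"

lemma FP_valid: "FP k F \<Longrightarrow> env k e \<Longrightarrow> valid (F e)"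
  by (simp add: FP_def)

lemma computesD:
  assumes "computes rs v m p F c" "\<forall>r. valid (s r)" "\<forall>r\<ge>m. s r = []" "s v = []"
  shows "runs c s (p (esize (map s rs))) (s(v := F (map s rs)))"
  using assms unfolding computes_def by blast

lemma FP_obtain:
  assumes "FP k F"
  obtains p where "polyb p" and "\<And>rs v m. length rs = k \<Longrightarrow> \<forall>r\<in>set rs. r < m \<and> r \<noteq> v \<Longrightarrow>
    v < m \<Longrightarrow> \<exists>c. computes rs v m p F c"
  using assms unfolding FP_def by blast

lemma FP_intro:
  assumes "\<And>e. env k e \<Longrightarrow> valid (F e)" "polyb p"
    and "\<And>rs v m. length rs = k \<Longrightarrow> \<forall>r\<in>set rs. r < m \<and> r \<noteq> v \<Longrightarrow> v < m \<Longrightarrow>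
      \<exists>c. wfs c \<and> (\<forall>s. (\<forall>r. valid (s r)) \<longrightarrow> (\<forall>r\<ge>m. s r = []) \<longrightarrow> s v = [] \<longrightarrow>
        runs c s (p (esize (map s rs))) (s(v := F (map s rs))))"
  shows "FP k F"
  unfolding FP_def
proof (intro conjI allI impI exI[of _ p])
  fix rs :: "nat list" and v m :: nat
  assume "length rs = k \<and> (\<forall>r\<in>set rs. r < m \<and> r \<noteq> v) \<and> v < m"
  then obtain c where "wfs c" "\<forall>s. (\<forall>r. valid (s r)) \<longrightarrow> (\<forall>r\<ge>m. s r = []) \<longrightarrow> s v = [] \<longrightarrow>
      runs c s (p (esize (map s rs))) (s(v := F (map s rs)))"
    using assms(3)[of rs m v] by blast
  then have "computes rs v m p F c" unfolding computes_def by blast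
  then show "\<exists>c. computes rs v m p F c" ..
qed (use assms(1,2) in auto)

lemma FP_cong:
  assumes "FP k F" "\<And>e. env k e \<Longrightarrow> F e = F' e"
  shows "FP k F'"
proof -
  obtain p where p: "polyb p" "\<And>rs v m. length rs = k \<Longrightarrow> \<forall>r\<in>set rs. r < m \<and> r \<noteq> v \<Longrightarrow>
    v < m \<Longrightarrow> \<exists>c. computes rs v m p F c" by (rule FP_obtain[OF assms(1)]; rule that; assumption)
  show ?thesis
  proof (rule FP_intro[OF _ p(1)])
    show "valid (F' e)" if "env k e" for e using FP_valid[OF assms(1) that] assms(2)[OF that] by simp
    fix rs :: "nat list" and v m :: nat
    assume a: "length rs = k" "\<forall>r\<in>set rs. r < m \<and> r \<noteq> v" "v < m"
    obtain c where "computes rs v m p F c" using p(2)[OF a] by blast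
    have "runs c s (p (esize (map s rs))) (s(v := F' (map s rs)))"
      if "\<forall>r. valid (s r)" "\<forall>r\<ge>m. s r = []" "s v = []" for s
      using computesD[OF \<open>computes rs v m p F c\<close> that] assms(2)[OF env_map[OF that(1) a(1)]] by simp
    with \<open>computes rs v m p F c\<close>
    show "\<exists>c. wfs c \<and> (\<forall>s. (\<forall>r. valid (s r)) \<longrightarrow> (\<forall>r\<ge>m. s r = []) \<longrightarrow> s v = [] \<longrightarrow>
        runs c s (p (esize (map s rs))) (s(v := F' (map s rs))))"
      unfolding computes_def by blast
  qed
qed

text \<open>The output is no longer than the running time, because each step pushes at most one
  symbol.\<close>

lemma FP_size:
  assumes "FP k F"
  obtains q where "polyb q" "\<And>e. env k e \<Longrightarrow> length (F e) \<le> q (esize e)"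
proof -
  obtain p where p: "polyb p" "\<And>rs v m. length rs = k \<Longrightarrow> \<forall>r\<in>set rs. r < m \<and> r \<noteq> v \<Longrightarrow>
    v < m \<Longrightarrow> \<exists>c. computes rs v m p F c" by (rule FP_obtain[OF assms]; rule that; assumption)
  obtain c where c: "computes [0..<k] k (Suc k) p F c" using p(2)[of "[0..<k]" "Suc k" k] by auto
  have "length (F e) \<le> p (esize e)" if "env k e" for e
  proof -
    let ?s = "\<lambda>r. if r < k then e ! r else []"
    have e: "map ?s [0..<k] = e" using that by (auto simp: env_def intro: nth_equalityI)
    have "\<forall>r. valid (?s r)" using that by (auto simp: env_def)
    then have "runs c ?s (p (esize e)) (?s(k := F e))"
      using computesD[OF c, of ?s] unfolding e by auto
    from runs_length[OF this, of k] show ?thesis by simp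
  qed
  with p(1) show ?thesis using that by blast
qed

text \<open>The same program is run on other registers. The factor \<open>j\<close> accounts for an
  argument of the environment being used up to \<open>j\<close> times.\<close>

lemma FP_ren:
  assumes "FP j F" "length is = j" "\<forall>i\<in>set is. i < k"
  shows "FP k (\<lambda>e. F (map ((!) e) is))"
proof -
  obtain p where p: "polyb p" "\<And>rs v m. length rs = j \<Longrightarrow> \<forall>r\<in>set rs. r < m \<and> r \<noteq> v \<Longrightarrow>
    v < m \<Longrightarrow> \<exists>c. computes rs v m p F c" by (rule FP_obtain[OF assms(1)]; rule that; assumption)
  show ?thesis
  proof (rule FP_intro)
    show "valid (F (map ((!) e) is))" if "env k e" for e
      using that assms(2,3) by (intro FP_valid[OF assms(1)]) (auto simp: env_def)
    show "polyb (\<lambda>n. p (j * n))" by (intro polyb_comp[OF p(1)] polyb_mult polyb_const polyb_id)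
    fix rs :: "nat list" and v m :: nat
    assume a: "length rs = k" "\<forall>r\<in>set rs. r < m \<and> r \<noteq> v" "v < m"
    then obtain c where c: "computes (map ((!) rs) is) v m p F c"
      using p(2)[of "map ((!) rs) is" m v] assms(2,3) by auto
    have *: "map s (map ((!) rs) is) = map ((!) (map s rs)) is" for s :: store
      using assms(3) a(1) by simp
    have "runs c s (p (j * esize (map s rs))) (s(v := F (map ((!) (map s rs)) is)))"
      if "\<forall>r. valid (s r)" "\<forall>r\<ge>m. s r = []" "s v = []" for s
    proof -
      have "esize (map ((!) (map s rs)) is) \<le> j * esize (map s rs)"
        using assms(3) unfolding assms(2)[symmetric]
      proof (induction "is")
        case (Cons i "is")
        with esize_nth[of i "map s rs"] a(1) show ?case by simp
      qed (simp add: esize_def)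
      from runs_mono[OF computesD[OF c that, unfolded *] polyb_mono[OF p(1) this]]
      show ?thesis .
    qed
    with c show "\<exists>c. wfs c \<and> (\<forall>s. (\<forall>r. valid (s r)) \<longrightarrow> (\<forall>r\<ge>m. s r = []) \<longrightarrow> s v = [] \<longrightarrow>
        runs c s (p (j * esize (map s rs))) (s(v := F (map ((!) (map s rs)) is))))"
      unfolding computes_def by blast
  qed
qed

lemma FP_weaken:
  assumes "FP k F"
  shows "FP (Suc k) (\<lambda>e. F (tl e))"
proof (rule FP_cong)
  show "FP (Suc k) (\<lambda>e. F (map ((!) e) [1..<Suc k]))" by (rule FP_ren[OF assms]) auto
  show "F (map ((!) e) [1..<Suc k]) = F (tl e)" if "env (Suc k) e" for e
    using that by (intro arg_cong[where f = F] nth_equalityI) (auto simp: env_def nth_tl simp del: upt_Suc)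
qed

lemma FP_var:
  assumes "i < k"
  shows "FP k (\<lambda>e. e ! i)"
proof (rule FP_intro)
  show "valid (e ! i)" if "env k e" for e using that assms by (auto simp: env_def)
  show "polyb (\<lambda>n. 6 * n + 3)" by (intro polyb_add polyb_mult polyb_const polyb_id)
  fix rs :: "nat list" and v m :: nat
  assume a: "length rs = k" "\<forall>r\<in>set rs. r < m \<and> r \<noteq> v" "v < m"
  let ?r = "rs ! i"
  have r: "?r < m" "?r \<noteq> v" "?r \<noteq> m" "v \<noteq> m" using a assms by auto
  \<comment> \<open>The first pass reverses the argument into the scratch register \<open>m\<close>;
    the second restores it and at the same time fills \<open>v\<close>.\<close>
  let ?c = "Seq (mv ?r m) (mv2 m ?r v)"
  have "runs ?c s (6 * esize (map s rs) + 3) (s(v := map s rs ! i))"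
    if "\<forall>r. valid (s r)" "\<forall>r\<ge>m. s r = []" "s v = []" for s
  proof -
    let ?s = "s(?r := [], m := rev (s ?r) @ s m)"
    have "runs ?c s (Suc ((2 * length (s ?r) + 1) + (4 * length (?s m) + 1)))
        (?s(m := [], ?r := rev (?s m) @ ?s ?r, v := rev (?s m) @ ?s v))"
      by (rule runs_Seq[OF runs_mv runs_mv2]) (use r in auto)
    moreover have "?s(m := [], ?r := rev (?s m) @ ?s ?r, v := rev (?s m) @ ?s v) = s(v := map s rs ! i)"
      using r that a(1) assms by (auto simp: fun_eq_iff)
    moreover have "length (s ?r) \<le> esize (map s rs)" using esize_nth[of i "map s rs"] a(1) assms by simp
    ultimately have "runs ?c s (Suc ((2 * length (s ?r) + 1) + (4 * length (?s m) + 1))) (s(v := map s rs ! i))"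
      by metis
    moreover have "length (?s m) = length (s ?r)" using that by simp
    ultimately show ?thesis using \<open>length (s ?r) \<le> _\<close> by (elim runs_mono) simp
  qed
  then show "\<exists>c. wfs c \<and> (\<forall>s. (\<forall>r. valid (s r)) \<longrightarrow> (\<forall>r\<ge>m. s r = []) \<longrightarrow> s v = [] \<longrightarrow>
        runs c s (6 * esize (map s rs) + 3) (s(v := map s rs ! i)))"
    by (intro exI[of _ ?c]) simp
qed

lemma FP_Nil: "FP k (\<lambda>e. [])"
proof (rule FP_intro[OF _ polyb_const[of 1]])
  show "\<exists>c. wfs c \<and> (\<forall>s. (\<forall>r. valid (s r)) \<longrightarrow> (\<forall>r\<ge>m. s r = []) \<longrightarrow> s v = [] \<longrightarrow>
        runs c s 1 (s(v := [])))" for v m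
    using runs_Skip by (intro exI[of _ Skip]) (simp add: fun_upd_idem)
qed simp

lemma FP_Cons:
  assumes "1 \<le> a" "a < 8" "FP k F"
  shows "FP k (\<lambda>e. a # F e)"
proof -
  obtain p where p: "polyb p" "\<And>rs v m. length rs = k \<Longrightarrow> \<forall>r\<in>set rs. r < m \<and> r \<noteq> v \<Longrightarrow>
    v < m \<Longrightarrow> \<exists>c. computes rs v m p F c" by (rule FP_obtain[OF assms(3)]; rule that; assumption)
  show ?thesis
  proof (rule FP_intro)
    show "valid (a # F e)" if "env k e" for e using FP_valid[OF assms(3) that] assms by simp
    show "polyb (\<lambda>n. p n + 2)" by (intro polyb_add polyb_const p)
    fix rs :: "nat list" and v m :: nat
    assume a: "length rs = k" "\<forall>r\<in>set rs. r < m \<and> r \<noteq> v" "v < m"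
    obtain c where c: "computes rs v m p F c" using p(2)[OF a] by blast
    have "runs (Seq c (Push v a)) s (p (esize (map s rs)) + 2) (s(v := a # F (map s rs)))"
      if "\<forall>r. valid (s r)" "\<forall>r\<ge>m. s r = []" "s v = []" for s
      using runs_Seq[OF computesD[OF c that] runs_Push[of v a]] by simp
    moreover have "wfs (Seq c (Push v a))" using c assms by (simp add: computes_def)
    ultimately show "\<exists>c. wfs c \<and> (\<forall>s. (\<forall>r. valid (s r)) \<longrightarrow> (\<forall>r\<ge>m. s r = []) \<longrightarrow> s v = [] \<longrightarrow>
        runs c s (p (esize (map s rs)) + 2) (s(v := a # F (map s rs))))"
      by blast
  qed
qed

text \<open>Recursion on words whose step also sees the remaining word \<open>x\<close>. This
  look-ahead is what allows tokens to be parsed later without a separate parser.\<close>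

primrec para :: "('a \<Rightarrow> 'a list \<Rightarrow> 'b \<Rightarrow> 'b) \<Rightarrow> 'b \<Rightarrow> 'a list \<Rightarrow> 'b" where
  "para h z [] = z"
| "para h z (a # x) = h a x (para h z x)"

text \<open>The allowance \<open>b\<close> depends on the remaining word and the parameters but not
  on the recursive value \<open>r\<close>. The lengths therefore add up to a polynomial instead of
  compounding, and with them the running times of all calls of \<open>H\<close> stay
  polynomial.\<close>

lemma FP_rec:
  assumes F: "FP k F" and G: "FP k G"
    and H: "\<And>a. 1 \<le> a \<Longrightarrow> a < 8 \<Longrightarrow> FP (Suc (Suc k)) (H a)"
    and b: "polyb b" "\<And>a x r e. 1 \<le> a \<Longrightarrow> a < 8 \<Longrightarrow> valid x \<Longrightarrow> valid r \<Longrightarrow> env k e \<Longrightarrow>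
      length (H a (x # r # e)) \<le> length r + b (length x + esize e)"
  shows "FP k (\<lambda>e. para (\<lambda>a x r. H a (x # r # e)) (G e) (F e))"
proof -
  obtain pF where pF: "polyb pF" "\<And>rs v m. length rs = k \<Longrightarrow> \<forall>r\<in>set rs. r < m \<and> r \<noteq> v \<Longrightarrow>
    v < m \<Longrightarrow> \<exists>c. computes rs v m pF F c" by (rule FP_obtain[OF F]; rule that; assumption)
  obtain pG where pG: "polyb pG" "\<And>rs v m. length rs = k \<Longrightarrow> \<forall>r\<in>set rs. r < m \<and> r \<noteq> v \<Longrightarrow>
    v < m \<Longrightarrow> \<exists>c. computes rs v m pG G c" by (rule FP_obtain[OF G]; rule that; assumption)
  have "\<forall>a\<in>{1..<8}. \<exists>p. polyb p \<and> (\<forall>rs v m. length rs = Suc (Suc k) \<and> (\<forall>r\<in>set rs. r < m \<and> r \<noteq> v) \<and>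
    v < m \<longrightarrow> (\<exists>c. computes rs v m p (H a) c))"
    using H unfolding FP_def by (meson atLeastLessThan_iff)
  then obtain pH' where pH': "\<forall>a\<in>{1..<8}. polyb (pH' a) \<and> (\<forall>rs v m. length rs = Suc (Suc k) \<and>
    (\<forall>r\<in>set rs. r < m \<and> r \<noteq> v) \<and> v < m \<longrightarrow> (\<exists>c. computes rs v m (pH' a) (H a) c))"
    by metis
  define pH where "pH n = (\<Sum>a\<in>{1..<8}. pH' a n)" for n
  have pH: "polyb pH" unfolding pH_def using pH' by (intro polyb_sum) auto
  have pH'_le: "pH' a n \<le> pH n" if "a \<in> {1..<8}" for a n
    unfolding pH_def using that by (intro member_le_sum) auto
  obtain qF where qF: "polyb qF" "\<And>e. env k e \<Longrightarrow> length (F e) \<le> qF (esize e)" by (rule FP_size[OF F]; rule that; assumption)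
  obtain qG where qG: "polyb qG" "\<And>e. env k e \<Longrightarrow> length (G e) \<le> qG (esize e)" by (rule FP_size[OF G]; rule that; assumption)
  let ?R = "\<lambda>e. para (\<lambda>a x r. H a (x # r # e)) (G e)"
  have R_valid: "valid (?R e x)" if "env k e" "valid x" for e x
    using that(2)
  proof (induction x)
    case (Cons a x)
    then show ?case using that(1) by (auto intro!: FP_valid[OF H])
  qed (use FP_valid[OF G that(1)] in simp)
  have R_len: "length (?R e x) \<le> qG (esize e) + length x * b (length x + esize e)"
    if "env k e" "valid x" for e x
    using that(2)
  proof (induction x)
    case (Cons a x)
    have "length (?R e (a # x)) \<le> length (?R e x) + b (length x + esize e)"
      using Cons that(1) R_valid[OF that(1)] by (auto intro!: b(2))
    also have "\<dots> \<le> qG (esize e) + length x * b (length x + esize e) + b (length x + esize e)"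
      using Cons by simp
    also have "\<dots> = qG (esize e) + Suc (length x) * b (length x + esize e)" by simp
    also have "\<dots> \<le> qG (esize e) + Suc (length x) * b (length (a # x) + esize e)"
      by (intro add_left_mono mult_left_mono polyb_mono[OF b(1)]) auto
    finally show ?case by simp
  qed (use qG(2)[OF that(1)] in simp)
  \<comment> \<open>\<open>A\<close> bounds the length of every intermediate value, \<open>T\<close>
    the time of one pass of the loop body, and \<open>P\<close> the total time, all in terms of the
    size of the environment.\<close>
  define A where "A n = qG n + qF n * b (qF n + n)" for n
  have A: "polyb A" unfolding A_def
    by (intro polyb_add polyb_mult qG qF polyb_comp[OF b(1)] polyb_id)
  define T where "T n = pH (qF n + A n + n) + 6 * A n + 9" for n
  have T: "polyb T" unfolding T_def
    by (intro polyb_add polyb_mult polyb_comp[OF pH] polyb_const A qF polyb_id)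
  define P where "P n = pF n + pG n + (2 * qF n + 1) + (qF n * Suc (T n) + 1) + (2 * qF n + 1) + (4 * A n + 2) + 7" for n
  have P: "polyb P" unfolding P_def Suc_eq_plus1
    by (intro polyb_add polyb_mult polyb_const pF pG qF A T)
  show ?thesis
  proof (rule FP_intro[OF _ P])
    show "valid (?R e (F e))" if "env k e" for e
      using R_valid[OF that FP_valid[OF F that]] .
    fix rs :: "nat list" and v m :: nat
    assume a: "length rs = k" "\<forall>r\<in>set rs. r < m \<and> r \<noteq> v" "v < m"
    \<comment> \<open>Roles: \<open>?g\<close> holds the symbols still to be consumed,
      \<open>?x\<close> the suffix already consumed, \<open>?acc\<close> the recursive value for
      \<open>?x\<close>, \<open>?t\<close> receives the next value, and \<open>?f\<close> serves for
      moves that must keep the order.\<close>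
    let ?f = m and ?x = "m + 1" and ?acc = "m + 2" and ?g = "m + 3" and ?t = "m + 4"
    obtain cF where cF: "computes rs ?f (m + 1) pF F cF" using pF(2)[of rs "m + 1" ?f] a by fastforce
    obtain cG where cG: "computes rs ?acc (m + 3) pG G cG" using pG(2)[of rs "m + 3" ?acc] a by fastforce
    have "\<forall>a\<in>{1..<8}. \<exists>c. computes (?x # ?acc # rs) ?t (m + 5) (pH' a) (H a) c"
    proof
      fix i :: nat
      assume "i \<in> {1..<8}"
      with pH' have "(\<forall>rs v m. length rs = Suc (Suc k) \<and>
        (\<forall>r\<in>set rs. r < m \<and> r \<noteq> v) \<and> v < m \<longrightarrow> (\<exists>c. computes rs v m (pH' i) (H i) c))" by blast
      from this[rule_format, of "?x # ?acc # rs" "m + 5" ?t] a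
      show "\<exists>c. computes (?x # ?acc # rs) ?t (m + 5) (pH' i) (H i) c" by fastforce
    qed
    then obtain cH where cH: "\<And>a. a \<in> {1..<8} \<Longrightarrow> computes (?x # ?acc # rs) ?t (m + 5) (pH' a) (H a) (cH a)"
      by metis
    define body where "body a = Seq (cH a) (Seq (clear ?acc) (Seq (mv ?t ?f) (Seq (mv ?f ?acc) (Push ?x a))))" for a
    define c where "c = Seq cF (Seq cG (Seq (mv ?f ?g) (Seq (Loop ?g body) (Seq (clear ?x) (Seq (mv ?acc ?f) (mv ?f v))))))"
    have wf: "wfs c" using cF cG cH by (simp add: c_def body_def computes_def)
    have body_runs: "runs (body i) s (T (esize (map s rs)))
        (s(?x := i # s ?x, ?acc := ?R (map s rs) (i # s ?x)))"
      if i: "1 \<le> i" "i < 8" and s: "\<forall>r. valid (s r)" "\<forall>r\<ge>m + 4. s r = []" "s ?f = []"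
        "s ?acc = ?R (map s rs) (s ?x)" "length (s ?x) < qF (esize (map s rs))" for i s
    proof -
      let ?e = "map s rs"
      let ?n = "esize ?e"
      have e: "env k ?e" by (rule env_map[OF s(1) a(1)])
      have Rle: "length (?R ?e y) \<le> A ?n" if "valid y" "length y \<le> qF ?n" for y
      proof -
        have "length (?R ?e y) \<le> qG ?n + length y * b (length y + ?n)" by (rule R_len[OF e that(1)])
        also have "\<dots> \<le> A ?n" unfolding A_def
          by (intro add_left_mono mult_le_mono polyb_mono[OF b(1)] add_right_mono that(2))
        finally show ?thesis .
      qed
      let ?new = "?R ?e (i # s ?x)"
      have new: "length ?new \<le> A ?n" using s i by (intro Rle) auto
      have old: "length (s ?acc) \<le> A ?n" unfolding s(4) using s by (intro Rle) auto
      have e': "map s (?x # ?acc # rs) = s ?x # s ?acc # ?e" by simp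
      let ?s1 = "s(?t := ?new)"
      have newH: "?new = H i (s ?x # s ?acc # ?e)" unfolding s(4) by simp
      have 1: "runs (cH i) s (pH' i (esize (s ?x # s ?acc # ?e))) ?s1"
        unfolding newH e'[symmetric] by (rule computesD[OF cH]) (use i s in auto)
      let ?s2 = "?s1(?acc := [])"
      have 2: "runs (clear ?acc) ?s1 (2 * length (s ?acc) + 1) ?s2"
        using runs_clear[of ?acc ?s1] by simp
      let ?s3 = "?s2(?t := [], ?f := rev ?new)"
      have 3: "runs (mv ?t ?f) ?s2 (2 * length ?new + 1) ?s3"
        using runs_mv[of ?t ?f ?s2] s by simp
      let ?s4 = "?s3(?f := [], ?acc := ?new)"
      have 4: "runs (mv ?f ?acc) ?s3 (2 * length ?new + 1) ?s4"
        using runs_mv[of ?f ?acc ?s3] s by simp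
      let ?s5 = "?s4(?x := i # s ?x)"
      have 5: "runs (Push ?x i) ?s4 1 ?s5" using runs_Push[of ?x i ?s4] by simp
      have "?s5 = s(?x := i # s ?x, ?acc := ?new)" using s by (auto simp: fun_eq_iff)
      with runs_Seq[OF 1 runs_Seq[OF 2 runs_Seq[OF 3 runs_Seq[OF 4 5]]]]
      have R: "runs (body i) s (Suc (pH' i (esize (s ?x # s ?acc # ?e)) + Suc (2 * length (s ?acc) + 1 +
          Suc (2 * length ?new + 1 + Suc (2 * length ?new + 1 + 1))))) (s(?x := i # s ?x, ?acc := ?new))"
        unfolding body_def by simp
      have "pH' i (esize (s ?x # s ?acc # ?e)) \<le> pH (qF ?n + A ?n + ?n)"
        using i s old by (intro order.trans[OF pH'_le polyb_mono[OF pH]]) auto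
      then show ?thesis
        using new old by (intro runs_mono[OF R]) (simp add: T_def)
    qed
    \<comment> \<open>The recursion evaluates the word from its right end, so \<open>?g\<close>
      contains it reversed. The invariant is that \<open>?acc\<close> is the recursive value of
      \<open>?x\<close>; the last condition keeps \<open>?x\<close> short enough for the bound
      \<open>A\<close>.\<close>
    have loop_runs: "runs (Loop ?g body) s (length (s ?g) * Suc (T (esize (map s rs))) + 1)
        (s(?g := [], ?x := rev (s ?g) @ s ?x, ?acc := ?R (map s rs) (rev (s ?g) @ s ?x)))"
      if s: "\<forall>r. valid (s r)" "\<forall>r\<ge>m + 4. s r = []" "s ?f = []"
        "s ?acc = ?R (map s rs) (s ?x)" "length (s ?g) + length (s ?x) \<le> qF (esize (map s rs))" for s
      using s
    proof (induction "s ?g" arbitrary: s)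
      case Nil
      have upd: "s(?g := [], ?x := rev (s ?g) @ s ?x, ?acc := ?R (map s rs) (rev (s ?g) @ s ?x)) = s"
        using Nil by (auto simp: fun_eq_iff)
      show ?case unfolding upd by (rule runs_mono[OF runs_Loop_Nil]) (use Nil in auto)
    next
      case (Cons i y)
      let ?e = "map s rs"
      let ?s0 = "s(?g := y)"
      have e0: "map ?s0 rs = ?e" using a(2) by auto
      have i: "1 \<le> i" "i < 8" "valid y"
        using Cons.prems(1)[rule_format, of ?g] Cons.hyps(2)[symmetric] by auto
      let ?s1 = "?s0(?x := i # ?s0 ?x, ?acc := ?R ?e (i # ?s0 ?x))"
      have b: "runs (body i) ?s0 (T (esize ?e)) ?s1"
        using body_runs[of i ?s0] i Cons.prems Cons.hyps(2)[symmetric] unfolding e0 by simp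
      have e1: "map ?s1 rs = ?e" using a(2) by auto
      have "env k ?e" by (rule env_map[OF Cons.prems(1) a(1)])
      then have "valid (?R ?e (i # s ?x))" by (rule R_valid) (use i Cons.prems in simp)
      then have val: "\<forall>r. valid (?s1 r)" using i Cons.prems(1) by simp
      have "runs (Loop ?g body) ?s1 (length (?s1 ?g) * Suc (T (esize (map ?s1 rs))) + 1)
        (?s1(?g := [], ?x := rev (?s1 ?g) @ ?s1 ?x, ?acc := ?R (map ?s1 rs) (rev (?s1 ?g) @ ?s1 ?x)))"
        by (rule Cons.hyps(1)) (unfold e1, use val Cons.prems Cons.hyps(2)[symmetric] in auto)
      moreover have "?s1(?g := [], ?x := rev (?s1 ?g) @ ?s1 ?x, ?acc := ?R ?e (rev (?s1 ?g) @ ?s1 ?x)) =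
          s(?g := [], ?x := rev (s ?g) @ s ?x, ?acc := ?R ?e (rev (s ?g) @ s ?x))"
        unfolding Cons.hyps(2)[symmetric] by (auto simp: fun_eq_iff)
      ultimately have l: "runs (Loop ?g body) ?s1 (length y * Suc (T (esize ?e)) + 1)
          (s(?g := [], ?x := rev (s ?g) @ s ?x, ?acc := ?R ?e (rev (s ?g) @ s ?x)))"
        unfolding e1 by simp
      show ?case
        by (rule runs_mono[OF runs_Loop_Cons[of s ?g i y, OF Cons.hyps(2)[symmetric] b l]])
          (simp add: Cons.hyps(2)[symmetric])
    qed
    have "runs c s (P (esize (map s rs))) (s(v := ?R (map s rs) (F (map s rs))))"
      if s: "\<forall>r. valid (s r)" "\<forall>r\<ge>m. s r = []" "s v = []" for s
    proof -
      let ?e = "map s rs"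
      let ?n = "esize ?e"
      let ?r = "?R ?e (F ?e)"
      have e: "env k ?e" by (rule env_map[OF s(1) a(1)])
      have Fv: "valid (F ?e)" and Gv: "valid (G ?e)" using e FP_valid F G by auto
      have Fl: "length (F ?e) \<le> qF ?n" using qF(2)[OF e] .
      let ?s1 = "s(?f := F ?e)"
      have 1: "runs cF s (pF ?n) ?s1" by (rule computesD[OF cF]) (use s in auto)
      have e1: "map ?s1 rs = ?e" using a(2) by auto
      let ?s2 = "?s1(?acc := G ?e)"
      have 2: "runs cG ?s1 (pG ?n) ?s2"
        using computesD[OF cG, of ?s1] s Fv unfolding e1 by simp
      let ?s3 = "?s2(?f := [], ?g := rev (F ?e))"
      have 3: "runs (mv ?f ?g) ?s2 (2 * length (F ?e) + 1) ?s3"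
        using runs_mv[of ?f ?g ?s2] s by simp
      have e3: "map ?s3 rs = ?e" using a(2) by auto
      let ?s4 = "?s3(?g := [], ?x := F ?e, ?acc := ?r)"
      have 4: "runs (Loop ?g body) ?s3 (length (F ?e) * Suc (T ?n) + 1) ?s4"
        using loop_runs[of ?s3] s Fv Gv Fl unfolding e3 by simp
      let ?s5 = "?s4(?x := [])"
      have 5: "runs (clear ?x) ?s4 (2 * length (F ?e) + 1) ?s5"
        using runs_clear[of ?x ?s4] by simp
      let ?s6 = "?s5(?acc := [], ?f := rev ?r)"
      have 6: "runs (mv ?acc ?f) ?s5 (2 * length ?r + 1) ?s6"
        using runs_mv[of ?acc ?f ?s5] s by simp
      let ?s7 = "?s6(?f := [], v := ?r)"
      have 7: "runs (mv ?f v) ?s6 (2 * length ?r + 1) ?s7"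
        using runs_mv[of ?f v ?s6] s a by simp
      have "?s7 = s(v := ?r)" using s a by (auto simp: fun_eq_iff)
      with runs_Seq[OF 1 runs_Seq[OF 2 runs_Seq[OF 3 runs_Seq[OF 4 runs_Seq[OF 5 runs_Seq[OF 6 7]]]]]]
      have R: "runs c s (Suc (pF ?n + Suc (pG ?n + Suc (2 * length (F ?e) + 1 + Suc (length (F ?e) * Suc (T ?n) + 1 +
          Suc (2 * length (F ?e) + 1 + Suc (2 * length ?r + 1 + (2 * length ?r + 1))))))))
          (s(v := ?r))"
        unfolding c_def by simp
      have "length ?r \<le> qG ?n + length (F ?e) * b (length (F ?e) + ?n)" by (rule R_len[OF e Fv])
      also have "\<dots> \<le> A ?n" unfolding A_def
        by (intro add_left_mono mult_le_mono polyb_mono[OF b(1)] add_right_mono Fl)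
      finally have rl: "length ?r \<le> A ?n" .
      have "length (F ?e) * Suc (T ?n) \<le> qF ?n * Suc (T ?n)" by (rule mult_right_mono[OF Fl]) simp
      have "Suc (a + Suc (b + Suc (2 * f + 1 + Suc (z + 1 + Suc (2 * f + 1 + Suc (2 * r + 1 + (2 * r + 1))))))) \<le>
          a + b + (2 * q + 1) + (z' + 1) + (2 * q + 1) + (4 * r' + 2) + 7"
        if "f \<le> q" "z \<le> z'" "r \<le> r'" for a b f z r q z' r' :: nat
        using that by linarith
      from this[OF Fl \<open>_ * Suc (T ?n) \<le> _\<close> rl] show ?thesis
        unfolding P_def by (rule runs_mono[OF R])
    qed
    with wf show "\<exists>c. wfs c \<and> (\<forall>s. (\<forall>r. valid (s r)) \<longrightarrow> (\<forall>r\<ge>m. s r = []) \<longrightarrow> s v = [] \<longrightarrow>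
        runs c s (P (esize (map s rs))) (s(v := ?R (map s rs) (F (map s rs)))))"
      by blast
  qed
qed

text \<open>The input register holds the tape word reversed, hence \<open>F [rev w]\<close>. The
  final pouring of register 1 into register 0 reverses the result, which is just the orientation in
  which the tape displays it.\<close>

theorem FP_machine:
  assumes "FP 1 F"
  shows "\<exists>M c d. tm_wf M \<and> (\<forall>w. valid w \<longrightarrow>
    (\<exists>t\<le>c * (length w + 1) ^ d. tm_halts_with M w t (F [rev w])))"
proof -
  obtain p where p: "polyb p" "\<And>rs v m. length rs = 1 \<Longrightarrow> \<forall>r\<in>set rs. r < m \<and> r \<noteq> v \<Longrightarrow>
    v < m \<Longrightarrow> \<exists>c. computes rs v m p F c" by (rule FP_obtain[OF assms]; rule that; assumption)
  obtain q where q: "polyb q" "\<And>e. env 1 e \<Longrightarrow> length (F e) \<le> q (esize e)" by (rule FP_size[OF assms]; rule that; assumption)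
  obtain c where c: "computes [0] 1 2 p F c" using p(2)[of "[0]" 2 1] by auto
  define c' where "c' = Seq c (Seq (clear 0) (mv 1 0))"
  obtain m where m: "wfc m c'" using wfs_wfc[of c'] c by (auto simp: c'_def computes_def)
  then have "wfc (Suc m) c'" by (rule wfc_mono) simp
  from stack_program_machine[OF this] obtain M where M: "tm_wf M"
    "\<And>w t s'. valid w \<Longrightarrow> (step ^^ t) ([c'], (\<lambda>_. [])(0 := rev w)) = ([], s') \<Longrightarrow>
      (\<forall>r>0. s' r = []) \<Longrightarrow> tm_halts_with M w (t * (2 * (length w + t) + 2)) (rev (s' 0))"
    by blast
  define P where "P n = p n + 2 * n + 2 * q n + 4" for n
  define Q where "Q n = P n * (2 * (n + P n) + 2)" for n
  have P: "polyb P" unfolding P_def by (intro polyb_add polyb_mult polyb_const p q polyb_id)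
  have Q: "polyb Q" unfolding Q_def by (intro polyb_add polyb_mult polyb_const P polyb_id)
  then obtain a d where ad: "\<And>n. Q n \<le> a * (n + 1) ^ d" unfolding polyb_def by blast
  have "\<exists>t\<le>a * (length w + 1) ^ d. tm_halts_with M w t (F [rev w])" if w: "valid w" for w
  proof -
    let ?s = "(\<lambda>_. [])(0 := rev w) :: store"
    have e: "env 1 [rev w]" using w by (simp add: env_def)
    have 1: "runs c ?s (p (length w)) (?s(1 := F [rev w]))"
      using computesD[OF c, of ?s] w by (simp add: esize_def)
    have "(?s(1 := F [rev w]))(0 := []) = (\<lambda>_. [])(1 := F [rev w])" by (auto simp: fun_eq_iff)
    then have 2: "runs (clear 0) (?s(1 := F [rev w])) (2 * length w + 1) ((\<lambda>_. [])(1 := F [rev w]))"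
      using runs_clear[of 0 "?s(1 := F [rev w])"] by (simp del: fun_upd_apply add: fun_upd_same fun_upd_other)
    let ?u = "(\<lambda>_. [])(1 := F [rev w]) :: store"
    have "?u(1 := [], 0 := rev (?u 1) @ ?u 0) = (\<lambda>_. [])(0 := rev (F [rev w]))"
      by (auto simp: fun_eq_iff)
    moreover have "?u 1 = F [rev w]" by simp
    ultimately have 3: "runs (mv 1 0) ?u (2 * length (F [rev w]) + 1) ((\<lambda>_. [])(0 := rev (F [rev w])))"
      using runs_mv[of 1 0 ?u] by (metis zero_neq_one)
    from runs_Seq[OF 1 runs_Seq[OF 2 3]] obtain t where
      t: "t \<le> Suc (p (length w) + Suc (2 * length w + 1 + (2 * length (F [rev w]) + 1)))"
        "(step ^^ t) ([c'], ?s) = ([], (\<lambda>_. [])(0 := rev (F [rev w])))"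
      unfolding runs_def c'_def by blast
    from M(2)[OF w t(2)] have h: "tm_halts_with M w (t * (2 * (length w + t) + 2)) (F [rev w])" by simp
    have "t \<le> P (length w)" using t(1) q(2)[OF e] by (simp add: P_def esize_def)
    then have "t * (2 * (length w + t) + 2) \<le> Q (length w)"
      unfolding Q_def by (intro mult_le_mono) auto
    with h ad[of "length w"] show ?thesis by (meson le_trans)
  qed
  with M(1) show ?thesis by blast
qed

section \<open>Closure properties and binary arithmetic\<close>

definition FPB :: "nat \<Rightarrow> (nat list list \<Rightarrow> bool) \<Rightarrow> bool" where
  "FPB k P \<longleftrightarrow> FP k (\<lambda>e. if P e then [1] else [])"

named_theorems FP_intros

lemmas [FP_intros] = FP_var FP_Nil FP_Cons

lemma env_CCE:
  assumes "env (Suc k) e"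
  obtains x e' where "e = x # e'" "valid x" "env k e'"
  using assms by (cases e) (auto simp: env_def)

lemma FP_para:
  assumes F: "FP k F" and G: "FP k G"
    and H: "\<And>a. 1 \<le> a \<Longrightarrow> a < 8 \<Longrightarrow> FP (Suc (Suc k)) (\<lambda>e. h a (e ! 0) (e ! 1) (tl (tl e)))"
    and b: "polyb b" "\<And>a x r e. 1 \<le> a \<Longrightarrow> a < 8 \<Longrightarrow> valid x \<Longrightarrow> valid r \<Longrightarrow> env k e \<Longrightarrow>
      length (h a x r e) \<le> length r + b (length x + esize e)"
  shows "FP k (\<lambda>e. para (\<lambda>a x r. h a x r e) (G e) (F e))"
  using FP_rec[OF F G H b(1)] b(2) by simp

text \<open>Branching is a recursion whose step ignores the recursive value: for a nonempty word
  only the outermost step counts.\<close>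

lemma FP_null_if:
  assumes "FP k F" "FP k G" "FP k H"
  shows "FP k (\<lambda>e. if F e = [] then G e else H e)"
proof -
  obtain q where q: "polyb q" "\<And>e. env k e \<Longrightarrow> length (H e) \<le> q (esize e)"
    by (rule FP_size[OF assms(3)]; rule that; assumption)
  have "FP k (\<lambda>e. para (\<lambda>a x r. H e) (G e) (F e))"
  proof (rule FP_para[OF assms(1,2) _ q(1)])
    show "FP (Suc (Suc k)) (\<lambda>e. H (tl (tl e)))"
      using FP_weaken[OF FP_weaken[OF assms(3)]] .
    show "length (H e) \<le> length r + q (length x + esize e)" if "env k e" for e and x r :: "nat list"
      using q(2)[OF that] polyb_mono[OF q(1), of "esize e" "length x + esize e"] by linarith
  qed
  moreover have "para (\<lambda>a x r. c) z x = (if x = [] then z else c)" for c z :: "nat list" and x :: "nat list"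
    by (cases x) auto
  ultimately show ?thesis by simp
qed

lemma FP_if [FP_intros]:
  assumes "FPB k P" "FP k F" "FP k G"
  shows "FP k (\<lambda>e. if P e then F e else G e)"
proof -
  have "FP k (\<lambda>e. if (if P e then [1::nat] else []) = [] then G e else F e)"
    by (rule FP_null_if[OF assms(1)[unfolded FPB_def] assms(3,2)])
  then show ?thesis by (rule FP_cong) auto
qed

lemma FPB_const [FP_intros]: "FPB k (\<lambda>e. c)"
  unfolding FPB_def using FP_Nil FP_Cons[OF _ _ FP_Nil, of 1] by (cases c) auto

lemma FPB_null [FP_intros]:
  assumes "FP k F"
  shows "FPB k (\<lambda>e. F e = [])"
  unfolding FPB_def by (intro FP_null_if assms FP_intros) auto

lemma FPB_not [FP_intros]:
  assumes "FPB k P"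
  shows "FPB k (\<lambda>e. \<not> P e)"
proof -
  have "FP k (\<lambda>e. if P e then [] else [1])" by (intro assms FP_intros) auto
  then show ?thesis unfolding FPB_def by (rule FP_cong) auto
qed

lemma FPB_conj [FP_intros]:
  assumes "FPB k P" "FPB k Q"
  shows "FPB k (\<lambda>e. P e \<and> Q e)"
proof -
  have "FP k (\<lambda>e. if P e then if Q e then [1] else [] else [])" by (intro assms FP_intros) auto
  then show ?thesis unfolding FPB_def by (rule FP_cong) auto
qed

section \<open>Elementary word operations and scanning\<close>

lemma FP_append [FP_intros]:
  assumes "FP k F" "FP k G"
  shows "FP k (\<lambda>e. F e @ G e)"
proof -
  have "FP k (\<lambda>e. para (\<lambda>a x r. a # r) (G e) (F e))"
    by (rule FP_para[OF assms _ polyb_const[of 1]]) (intro FP_intros; simp; fail | simp)+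
  moreover have "para (\<lambda>a x r. a # r) y x = x @ y" for x y :: "nat list"
    by (induction x) auto
  ultimately show ?thesis by simp
qed

lemma FP_rev [FP_intros]:
  assumes "FP k F"
  shows "FP k (\<lambda>e. rev (F e))"
proof -
  have "FP k (\<lambda>e. para (\<lambda>a x r. r @ [a]) [] (F e))"
    by (rule FP_para[OF assms FP_Nil _ polyb_const[of 1]]) (intro FP_intros; simp; fail | simp)+
  moreover have "para (\<lambda>a x r. r @ [a]) [] x = rev x" for x :: "nat list"
    by (induction x) auto
  ultimately show ?thesis by simp
qed

lemma FP_tl [FP_intros]:
  assumes "FP k F"
  shows "FP k (\<lambda>e. tl (F e))"
proof -
  have "FP k (\<lambda>e. para (\<lambda>a x r. x) [] (F e))"
    by (rule FP_para[OF assms FP_Nil _ polyb_id]) (intro FP_intros; simp; fail | simp)+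
  moreover have "para (\<lambda>a x r. x) [] x = tl x" for x :: "nat list"
    by (cases x) auto
  ultimately show ?thesis by simp
qed

lemma FP_takeWhile [FP_intros]:
  assumes "FP k F"
  shows "FP k (\<lambda>e. takeWhile P (F e))"
proof -
  have "FP k (\<lambda>e. para (\<lambda>a x r. if P a then a # r else []) [] (F e))"
    by (rule FP_para[OF assms FP_Nil _ polyb_const[of 1]]) (intro FP_intros; simp; fail | simp)+
  moreover have "para (\<lambda>a x r. if P a then a # r else []) [] x = takeWhile P x" for x
    by (induction x) auto
  ultimately show ?thesis by simp
qed

lemma FP_dropWhile [FP_intros]:
  assumes "FP k F"
  shows "FP k (\<lambda>e. dropWhile P (F e))"
proof -
  have "FP k (\<lambda>e. para (\<lambda>a x r. if P a then r else a # x) [] (F e))"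
    by (rule FP_para[OF assms FP_Nil _ polyb_add[OF polyb_id polyb_const[of 1]]])
      (intro FP_intros; simp; fail | simp)+
  moreover have "para (\<lambda>a x r. if P a then r else a # x) [] x = dropWhile P x" for x
    by (induction x) auto
  ultimately show ?thesis by simp
qed

definition starts :: "nat \<Rightarrow> nat list \<Rightarrow> bool" where
  "starts c x \<longleftrightarrow> x \<noteq> [] \<and> hd x = c"

lemma starts_simps [simp]: "\<not> starts c []" "starts c (a # x) \<longleftrightarrow> a = c"
  by (auto simp: starts_def)

lemma FPB_starts [FP_intros]:
  assumes "FP k F"
  shows "FPB k (\<lambda>e. starts c (F e))"
proof -
  have "FP k (\<lambda>e. para (\<lambda>a x r. if a = c then [1] else []) [] (F e))"
    by (rule FP_para[OF assms FP_Nil _ polyb_const[of 1]]) (intro FP_intros; simp; fail | simp)+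
  moreover have "para (\<lambda>a x r. if a = c then [1] else []) [] x = (if starts c x then [1::nat] else [])" for x
    by (cases x) auto
  ultimately show ?thesis by (simp add: FPB_def)
qed

primrec collect :: "(nat \<Rightarrow> nat list \<Rightarrow> nat list) \<Rightarrow> nat list \<Rightarrow> nat list" where
  "collect d [] = []"
| "collect d (a # x) = d a x @ collect d x"

text \<open>The contribution of a position does not involve the accumulator, so the growth condition
  follows from \<open>FP_size\<close> of \<open>D\<close>. This spares length estimates for nearly
  all word functions of the reduction.\<close>

lemma FP_collect:
  assumes F: "FP k F" and D: "\<And>a. 1 \<le> a \<Longrightarrow> a < 8 \<Longrightarrow> FP (Suc k) (\<lambda>e. D a (e ! 0) (tl e))"
  shows "FP k (\<lambda>e. collect (\<lambda>a x. D a x e) (F e))"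
proof -
  have "\<forall>a\<in>{1..<8}. \<exists>q. polyb q \<and> (\<forall>e. env (Suc k) e \<longrightarrow> length (D a (e ! 0) (tl e)) \<le> q (esize e))"
    using FP_size[OF D] by (metis atLeastLessThan_iff)
  then obtain q where q: "\<And>a. a \<in> {1..<8} \<Longrightarrow> polyb (q a)"
    "\<And>a e. a \<in> {1..<8} \<Longrightarrow> env (Suc k) e \<Longrightarrow> length (D a (e ! 0) (tl e)) \<le> q a (esize e)"
    by metis
  let ?b = "\<lambda>n. \<Sum>a\<in>{1..<8}. q a n"
  have "FP k (\<lambda>e. para (\<lambda>a x r. D a x e @ r) [] (F e))"
  proof (rule FP_para[OF F FP_Nil])
    show "polyb ?b" by (intro polyb_sum q) auto
    show "length (D a x e @ r) \<le> length r + ?b (length x + esize e)"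
      if "1 \<le> a" "a < 8" "valid x" "valid r" "env k e" for a x r e
    proof -
      have "length (D a x e) \<le> q a (length x + esize e)" using q(2)[of a "x # e"] that by simp
      also have "\<dots> \<le> ?b (length x + esize e)" by (rule member_le_sum) (use that in auto)
      finally show ?thesis by simp
    qed
    fix a :: nat
    assume a: "1 \<le> a" "a < 8"
    have "FP (Suc (Suc k)) (\<lambda>e. D a (e ! 0) (tl (tl e)))"
    proof (rule FP_cong)
      \<comment> \<open>Index 1, the accumulator, is left out by renaming.\<close>
      show "FP (Suc (Suc k)) (\<lambda>e. (\<lambda>e. D a (e ! 0) (tl e)) (map ((!) e) (0 # [2..<Suc (Suc k)])))"
        by (rule FP_ren[OF D[OF a]]) auto
      fix e
      assume "env (Suc (Suc k)) e"
      then obtain x r e' where e: "e = x # r # e'" "env k e'" by (metis env_CCE)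
      have "map ((!) e) [2..<Suc (Suc k)] = e'"
        by (intro nth_equalityI) (use e in \<open>auto simp: env_def simp del: upt_Suc\<close>)
      then show "(\<lambda>e. D a (e ! 0) (tl e)) (map ((!) e) (0 # [2..<Suc (Suc k)])) = D a (e ! 0) (tl (tl e))"
        unfolding e(1) by simp
    qed
    then show "FP (Suc (Suc k)) (\<lambda>e. D a (e ! 0) (tl (tl e)) @ e ! 1)"
      by (intro FP_intros) auto
  qed
  moreover have "para (\<lambda>a x r. d a x @ r) [] x = collect d x" for d x
    by (induction x) auto
  ultimately show ?thesis by simp
qed

text \<open>As in \<open>bits\<close>, numbers are written with the least significant bit first, the
  symbol 1 being the bit 0 and the symbol 2 the bit 1. A zero bit is flipped in front of the
  untouched tail \<open>x\<close>; a one bit passes the carry on to \<open>r\<close>.\<close>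

definition bin_inc :: "nat list \<Rightarrow> nat list" where
  "bin_inc = para (\<lambda>a x r. if a = 1 then 2 # x else 1 # r) [2]"

lemma FP_bin_inc [FP_intros]:
  assumes "FP k F"
  shows "FP k (\<lambda>e. bin_inc (F e))"
  unfolding bin_inc_def
  by (rule FP_para[OF assms _ _ polyb_add[OF polyb_id polyb_const[of 1]]])
    (intro FP_intros; simp; fail | simp)+

lemma length_bin_inc: "length (bin_inc x) \<le> length x + 1"
  by (induction x) (auto simp: bin_inc_def)

definition count_up :: "nat set \<Rightarrow> nat list \<Rightarrow> nat list \<Rightarrow> nat list" where
  "count_up A = para (\<lambda>a x r. if a \<in> A then bin_inc r else r)"

lemma FP_count_up [FP_intros]:
  assumes "FP k F" "FP k G"
  shows "FP k (\<lambda>e. count_up A (F e) (G e))"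
  unfolding count_up_def
  by (rule FP_para[OF assms(2,1) _ polyb_const[of 1]])
    ((intro FP_intros; simp; fail) | use length_bin_inc in auto)+

text \<open>The recursion consumes \<open>u\<close> from its right end, so the accumulator starts as
  \<open>rev v\<close> and loses one symbol per match. The word \<open>[7]\<close> signals failure
  and persists because 7 does not occur in the words \<open>u\<close> compared.\<close>

definition same_word :: "nat list \<Rightarrow> nat list \<Rightarrow> bool" where
  "same_word u v \<longleftrightarrow> para (\<lambda>a x r. if starts a r then tl r else [7]) (rev v) u = []"

lemma FPB_same_word [FP_intros]:
  assumes "FP k F" "FP k G"
  shows "FPB k (\<lambda>e. same_word (F e) (G e))"
  unfolding same_word_def
  by (intro FPB_null, rule FP_para[OF assms(1) _ _ polyb_const[of 1]])
    ((intro FP_intros assms(2); simp; fail) | auto)+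

lemma same_word_iff:
  assumes "7 \<notin> set u"
  shows "same_word u v \<longleftrightarrow> u = v"
proof -
  \<comment> \<open>The accumulator after a suffix \<open>u\<close> is what remains of
    \<open>v\<close>, reversed, once \<open>u\<close> has been cut off its end.\<close>
  have "para (\<lambda>a x r. if starts a r then tl r else [7]) (rev v) u =
      (if \<exists>w. v = w @ u then rev (THE w. v = w @ u) else [7])"
    using assms
  proof (induction u)
    case (Cons a u)
    show ?case
    proof (cases "\<exists>w. v = w @ u")
      case True
      then obtain w where w: "v = w @ u" by blast
      have "para (\<lambda>a x r. if starts a r then tl r else [7]) (rev v) u = rev w"
        using Cons w by simp
      moreover have "(\<exists>w'. v = w' @ a # u) \<longleftrightarrow> starts a (rev w)"
      proof
        assume "starts a (rev w)"
        then have "w = rev (tl (rev w)) @ [a]" by (cases w rule: rev_cases) auto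
        with w show "\<exists>w'. v = w' @ a # u" by (metis append.assoc append_Cons append_Nil)
      qed (use w in auto)
      moreover have "(THE w'. v = w' @ a # u) = rev (tl (rev w))" if "starts a (rev w)"
        using that w by (cases w rule: rev_cases) auto
      ultimately show ?thesis by auto
    next
      case False
      moreover have "\<not> (\<exists>w. v = w @ a # u)" using False by (metis append.assoc append_Cons append_Nil)
      ultimately show ?thesis using Cons by auto
    qed
  qed simp
  then show ?thesis unfolding same_word_def by auto
qed

lemma FP_drop [FP_intros]:
  assumes "FP k F" "FP k G"
  shows "FP k (\<lambda>e. drop (length (F e)) (G e))"
proof -
  have "FP k (\<lambda>e. para (\<lambda>a x r. tl r) (G e) (F e))"
    by (rule FP_para[OF assms _ polyb_const[of 0]]) (intro FP_intros; simp; fail | simp)+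
  moreover have "para (\<lambda>a x r. tl r) y x = drop (length x) y" for x y :: "nat list"
    by (induction x) (auto simp: drop_Suc tl_drop)
  ultimately show ?thesis by simp
qed

text \<open>Here \<open>x\<close> is read with the most significant bit first and \<open>y\<close> with the least significant bit first;
  the head of the accumulator is the carry.\<close>
definition bin_addc :: "nat list \<Rightarrow> nat list \<Rightarrow> nat list" where
  "bin_addc y = para (\<lambda>a x r.
     if a = 2 then
       if starts 2 (drop (length x) y) then (if starts 2 r then 2 # 2 # tl r else 2 # 1 # tl r)
       else (if starts 2 r then 2 # 1 # tl r else 1 # 2 # tl r)
     else
       if starts 2 (drop (length x) y) then (if starts 2 r then 2 # 1 # tl r else 1 # 2 # tl r)
       else (if starts 2 r then 1 # 2 # tl r else 1 # 1 # tl r)) [1]"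

text \<open>Padding \<open>x\<close> with one zero per symbol of \<open>y\<close> makes every bit of
  \<open>y\<close> enter the addition. The raw sum has its carry and leading zeros in front, so
  dropping those and reversing gives the canonical form.\<close>

definition bin_add :: "nat list \<Rightarrow> nat list \<Rightarrow> nat list" where
  "bin_add x y = rev (dropWhile (\<lambda>a. a = 1) (bin_addc y (rev (x @ map (\<lambda>_. 1) y))))"

lemma FP_bin_addc [FP_intros]:
  assumes "FP k F" "FP k G"
  shows "FP k (\<lambda>e. bin_addc (F e) (G e))"
  unfolding bin_addc_def
  by (rule FP_para[OF assms(2) _ _ polyb_const[of 2]])
    ((intro FP_intros FP_weaken[OF FP_weaken[OF assms(1)]]; simp; fail) | auto)+

lemma FP_map_const [FP_intros]:
  assumes "1 \<le> c" "c < 8" "FP k F"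
  shows "FP k (\<lambda>e. map (\<lambda>_. c) (F e))"
proof -
  have "FP k (\<lambda>e. para (\<lambda>a x r. c # r) [] (F e))"
    by (rule FP_para[OF assms(3) FP_Nil _ polyb_const[of 1]]) (intro FP_intros assms(1,2); simp; fail | simp)+
  moreover have "para (\<lambda>a x r. c # r) [] x = map (\<lambda>_. c) x" for x :: "nat list"
    by (induction x) auto
  ultimately show ?thesis by simp
qed

lemma FP_bin_add [FP_intros]:
  assumes "FP k F" "FP k G"
  shows "FP k (\<lambda>e. bin_add (F e) (G e))"
  unfolding bin_add_def by (intro FP_intros assms) auto

lemma length_bin_addc: "length (bin_addc y x) = length x + 1"
proof (induction x)
  case (Cons a x)
  then show ?case by (auto simp: bin_addc_def)
qed (simp add: bin_addc_def)

lemma length_bin_add: "length (bin_add x y) \<le> length x + length y + 1"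
  unfolding bin_add_def using length_dropWhile_le[of "\<lambda>a. a = 1" "bin_addc y (rev (x @ map (\<lambda>_. 1) y))"]
  by (simp add: length_bin_addc)

text \<open>Horner's scheme: double the product for the higher bits and add \<open>y\<close> if the
  current bit is set. The case distinction on \<open>r = []\<close> keeps zero canonical when
  doubling.\<close>

definition bin_mul :: "nat list \<Rightarrow> nat list \<Rightarrow> nat list" where
  "bin_mul x y = para (\<lambda>a x r. if a = 2 then bin_add (if r = [] then [] else 1 # r) y
     else (if r = [] then [] else 1 # r)) [] x"

lemma FP_bin_mul [FP_intros]:
  assumes "FP k F" "FP k G"
  shows "FP k (\<lambda>e. bin_mul (F e) (G e))"
proof -
  obtain q where q: "polyb q" "\<And>e. env k e \<Longrightarrow> length (G e) \<le> q (esize e)"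
    by (rule FP_size[OF assms(2)]; rule that; assumption)
  show ?thesis unfolding bin_mul_def
  proof (rule FP_para[OF assms(1) FP_Nil _ polyb_add[OF q(1) polyb_const[of 2]]])
    show "length (if a = 2 then bin_add (if r = [] then [] else 1 # r) (G e) else if r = [] then [] else 1 # r)
        \<le> length r + (q (length x + esize e) + 2)" if "env k e" for a :: nat and x r :: "nat list" and e
      using length_bin_add[of "if r = [] then [] else 1 # r" "G e"] q(2)[OF that]
        polyb_mono[OF q(1), of "esize e" "length x + esize e"] by (auto split: if_splits)
  qed (intro FP_intros FP_weaken[OF FP_weaken[OF assms(2)]]; simp)
qed

section \<open>Correctness of binary arithmetic\<close>

fun bin_val :: "nat list \<Rightarrow> nat" where
  "bin_val [] = 0"
| "bin_val (a # x) = (if a = 2 then 1 else 0) + 2 * bin_val x"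

declare bits.simps [simp del]

lemma bits_0 [simp]: "bits 0 = []"
  by (simp add: bits.simps)

lemma bits_double: "bits (2 * n) = (if n = 0 then [] else 1 # bits n)"
  by (simp add: bits.simps[of "2 * n"])

lemma bits_Suc_double: "bits (Suc (2 * n)) = 2 # bits n"
  by (simp add: bits.simps[of "Suc (2 * n)"])

lemma bin_val_bits [simp]: "bin_val (bits n) = n"
proof (induction n rule: less_induct)
  case (less n)
  show ?case using less[of "n div 2"] by (subst bits.simps) auto
qed

lemma bits_inj [simp]: "bits m = bits n \<longleftrightarrow> m = n"
  by (metis bin_val_bits)

lemma bits_set: "set (bits n) \<subseteq> {1, 2}"
proof (induction n rule: less_induct)
  case (less n)
  show ?case using less[of "n div 2"] by (subst bits.simps) auto
qed

lemma bits_bin_val: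
  assumes "set x \<subseteq> {1, 2}" "x = [] \<or> last x = 2"
  shows "bits (bin_val x) = x"
  using assms
proof (induction x)
  case (Cons a x)
  then have IH: "bits (bin_val x) = x" by (auto split: if_splits)
  show ?case
  proof (cases "a = 2")
    case False
    then have "x \<noteq> []" using Cons.prems by (auto split: if_splits)
    then have "bin_val x \<noteq> 0" using IH by (metis bits_0)
    then show ?thesis using False Cons.prems IH by (simp add: bits_double)
  qed (simp add: bits_Suc_double IH)
qed simp

lemma bin_val_append: "bin_val (x @ y) = bin_val x + 2 ^ length x * bin_val y"
  by (induction x) (auto simp: algebra_simps)

lemma bin_inc_bits [simp]: "bin_inc (bits n) = bits (Suc n)"
proof (induction n rule: less_induct)
  case (less n)
  consider "n = 0" | m where "n = 2 * m" "m \<noteq> 0" | m where "n = Suc (2 * m)"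
    by (metis evenE oddE Suc_eq_plus1 mult_0_right)
  then show ?case
  proof cases
    case 1
    then show ?thesis using bits_Suc_double[of 0] by (simp add: bin_inc_def)
  next
    case 2
    then show ?thesis by (simp add: bits_double bits_Suc_double) (simp add: bin_inc_def)
  next
    case 3
    have "Suc (Suc (2 * m)) = 2 * Suc m" by simp
    then have "bits (Suc n) = 1 # bits (Suc m)" using 3 bits_double[of "Suc m"] by simp
    moreover have "bin_inc (2 # bits m) = 1 # bin_inc (bits m)" by (simp add: bin_inc_def)
    ultimately show ?thesis using 3 less[of m] by (simp add: bits_Suc_double)
  qed
qed

lemma count_bits: "count_up A (bits n) x = bits (n + length (filter (\<lambda>a. a \<in> A) x))"
  by (induction x) (auto simp: count_up_def)

lemma bin_addc_correct:
  assumes "set x \<subseteq> {1, 2}"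
  shows "bin_val (rev (bin_addc y x)) = bin_val (rev x) + bin_val (take (length x) y) \<and> set (bin_addc y x) \<subseteq> {1, 2}"
  using assms
proof (induction x)
  case Nil
  then show ?case by (simp add: bin_addc_def)
next
  case (Cons a x)
  let ?n = "length x"
  obtain c s where r: "bin_addc y x = c # s" using length_bin_addc[of y x] by (cases "bin_addc y x") auto
  have s: "length s = ?n" using length_bin_addc[of y x] r by simp
  have IH: "bin_val (rev s) + 2 ^ ?n * (if c = 2 then 1 else 0) = bin_val (rev x) + bin_val (take ?n y)"
      "c = 1 \<or> c = 2" "set s \<subseteq> {1, 2}"
    using Cons r s by (auto simp: bin_val_append)
  let ?b = "starts 2 (drop ?n y)"
  have tk: "bin_val (take (Suc ?n) y) = bin_val (take ?n y) + 2 ^ ?n * (if ?b then 1 else 0)"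
  proof (cases "?n < length y")
    case True
    then show ?thesis by (simp add: take_Suc_conv_app_nth bin_val_append starts_def hd_drop_conv_nth)
  qed simp
  have rx: "bin_val (rev (a # x)) = bin_val (rev x) + 2 ^ ?n * (if a = 2 then 1 else 0)"
    by (simp add: bin_val_append)
  have step: "bin_addc y (a # x) = (
     if a = 2 then
       if ?b then (if c = 2 then 2 # 2 # s else 2 # 1 # s)
       else (if c = 2 then 2 # 1 # s else 1 # 2 # s)
     else
       if ?b then (if c = 2 then 2 # 1 # s else 1 # 2 # s)
       else (if c = 2 then 1 # 2 # s else 1 # 1 # s))"
    using r by (simp add: bin_addc_def)
  have v: "bin_val (rev (p # q # s)) = bin_val (rev s) + 2 ^ ?n * (if q = 2 then 1 else 0) + 2 * 2 ^ ?n * (if p = 2 then 1 else 0)" for p q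
    by (simp add: bin_val_append s)
  show ?case
    unfolding step length_Cons tk rx using IH Cons.prems by (auto simp: v simp del: rev.simps)
qed

lemma bin_add_bits:
  assumes "set x \<subseteq> {1, 2}" "set y \<subseteq> {1, 2}"
  shows "bin_add x y = bits (bin_val x + bin_val y)"
proof -
  let ?x = "x @ map (\<lambda>_. 1) y"
  let ?z = "bin_addc y (rev ?x)"
  have z: "bin_val (rev ?z) = bin_val x + bin_val y" "set ?z \<subseteq> {1, 2}"
  proof -
    have "bin_val (map (\<lambda>_. 1) y) = 0" by (induction y) auto
    moreover have "set (rev ?x) \<subseteq> {1, 2}" using assms by auto
    ultimately show "bin_val (rev ?z) = bin_val x + bin_val y" "set ?z \<subseteq> {1, 2}"
      using bin_addc_correct[of "rev ?x" y] by (auto simp: bin_val_append)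
  qed
  have dw: "bin_val (rev (dropWhile (\<lambda>a. a = 1) u)) = bin_val (rev u)" for u
    by (induction u) (auto simp: bin_val_append)
  have "last (bin_add x y) = 2" if "bin_add x y \<noteq> []"
  proof -
    have "hd (dropWhile (\<lambda>a. a = 1) ?z) \<noteq> 1" using that hd_dropWhile[of "\<lambda>a. a = 1" ?z]
      by (simp add: bin_add_def)
    moreover have "hd (dropWhile (\<lambda>a. a = 1) ?z) \<in> {1, 2}"
      using that z(2) set_dropWhileD hd_in_set unfolding bin_add_def by (metis (no_types, lifting) rev_is_Nil_conv subsetD)
    ultimately show ?thesis using that by (simp add: bin_add_def last_rev)
  qed
  moreover have "set (bin_add x y) \<subseteq> {1, 2}" using z(2) set_dropWhileD by (fastforce simp: bin_add_def)
  ultimately have "bits (bin_val (bin_add x y)) = bin_add x y" by (intro bits_bin_val) auto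
  moreover have "bin_val (bin_add x y) = bin_val x + bin_val y" unfolding bin_add_def dw z ..
  ultimately show ?thesis by simp
qed

lemma bin_mul_bits:
  assumes "set x \<subseteq> {1, 2}" "set y \<subseteq> {1, 2}"
  shows "bin_mul x y = bits (bin_val x * bin_val y)"
  using assms(1)
proof (induction x)
  case (Cons a x)
  let ?n = "bin_val x * bin_val y"
  have IH: "bin_mul x y = bits ?n" using Cons by simp
  have nil: "bits ?n = [] \<longleftrightarrow> ?n = 0" using bits_inj[of ?n 0] by (simp only: bits_0)
  have d: "(if bin_mul x y = [] then [] else 1 # bin_mul x y) = bits (2 * ?n)"
    unfolding IH nil by (simp add: bits_double)
  have "bin_mul (a # x) y = (if a = 2 then bin_add (bits (2 * ?n)) y else bits (2 * ?n))"
    unfolding d[symmetric] by (simp add: bin_mul_def)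
  then show ?case using bin_add_bits[OF bits_set assms(2)] by (simp add: algebra_simps)
qed (simp add: bin_mul_def)

section \<open>The reduction as a function on words\<close>

definition is_bit :: "nat \<Rightarrow> bool" where
  "is_bit a \<longleftrightarrow> a = 1 \<or> a = 2"

definition first_token :: "nat list \<Rightarrow> nat list" where
  "first_token x = takeWhile is_bit x"

definition after_token :: "nat list \<Rightarrow> nat list" where
  "after_token x = dropWhile is_bit x"

text \<open>A wire name is a possibly empty run of bits closed by 3; the empty run is the name 0.
  The test on \<open>a\<close> and \<open>x\<close> singles out the delimiter directly in front of a
  name, so that each name is seen once and never from within its bits.\<close>

definition occurs :: "nat list \<Rightarrow> nat list \<Rightarrow> bool" where
  "occurs v Q \<longleftrightarrow>
    collect (\<lambda>a x. if \<not> is_bit a \<and> starts 3 (after_token x) then if same_word (first_token x) v then [1] else [] else []) Q \<noteq> []"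

definition is_gate_name :: "nat list \<Rightarrow> nat list \<Rightarrow> bool" where
  "is_gate_name v H \<longleftrightarrow> collect (\<lambda>a x. if (a = 4 \<or> a = 6) \<and> same_word (first_token x) v then [1] else []) H \<noteq> []"

text \<open>\<open>P\<close> and \<open>M\<close> list the wires with coefficient 1 and -1. The
  three literals are the encodings of 1, -1 and 0.\<close>

definition vector_word :: "nat list \<Rightarrow> nat list \<Rightarrow> nat list \<Rightarrow> nat list" where
  "vector_word H P M = collect (\<lambda>a x. if \<not> is_bit a \<and> starts 3 (after_token x) then
     (if occurs (first_token x) P then [7, 2, 3, 2, 3] else if occurs (first_token x) M then [6, 2, 3, 2, 3] else [7, 3, 2, 3])
     else []) H"

definition sample_word :: "nat list \<Rightarrow> nat list \<Rightarrow> nat list \<Rightarrow> nat list \<Rightarrow> nat list" where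
  "sample_word H P M y = vector_word H P M @ [4] @ y @ [5]"

text \<open>Requiring \<open>a = 3\<close> selects gate arguments, since the name of a gate follows
  its tag directly. A sample is emitted at the last occurrence only, so each input wire that is read
  pays once.\<close>

definition paid_word :: "nat list \<Rightarrow> nat list \<Rightarrow> nat list" where
  "paid_word H y = collect (\<lambda>a x.
     if a = 3 \<and> starts 3 (after_token x) \<and> \<not> is_gate_name (first_token x) H \<and> \<not> occurs (first_token x) (after_token x)
     then sample_word H ([3] @ first_token x @ [3]) [] y else []) H"

definition and_word :: "nat list \<Rightarrow> nat list \<Rightarrow> nat list \<Rightarrow> nat list" where
  "and_word H M Q = collect (\<lambda>a x. if \<not> is_bit a \<and> starts 3 (after_token x)
     then sample_word H ([3] @ first_token x @ [3]) M [7, 3, 2, 3] else []) Q"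

text \<open>Cutting at the next 5 isolates the current gate; dropping its first token then leaves
  the arguments, preceded by the delimiter 3 that \<open>occurs\<close> and \<open>and_word\<close>
  expect.\<close>

definition gates_word :: "nat list \<Rightarrow> nat list" where
  "gates_word H = collect (\<lambda>a x.
     if a = 4 then and_word H ([3] @ first_token x @ [3]) (after_token (takeWhile (\<lambda>b. b \<noteq> 5) x))
     else if a = 6 then sample_word H (after_token (takeWhile (\<lambda>b. b \<noteq> 5) x)) ([3] @ first_token x @ [3]) [7, 3, 2, 3]
     else []) H"

text \<open>The recursion starts at the right end, so the first name found there is kept. The empty
  word means that none was found yet, which is unambiguous because gate names are positive.\<close>

definition last_gate :: "nat list \<Rightarrow> nat list" where
  "last_gate H = para (\<lambda>a x r. if (a = 4 \<or> a = 6) \<and> r = [] then first_token x else r) [] H"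

text \<open>Inserts the name of its output wire in front of the arguments of every gate. The names in the resulting
  word are the coordinates of the sample vectors.\<close>
definition annotate :: "nat list \<Rightarrow> nat list \<Rightarrow> nat list" where
  "annotate m G = rev (collect (\<lambda>a x.
     if a = 4 \<or> a = 6 then [3] @ rev (count_up {4, 6} m x) @ [a] else [a]) (rev G))"

text \<open>The dimension is the number of 3s in \<open>H\<close>, as each name is closed by exactly
  one. The prefix \<open>[7, 2, 3]\<close> is the numerator 1 of \<open>y\<close>, and
  \<open>E\<close> is the denominator in binary.\<close>

definition assemble :: "nat list \<Rightarrow> nat list \<Rightarrow> nat list" where
  "assemble H E = count_up {3} [] H @ [3] @ paid_word H ([7, 2, 3] @ E @ [3]) @ gates_word H @
     sample_word H [] ([3] @ last_gate H @ [3]) [7, 2, 3, 2, 3]"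

primrec bin_pow :: "nat list \<Rightarrow> nat \<Rightarrow> nat list" where
  "bin_pow x 0 = [2]"
| "bin_pow x (Suc i) = bin_mul x (bin_pow x i)"

text \<open>\<open>[1, 2, 1, 2]\<close> is 10 in binary. Counting gate tags upwards from the number
  of input wires gives the size of the circuit.\<close>

definition reduce :: "nat \<Rightarrow> nat list \<Rightarrow> nat list" where
  "reduce l w = assemble (annotate (first_token w) (tl (after_token w)))
     (bin_pow (bin_mul [1, 2, 1, 2] (count_up {4, 6} (first_token w) (tl (after_token w)))) (Suc l))"

section \<open>The reduction is polynomial-time\<close>

lemma FP_first_token [FP_intros]: "FP k F \<Longrightarrow> FP k (\<lambda>e. first_token (F e))"
  unfolding first_token_def by (rule FP_takeWhile)

lemma FP_after_token [FP_intros]: "FP k F \<Longrightarrow> FP k (\<lambda>e. after_token (F e))"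
  unfolding after_token_def by (rule FP_dropWhile)

lemmas [FP_intros] = FP_collect

lemma FPB_occurs [FP_intros]: "FP k F \<Longrightarrow> FP k G \<Longrightarrow> FPB k (\<lambda>e. occurs (F e) (G e))"
  unfolding occurs_def by (intro FP_intros FP_weaken[of _ F]) auto

lemma FPB_is_gate_name [FP_intros]: "FP k F \<Longrightarrow> FP k G \<Longrightarrow> FPB k (\<lambda>e. is_gate_name (F e) (G e))"
  unfolding is_gate_name_def by (intro FP_intros FP_weaken[of _ F]) auto

lemma FP_vector_word [FP_intros]: "FP k F \<Longrightarrow> FP k G \<Longrightarrow> FP k H \<Longrightarrow> FP k (\<lambda>e. vector_word (F e) (G e) (H e))"
  unfolding vector_word_def by (intro FP_intros FP_weaken[of _ G] FP_weaken[of _ H]) auto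

lemma FP_sample_word [FP_intros]:
  "FP k F \<Longrightarrow> FP k G \<Longrightarrow> FP k H \<Longrightarrow> FP k I \<Longrightarrow> FP k (\<lambda>e. sample_word (F e) (G e) (H e) (I e))"
  unfolding sample_word_def by (intro FP_intros) auto

lemma FP_paid_word [FP_intros]: "FP k F \<Longrightarrow> FP k G \<Longrightarrow> FP k (\<lambda>e. paid_word (F e) (G e))"
  unfolding paid_word_def by (intro FP_intros FP_weaken[of _ F] FP_weaken[of _ G]) auto

lemma FP_and_word [FP_intros]: "FP k F \<Longrightarrow> FP k G \<Longrightarrow> FP k H \<Longrightarrow> FP k (\<lambda>e. and_word (F e) (G e) (H e))"
  unfolding and_word_def by (intro FP_intros FP_weaken[of _ F] FP_weaken[of _ G]) auto

lemma FP_gates_word [FP_intros]: "FP k F \<Longrightarrow> FP k (\<lambda>e. gates_word (F e))"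
  unfolding gates_word_def by (intro FP_intros FP_weaken[of _ F]) auto

lemma FP_last_gate [FP_intros]: "FP k F \<Longrightarrow> FP k (\<lambda>e. last_gate (F e))"
  unfolding last_gate_def
  by (rule FP_para[OF _ FP_Nil _ polyb_id])
    (assumption | (intro FP_intros; simp; fail) | auto simp: first_token_def intro: trans_le_add1 length_takeWhile_le)+

lemma FP_annotate [FP_intros]: "FP k F \<Longrightarrow> FP k G \<Longrightarrow> FP k (\<lambda>e. annotate (F e) (G e))"
  unfolding annotate_def by (intro FP_intros FP_weaken[of _ F]) auto

text \<open>The exponent is a constant and not an argument: \<open>i\<close> multiplications are
  nested, and the time bound may depend on \<open>i\<close>.\<close>

lemma FP_bin_pow [FP_intros]: "FP k F \<Longrightarrow> FP k (\<lambda>e. bin_pow (F e) i)"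
proof (induction i)
  case 0
  then show ?case unfolding bin_pow.simps by (intro FP_intros) auto
next
  case (Suc i)
  then show ?case unfolding bin_pow.simps by (intro FP_intros) auto
qed

lemma FP_assemble [FP_intros]: "FP k F \<Longrightarrow> FP k G \<Longrightarrow> FP k (\<lambda>e. assemble (F e) (G e))"
  unfolding assemble_def by (intro FP_intros) auto

lemma FP_reduce: "FP k F \<Longrightarrow> FP k (\<lambda>e. reduce l (F e))"
  unfolding reduce_def by (intro FP_intros) auto

section \<open>The words produced by the reduction encode the intended samples\<close>

lemma is_bit_simps [simp]: "is_bit 1" "is_bit (Suc 0)" "is_bit 2" "\<not> is_bit 3" "\<not> is_bit 4" "\<not> is_bit 5" "\<not> is_bit 6" "\<not> is_bit 7"
  by (auto simp: is_bit_def)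

lemma is_bit_bits: "a \<in> set (bits n) \<Longrightarrow> is_bit a"
  using bits_set[of n] by (auto simp: is_bit_def)

lemma first_token_append [simp]: "first_token (bits n @ 3 # y) = bits n"
  unfolding first_token_def by (subst takeWhile_append2) (auto simp: is_bit_bits)

lemma after_token_append [simp]: "after_token (bits n @ 3 # y) = 3 # y"
  unfolding after_token_def by (subst dropWhile_append2) (auto simp: is_bit_bits)

lemma after_token_Cons [simp]: "\<not> is_bit a \<Longrightarrow> after_token (a # y) = a # y"
  by (simp add: after_token_def)

lemma after_token_Nil [simp]: "after_token [] = []"
  by (simp add: after_token_def)

lemma same_word_bits [simp]: "same_word (bits m) (bits n) \<longleftrightarrow> m = n"
  using bits_set[of m] by (subst same_word_iff) auto

lemma collect_append_skip:
  "(\<And>a y. a \<in> set x \<Longrightarrow> d a y = []) \<Longrightarrow> collect d (x @ y) = collect d y"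
  by (induction x) auto

lemma collect_bits:
  "(\<And>a y. is_bit a \<Longrightarrow> d a y = []) \<Longrightarrow> collect d (bits n @ y) = collect d y"
  by (rule collect_append_skip) (auto simp: is_bit_bits)

abbreviation encs :: "nat list \<Rightarrow> nat list" where
  "encs ns \<equiv> concat (map enc_nat ns)"

lemma set_encs: "a \<in> set (encs ns) \<Longrightarrow> a = 1 \<or> a = 2 \<or> a = 3"
  using is_bit_bits by (induction ns) (auto simp: enc_nat_def is_bit_def)

lemma bits_1 [simp]: "bits (Suc 0) = [2]"
  using bits_Suc_double[of 0] by simp

text \<open>The 3 that closes one name is the delimiter in front of the next, so the induction
  passes from \<open>s\<close> to 3. The condition on \<open>y\<close> says that no further name
  follows.\<close>

lemma collect_encs:
  assumes "\<not> starts 3 (after_token y)" "\<not> is_bit s"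
  shows "collect (\<lambda>a x. if \<not> is_bit a \<and> starts 3 (after_token x) then g (first_token x) else []) (s # encs ns @ y) =
    concat (map (\<lambda>n. g (bits n)) ns) @ collect (\<lambda>a x. if \<not> is_bit a \<and> starts 3 (after_token x) then g (first_token x) else []) y"
  using assms(2)
proof (induction ns arbitrary: s)
  case Nil
  then show ?case using assms(1) by simp
next
  case (Cons n ns)
  show ?case using Cons.prems Cons.IH[of 3] by (simp add: enc_nat_def collect_bits)
qed

fun gtag :: "gate \<Rightarrow> nat" where
  "gtag (AndG cs) = 4"
| "gtag (OrG cs) = 6"

lemma gtag_cases: "gtag g = 4 \<or> gtag g = 6"
  by (cases g) auto

lemma not_is_bit_gtag [simp]: "\<not> is_bit (gtag g)"
  using gtag_cases[of g] by (auto simp: is_bit_def)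

definition block_word :: "nat \<times> gate \<Rightarrow> nat list" where
  "block_word b = gtag (snd b) # encs (fst b # gate_args (snd b)) @ [5]"

abbreviation block_words :: "(nat \<times> gate) list \<Rightarrow> nat list" where
  "block_words bl \<equiv> concat (map block_word bl)"

definition wire_names :: "(nat \<times> gate) list \<Rightarrow> nat list" where
  "wire_names bl = concat (map (\<lambda>b. fst b # gate_args (snd b)) bl)"

definition arg_names :: "(nat \<times> gate) list \<Rightarrow> nat list" where
  "arg_names bl = concat (map (\<lambda>b. gate_args (snd b)) bl)"

lemma wire_names_simps [simp]: "wire_names [] = []" "wire_names (b # bl) = fst b # gate_args (snd b) @ wire_names bl"
  by (simp_all add: wire_names_def)

lemma arg_names_simps [simp]: "arg_names [] = []" "arg_names (b # bl) = gate_args (snd b) @ arg_names bl"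
  by (simp_all add: arg_names_def)

lemma set_wire_names: "set (wire_names bl) = fst ` set bl \<union> set (arg_names bl)"
  by (induction bl) auto

lemma after_token_block_words: "\<not> starts 3 (after_token (block_words bl))"
proof (cases bl)
  case (Cons b bl')
  then show ?thesis using gtag_cases[of "snd b"] by (auto simp: block_word_def)
qed simp

lemma collect_block_words:
  "collect (\<lambda>a x. if \<not> is_bit a \<and> starts 3 (after_token x) then g (first_token x) else []) (block_words bl) =
    concat (map (\<lambda>n. g (bits n)) (wire_names bl))"
proof (induction bl)
  case (Cons b bl)
  let ?d = "\<lambda>a x. if \<not> is_bit a \<and> starts 3 (after_token x) then g (first_token x) else []"
  have "collect ?d (block_words (b # bl)) = collect ?d (gtag (snd b) # encs (fst b # gate_args (snd b)) @ 5 # block_words bl)"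
    by (simp add: block_word_def)
  also have "\<dots> = concat (map (\<lambda>n. g (bits n)) (fst b # gate_args (snd b))) @ collect ?d (5 # block_words bl)"
    by (rule collect_encs) auto
  also have "collect ?d (5 # block_words bl) = collect ?d (block_words bl)"
    using after_token_block_words by simp
  finally show ?case unfolding Cons by simp
qed simp

lemma occurs_encs: "occurs (bits v) (3 # encs ns) \<longleftrightarrow> v \<in> set ns"
  using collect_encs[of "[]" 3 "\<lambda>t. if same_word t (bits v) then [1] else []" ns]
  unfolding occurs_def by auto

lemma occurs_single: "occurs (bits v) (3 # bits n @ [3]) \<longleftrightarrow> v = n"
  using occurs_encs[of v "[n]"] by (simp add: enc_nat_def)

lemma occurs_tail: "occurs (bits v) (3 # encs ns @ 5 # block_words bl) \<longleftrightarrow> v \<in> set ns \<union> set (wire_names bl)"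
  using collect_encs[of "5 # block_words bl" 3 "\<lambda>t. if same_word t (bits v) then [1] else []" ns]
    collect_block_words[of "\<lambda>t. if same_word t (bits v) then [1] else []" bl]
  unfolding occurs_def by (auto simp: after_token_block_words)

lemma not_occurs_Nil: "\<not> occurs v []"
  by (simp add: occurs_def)

lemma collect_gate_positions:
  assumes "\<And>a x. a \<noteq> 4 \<Longrightarrow> a \<noteq> 6 \<Longrightarrow> d a x = []"
  shows "collect d (block_words (b # bl)) =
    d (gtag (snd b)) (encs (fst b # gate_args (snd b)) @ 5 # block_words bl) @ collect d (block_words bl)"
proof -
  have "a \<noteq> 4 \<and> a \<noteq> 6" if "a \<in> set (encs ns @ [5])" for a ns
    using that set_encs[of a ns] by (auto simp del: set_concat)
  then have "collect d ((encs ns @ [5]) @ y) = collect d y" for ns y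
    using assms by (intro collect_append_skip) blast
  from this[of "fst b # gate_args (snd b)" "block_words bl"] show ?thesis by (simp add: block_word_def)
qed

lemma is_gate_name_block_words: "is_gate_name (bits v) (block_words bl) \<longleftrightarrow> v \<in> fst ` set bl"
proof (induction bl)
  case (Cons b bl)
  then show ?case using gtag_cases[of "snd b"] unfolding is_gate_name_def
    by (subst collect_gate_positions) (auto simp: enc_nat_def)
qed (simp add: is_gate_name_def)

definition sample_vector :: "nat list \<Rightarrow> nat set \<Rightarrow> nat set \<Rightarrow> rat list" where
  "sample_vector V P M = map (\<lambda>v. if v \<in> P then 1 else if v \<in> M then - 1 else 0) V"

lemma enc_int_simps: "enc_int 0 = [7, 3]" "enc_int 1 = [7, 2, 3]" "enc_int (- 1) = [6, 2, 3]"
  by (simp_all add: enc_int_def enc_nat_def)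

lemma enc_rat_inverse:
  assumes "0 < n"
  shows "enc_rat (1 / of_nat n) = [7, 2, 3] @ bits n @ [3]"
proof -
  have "(1 / of_nat n :: rat) = Fract 1 (int n)" by (simp add: Fract_of_int_quotient)
  then have "quotient_of (1 / of_nat n) = (1, int n)"
    using assms by (simp add: quotient_of_Fract normalize_stable)
  then show ?thesis by (simp add: enc_rat_def enc_int_simps enc_nat_def)
qed

lemma enc_rat_simps: "enc_rat 0 = [7, 3, 2, 3]" "enc_rat 1 = [7, 2, 3, 2, 3]" "enc_rat (- 1) = [6, 2, 3, 2, 3]"
proof -
  have "quotient_of (- 1) = (- 1, 1)" using quotient_of_int[of "- 1"] by simp
  then show "enc_rat 0 = [7, 3, 2, 3]" "enc_rat 1 = [7, 2, 3, 2, 3]" "enc_rat (- 1) = [6, 2, 3, 2, 3]"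
    by (simp_all add: enc_rat_def enc_int_simps enc_nat_def)
qed

lemma sample_word_block_words:
  assumes "\<And>v. occurs (bits v) P \<longleftrightarrow> v \<in> P'" "\<And>v. occurs (bits v) M \<longleftrightarrow> v \<in> M'"
  shows "sample_word (block_words bl) P M (enc_rat y) = enc_sample (sample_vector (wire_names bl) P' M', y)"
proof -
  have "vector_word (block_words bl) P M = concat (map enc_rat (sample_vector (wire_names bl) P' M'))"
    unfolding vector_word_def assms sample_vector_def map_map
      collect_block_words[of "\<lambda>t. if occurs t P then [7, 2, 3, 2, 3] else if occurs t M then [6, 2, 3, 2, 3] else [7, 3, 2, 3]"]
    by (intro arg_cong[where f = concat] map_cong) (auto simp: enc_rat_simps)
  then show ?thesis by (simp add: sample_word_def enc_sample_def)
qed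

definition used_inputs :: "(nat \<times> gate) list \<Rightarrow> nat list" where
  "used_inputs bl = filter (\<lambda>c. c \<notin> fst ` set bl) (remdups (arg_names bl))"

definition gate_samples :: "nat list \<Rightarrow> nat \<times> gate \<Rightarrow> (rat list \<times> rat) list" where
  "gate_samples V b = (case snd b of
     AndG cs \<Rightarrow> map (\<lambda>c. (sample_vector V {c} {fst b}, 0)) cs
   | OrG cs \<Rightarrow> [(sample_vector V (set cs) {fst b}, 0)])"

definition circuit_samples :: "(nat \<times> gate) list \<Rightarrow> rat \<Rightarrow> (rat list \<times> rat) list" where
  "circuit_samples bl y = map (\<lambda>c. (sample_vector (wire_names bl) {c} {}, y)) (used_inputs bl) @
     concat (map (gate_samples (wire_names bl)) bl) @ [(sample_vector (wire_names bl) {} {fst (last bl)}, 1)]"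

text \<open>\<open>remdups\<close> keeps the last occurrence of each element, which agrees with the
  test that the name does not occur further on.\<close>

lemma paid_word_block_words:
  "paid_word (block_words bl) (enc_rat y) =
    concat (map enc_sample (map (\<lambda>c. (sample_vector (wire_names bl) {c} {}, y)) (used_inputs bl)))"
proof -
  let ?H = "block_words bl"
  let ?d = "\<lambda>(a::nat) x. if a = 3 \<and> starts 3 (after_token x) \<and> \<not> is_gate_name (first_token x) ?H \<and> \<not> occurs (first_token x) (after_token x)
     then sample_word ?H ([3] @ first_token x @ [3]) [] (enc_rat y) else []"
  let ?s = "\<lambda>cs. concat (map (\<lambda>c. enc_sample (sample_vector (wire_names bl) {c} {}, y)) (filter (\<lambda>c. c \<notin> fst ` set bl) cs))"
  \<comment> \<open>This treats the arguments within one block, starting at the 3 that closes the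
    name of the gate or of the previous argument.\<close>
  have step: "collect ?d (3 # encs cs @ 5 # block_words bl') = ?s (remdups (cs @ arg_names bl'))"
    if "fst ` set bl' \<subseteq> fst ` set bl" "collect ?d (block_words bl') = ?s (remdups (arg_names bl'))" for cs bl'
  proof (induction cs)
    case Nil
    then show ?case using that(2) by simp
  next
    case (Cons c cs)
    let ?R = "3 # encs cs @ 5 # block_words bl'"
    have "encs (c # cs) @ 5 # block_words bl' = bits c @ ?R" by (simp add: enc_nat_def)
    then have "collect ?d (3 # encs (c # cs) @ 5 # block_words bl') = ?d 3 (bits c @ ?R) @ collect ?d (bits c @ ?R)"
      by (simp only: collect.simps)
    also have "collect ?d (bits c @ ?R) = collect ?d ?R" by (rule collect_bits) auto
    also note Cons.IH
    also have "?d 3 (bits c @ 3 # encs cs @ 5 # block_words bl') =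
      (if c \<notin> fst ` set bl \<and> c \<notin> set cs \<union> set (arg_names bl') then enc_sample (sample_vector (wire_names bl) {c} {}, y) else [])"
    proof -
      have "sample_word ?H ([3] @ bits c @ [3]) [] (enc_rat y) = enc_sample (sample_vector (wire_names bl) {c} {}, y)"
        by (rule sample_word_block_words) (auto simp: occurs_single not_occurs_Nil)
      then show ?thesis using that(1) by (auto simp: is_gate_name_block_words occurs_tail set_wire_names)
    qed
    finally show ?case by auto
  qed
  have "collect ?d (block_words bl') = ?s (remdups (arg_names bl'))" if "set bl' \<subseteq> set bl" for bl'
    using that
  proof (induction bl')
    case (Cons b bl')
    let ?R = "3 # encs (gate_args (snd b)) @ 5 # block_words bl'"
    have "block_words (b # bl') = gtag (snd b) # bits (fst b) @ ?R" by (simp add: block_word_def enc_nat_def)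
    then have "collect ?d (block_words (b # bl')) = ?d (gtag (snd b)) (bits (fst b) @ ?R) @ collect ?d (bits (fst b) @ ?R)"
      by (simp only: collect.simps)
    also have "?d (gtag (snd b)) (bits (fst b) @ ?R) = []" using gtag_cases[of "snd b"] by auto
    also have "[] @ collect ?d (bits (fst b) @ ?R) = collect ?d (bits (fst b) @ ?R)" by simp
    also have "collect ?d (bits (fst b) @ ?R) = collect ?d ?R" by (rule collect_bits) auto
    also have "\<dots> = ?s (remdups (arg_names (b # bl')))"
      using Cons step[of bl' "gate_args (snd b)"] by (simp add: image_mono)
    finally show ?case .
  qed simp
  from this[of bl] show ?thesis unfolding paid_word_def used_inputs_def by (simp add: comp_def)
qed

lemma gates_word_block_words:
  "gates_word (block_words bl) = concat (map enc_sample (concat (map (gate_samples (wire_names bl)) bl)))"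
proof -
  let ?H = "block_words bl"
  let ?d = "\<lambda>a x. if a = 4 then and_word ?H ([3] @ first_token x @ [3]) (after_token (takeWhile (\<lambda>b. b \<noteq> 5) x))
     else if a = 6 then sample_word ?H (after_token (takeWhile (\<lambda>b. b \<noteq> 5) x)) ([3] @ first_token x @ [3]) [7, 3, 2, 3]
     else []"
  have tw: "takeWhile (\<lambda>b. b \<noteq> 5) (encs ns @ 5 # y) = encs ns" for ns y
  proof -
    have "a \<noteq> 5" if "a \<in> set (encs ns)" for a
      using set_encs[OF that] by auto
    then show ?thesis by (subst takeWhile_append2) auto
  qed
  have step: "?d (gtag (snd b)) (encs (fst b # gate_args (snd b)) @ 5 # z) =
      concat (map enc_sample (gate_samples (wire_names bl) b))" for b z
  proof -
    let ?x = "encs (fst b # gate_args (snd b)) @ 5 # z"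
    have a: "after_token (takeWhile (\<lambda>b. b \<noteq> 5) ?x) = 3 # encs (gate_args (snd b))" "first_token ?x = bits (fst b)"
      unfolding tw by (simp_all add: enc_nat_def)
    show ?thesis
    proof (cases "snd b")
      case (AndG cs)
      have "and_word ?H ([3] @ bits (fst b) @ [3]) (3 # encs cs) =
        concat (map (\<lambda>c. sample_word ?H ([3] @ bits c @ [3]) ([3] @ bits (fst b) @ [3]) (enc_rat 0)) cs)"
        unfolding and_word_def enc_rat_simps(1)[symmetric]
        using collect_encs[of "[]" 3 "\<lambda>t. sample_word ?H ([3] @ t @ [3]) ([3] @ bits (fst b) @ [3]) (enc_rat 0)" cs]
        by (simp only: append_Nil2 after_token_Nil starts_simps is_bit_simps collect.simps not_False_eq_True simp_thms)
      also have "\<dots> = concat (map enc_sample (gate_samples (wire_names bl) b))"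
        unfolding gate_samples_def AndG gate.case map_map comp_def
        by (intro arg_cong[where f = concat] map_cong refl sample_word_block_words) (auto simp: occurs_single)
      finally show ?thesis using a AndG by simp
    next
      case (OrG cs)
      have "sample_word ?H (3 # encs cs) ([3] @ bits (fst b) @ [3]) (enc_rat 0) =
          enc_sample (sample_vector (wire_names bl) (set cs) {fst b}, 0)"
        by (rule sample_word_block_words) (auto simp: occurs_single occurs_encs)
      then show ?thesis using a OrG by (simp add: gate_samples_def enc_rat_simps)
    qed
  qed
  have "collect ?d (block_words bl') = concat (map enc_sample (concat (map (gate_samples (wire_names bl)) bl')))" for bl'
  proof (induction bl')
    case (Cons b bl')
    then show ?case by (subst collect_gate_positions, simp, subst step, simp)
  qed simp
  then show ?thesis unfolding gates_word_def by blast
qed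

lemma last_gate_block_words:
  assumes "bl \<noteq> []" "\<forall>b\<in>set bl. 0 < fst b"
  shows "last_gate (block_words bl) = bits (fst (last bl))"
  using assms
proof (induction bl)
  case (Cons b bl)
  have *: "last_gate (x @ y) = last_gate y" if "\<And>a. a \<in> set x \<Longrightarrow> a \<noteq> 4 \<and> a \<noteq> 6" for x y
    using that by (induction x) (auto simp: last_gate_def)
  have "a \<noteq> 4 \<and> a \<noteq> 6" if "a \<in> set (encs ns @ [5])" for a ns
    using that set_encs[of a ns] by (auto simp del: set_concat)
  then have skip: "last_gate (encs ns @ 5 # y) = last_gate y" for ns y
    using *[of "encs ns @ [5]" y] by auto
  have "last_gate (block_words (b # bl)) = (if last_gate (block_words bl) = [] then first_token (encs (fst b # gate_args (snd b)) @ 5 # block_words bl)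
     else last_gate (block_words bl))"
    using gtag_cases[of "snd b"] skip[of "fst b # gate_args (snd b)" "block_words bl"]
    by (auto simp: block_word_def last_gate_def)
  moreover have "bits n \<noteq> []" if "0 < n" for n
    using that bits_inj[of n 0] by (simp only: bits_0)
  moreover have "last_gate [] = []" by (simp add: last_gate_def)
  ultimately show ?case using Cons by (cases "bl = []") (auto simp: enc_nat_def)
qed simp

lemma count_block_words: "count_up {3} [] (block_words bl) = bits (length (wire_names bl))"
proof -
  have "filter (\<lambda>a. a = 3) (bits n) = []" for n
    using bits_set[of n] by (auto simp: filter_empty_conv)
  then have n: "length (filter (\<lambda>a. a = 3) (enc_nat n)) = 1" for n
    by (simp add: enc_nat_def)
  then have ns: "length (filter (\<lambda>a. a = 3) (encs ns)) = length ns" for ns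
    by (induction ns) auto
  have g: "gtag g \<noteq> 3" for g by (cases g) auto
  have "length (filter (\<lambda>a. a = 3) (block_words bl)) = length (wire_names bl)"
    by (induction bl) (simp_all add: block_word_def n ns g)
  then show ?thesis using count_bits[of "{3}" 0] by simp
qed

lemma enc_gate_gtag: "enc_gate g = gtag g # encs (gate_args g) @ [5]"
  by (cases g) auto

text \<open>The first form yields the circuit size, the second the wire numbers inserted by
  \<open>annotate\<close>.\<close>

lemma count_gates: "count_up {4, 6} (bits m) (concat (map enc_gate gs)) = bits (m + length gs)"
  "count_up {4, 6} (bits m) (rev (concat (map enc_gate gs))) = bits (m + length gs)"
proof -
  have "filter (\<lambda>a. a = 4 \<or> a = 6) (bits n) = []" for n
    using bits_set[of n] by (auto simp: filter_empty_conv)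
  then have "filter (\<lambda>a. a = 4 \<or> a = 6) (encs ns) = []" for ns
    by (induction ns) (auto simp: enc_nat_def)
  then have "length (filter (\<lambda>a. a = 4 \<or> a = 6) (concat (map enc_gate gs))) = length gs"
    using gtag_cases by (induction gs) (auto simp: enc_gate_gtag)
  then show "count_up {4, 6} (bits m) (concat (map enc_gate gs)) = bits (m + length gs)"
    "count_up {4, 6} (bits m) (rev (concat (map enc_gate gs))) = bits (m + length gs)"
    by (simp_all add: count_bits rev_filter[symmetric])
qed

text \<open>In the reversed word the tail seen at a gate tag describes exactly the earlier gates, so
  counting its tags from \<open>m\<close> gives the number of the output wire of that gate.\<close>

lemma annotate_gates: "annotate (bits m) (concat (map enc_gate gs)) = block_words (enumerate m gs)"
proof -
  let ?d = "\<lambda>a x. if a = 4 \<or> a = 6 then [3] @ rev (count_up {4, 6} (bits m) x) @ [a] else [a]"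
  have keep: "collect ?d (x @ y) = x @ collect ?d y" if "\<And>a. a \<in> set x \<Longrightarrow> a \<noteq> 4 \<and> a \<noteq> 6" for x y
    using that by (induction x) auto
  have "collect ?d (rev (concat (map enc_gate gs))) = rev (block_words (enumerate m gs))"
  proof (induction gs rule: rev_induct)
    case (snoc g gs)
    let ?x = "5 # rev (encs (gate_args g))" and ?y = "rev (concat (map enc_gate gs))"
    have x: "a \<noteq> 4 \<and> a \<noteq> 6" if "a \<in> set ?x" for a
      using that set_encs[of a "gate_args g"] by (auto simp del: set_concat)
    have "collect ?d (rev (concat (map enc_gate (gs @ [g])))) = collect ?d (?x @ gtag g # ?y)"
      by (simp add: enc_gate_gtag)
    also have "\<dots> = ?x @ collect ?d (gtag g # ?y)" by (rule keep[OF x])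
    also have "\<dots> = ?x @ ([3] @ rev (bits (m + length gs)) @ [gtag g]) @ rev (block_words (enumerate m gs))"
      using gtag_cases[of g] snoc by (auto simp: count_gates)
    also have "\<dots> = rev (block_words (enumerate m (gs @ [g])))"
      by (simp add: enumerate_append_eq block_word_def enc_nat_def)
    finally show ?case .
  qed simp
  then show ?thesis by (simp add: annotate_def)
qed

lemma bin_pow_bits: "bin_pow (bits x) i = bits (x ^ i)"
  by (induction i) (use bits_Suc_double[of 0] in \<open>simp_all add: bin_mul_bits[OF bits_set bits_set]\<close>)

definition blocks :: "circuit \<Rightarrow> (nat \<times> gate) list" where
  "blocks C = enumerate (ninputs C) (gates C)"

lemma circuit_wf_nonempty:
  assumes "circuit_wf C"
  shows "gates C \<noteq> []" "0 < ninputs C"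
proof -
  show "gates C \<noteq> []" using assms by (simp add: circuit_wf_def)
  then have "gate_args (gates C ! 0) \<noteq> []" "\<forall>c\<in>set (gate_args (gates C ! 0)). c < ninputs C"
    using assms by (auto simp: circuit_wf_def)
  then show "0 < ninputs C" by (cases "gate_args (gates C ! 0)") auto
qed

theorem reduce_correct:
  assumes "circuit_wf C"
  shows "reduce l (enc_circuit C) = enc_output (length (wire_names (blocks C)))
    (circuit_samples (blocks C) (1 / of_nat ((10 * csize C) ^ Suc l)))"
proof -
  let ?bl = "blocks C" and ?G = "concat (map enc_gate (gates C))"
  have w: "first_token (enc_circuit C) = bits (ninputs C)" "tl (after_token (enc_circuit C)) = ?G"
    by (simp_all add: enc_circuit_def enc_nat_def)
  note g = circuit_wf_nonempty(1)[OF assms] and i = circuit_wf_nonempty(2)[OF assms]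
  have s: "0 < (10 * csize C) ^ Suc l" using i by (simp add: csize_def)
  have H: "annotate (bits (ninputs C)) ?G = block_words ?bl" by (simp add: annotate_gates blocks_def)
  have "bin_mul [1, 2, 1, 2] (bits (csize C)) = bits (10 * csize C)"
    using bin_mul_bits[of "[1, 2, 1, 2]" "bits (csize C)"] bits_set by simp
  then have E: "bin_pow (bin_mul [1, 2, 1, 2] (count_up {4, 6} (bits (ninputs C)) ?G)) (Suc l) = bits ((10 * csize C) ^ Suc l)"
    by (simp only: count_gates csize_def[symmetric] bin_pow_bits)
  have "length ?bl \<noteq> 0" using g by (simp add: blocks_def)
  then have "?bl \<noteq> []" by auto
  moreover have "\<forall>b\<in>set ?bl. 0 < fst b" using i by (auto simp: blocks_def in_set_enumerate_eq)
  ultimately have L: "last_gate (block_words ?bl) = bits (fst (last ?bl))" by (rule last_gate_block_words)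
  have "sample_word (block_words ?bl) [] ([3] @ bits (fst (last ?bl)) @ [3]) (enc_rat 1) =
      enc_sample (sample_vector (wire_names ?bl) {} {fst (last ?bl)}, 1)"
    by (rule sample_word_block_words) (auto simp: occurs_single not_occurs_Nil)
  then show ?thesis
    unfolding reduce_def w H E assemble_def L count_block_words gates_word_block_words enc_rat_inverse[OF s, symmetric] paid_word_block_words
    by (simp add: enc_output_def circuit_samples_def enc_nat_def enc_rat_simps)
qed

lemma valid_enc_circuit: "valid (enc_circuit C)"
proof -
  have b: "valid (enc_nat n)" for n using bits_set[of n] by (auto simp: enc_nat_def valid_def)
  then have "valid (encs ns)" for ns by (induction ns) auto
  then have "valid (enc_gate g)" for g using gtag_cases[of g] by (auto simp: enc_gate_gtag)
  then have "valid (concat (map enc_gate gs))" for gs by (induction gs) auto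
  with b show ?thesis by (simp add: enc_circuit_def)
qed

section \<open>Correctness of the samples\<close>

lemma foldl_snoc_length: "length (foldl (\<lambda>xs g. xs @ [F xs g]) ys gs) = length ys + length gs"
  by (induction gs rule: rev_induct) auto

lemma foldl_snoc_init:
  "i < length ys \<Longrightarrow> foldl (\<lambda>xs g. xs @ [F xs g]) ys gs ! i = ys ! i"
  by (induction gs rule: rev_induct) (auto simp: nth_append foldl_snoc_length)

lemma foldl_snoc_nth:
  fixes F ys gs
  defines "r \<equiv> foldl (\<lambda>xs g. xs @ [F xs g]) ys gs"
  assumes "j < length gs"
  shows "r ! (length ys + j) = F (take (length ys + j) r) (gs ! j)"
  using assms(2) unfolding r_def
proof (induction gs rule: rev_induct)
  case (snoc g gs)
  then show ?case
    by (cases "j < length gs") (auto simp: nth_append foldl_snoc_length less_Suc_eq)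
qed simp

lemma foldl_max_ge: "c \<in> set cs \<Longrightarrow> f c \<le> foldl (\<lambda>m c. max m (f c)) z cs"
  for f :: "'a \<Rightarrow> nat"
proof (induction cs rule: rev_induct)
  case (snoc x xs)
  then show ?case by (auto simp: le_max_iff_disj)
qed simp

lemma wire_vals_length: "length (wire_vals C a) = csize C"
  by (simp add: wire_vals_def foldl_snoc_length csize_def)

lemma wire_vals_input: "c < ninputs C \<Longrightarrow> wire_vals C a ! c = a c"
  by (simp add: wire_vals_def foldl_snoc_init)

lemma wire_vals_gate:
  assumes "circuit_wf C" "j < length (gates C)"
  shows "wire_vals C a ! (ninputs C + j) = gate_val (wire_vals C a) (gates C ! j)"
proof -
  let ?v = "wire_vals C a"
  have "?v ! (ninputs C + j) = gate_val (take (ninputs C + j) ?v) (gates C ! j)"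
    using foldl_snoc_nth[of j "gates C" gate_val "map a [0..<ninputs C]"] assms(2)
    by (simp add: wire_vals_def)
  moreover have "\<forall>c\<in>set (gate_args (gates C ! j)). c < ninputs C + j"
    using assms by (simp add: circuit_wf_def)
  ultimately show ?thesis by (cases "gates C ! j") (auto simp: list_all_iff list_ex_iff)
qed

lemma wire_depths_length: "length (wire_depths C) = csize C"
  by (simp add: wire_depths_def foldl_snoc_length csize_def)

lemma wire_depths_gate:
  assumes "circuit_wf C" "j < length (gates C)" "c \<in> set (gate_args (gates C ! j))"
  shows "wire_depths C ! c < wire_depths C ! (ninputs C + j)"
proof -
  let ?d = "wire_depths C"
  have "?d ! (ninputs C + j) = Suc (foldl (\<lambda>m c. max m (take (ninputs C + j) ?d ! c)) 0 (gate_args (gates C ! j)))"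
    using foldl_snoc_nth[of j "gates C" "\<lambda>ds g. Suc (foldl (\<lambda>m c. max m (ds ! c)) 0 (gate_args g))"
        "replicate (ninputs C) 0"] assms(2)
    by (simp add: wire_depths_def)
  moreover have "c < ninputs C + j" using assms by (auto simp: circuit_wf_def)
  ultimately show ?thesis using foldl_max_ge[OF assms(3), of "\<lambda>c. take (ninputs C + j) ?d ! c" 0]
    by simp
qed

locale reduction =
  fixes C :: circuit
  assumes wf: "circuit_wf C"
begin

abbreviation "ni \<equiv> ninputs C"
abbreviation "N \<equiv> csize C"
abbreviation "bl \<equiv> blocks C"
abbreviation "V \<equiv> wire_names bl"
abbreviation "out \<equiv> N - 1"

lemmas gates_nonempty = circuit_wf_nonempty(1)[OF wf]
  and ninputs_pos = circuit_wf_nonempty(2)[OF wf]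

lemma N_pos: "0 < N" and ni_le_out: "ni \<le> out" and ni_le_N: "ni \<le> N"
  using gates_nonempty ninputs_pos by (cases "gates C", auto simp: csize_def)+

lemma mem_blocks: "(nm, g) \<in> set bl \<longleftrightarrow> ni \<le> nm \<and> nm < N \<and> g = gates C ! (nm - ni)"
  by (auto simp: blocks_def in_set_enumerate_eq csize_def)

lemma fst_blocks: "fst ` set bl = {ni..<N}"
  using mem_blocks by (force simp: image_iff)

lemma block_index:
  assumes "(nm, g) \<in> set bl"
  shows "nm - ni < length (gates C)" "ni + (nm - ni) = nm" "g = gates C ! (nm - ni)" "nm < N"
  using assms ni_le_N unfolding mem_blocks by (auto simp: csize_def less_diff_conv2)

lemma block_args:
  assumes "(nm, g) \<in> set bl"
  shows "gate_args g \<noteq> []" "c \<in> set (gate_args g) \<Longrightarrow> c < nm"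
    "c \<in> set (gate_args g) \<Longrightarrow> c \<in> set V" "nm \<in> set V" "nm < N"
proof -
  note j = block_index[OF assms]
  have "gate_args g \<noteq> [] \<and> (\<forall>c\<in>set (gate_args g). c < ni + (nm - ni))"
    using wf j(1) unfolding circuit_wf_def j(3) by blast
  then show "gate_args g \<noteq> []" "c \<in> set (gate_args g) \<Longrightarrow> c < nm"
    unfolding j(2) by blast+
  show "c \<in> set (gate_args g) \<Longrightarrow> c \<in> set V" "nm \<in> set V"
    using assms by (force simp: wire_names_def)+
  show "nm < N" by (rule j)
qed

lemma block_val:
  assumes "(nm, g) \<in> set bl"
  shows "wire_vals C a ! nm = gate_val (wire_vals C a) g"
  using wire_vals_gate[OF wf, of "nm - ni" a] block_index[OF assms] by simp

lemma block_depth: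
  assumes "(nm, g) \<in> set bl" "c \<in> set (gate_args g)"
  shows "wire_depths C ! c < wire_depths C ! nm"
  using wire_depths_gate[OF wf, of "nm - ni" c] block_index[OF assms(1)] assms(2) by simp

lemma circuit_eval_out: "circuit_eval C a = wire_vals C a ! out"
  using wire_vals_length[of C a] N_pos by (subst circuit_eval_def, subst last_conv_nth) auto

lemma circuit_depth_out: "circuit_depth C = wire_depths C ! out"
  using wire_depths_length[of C] N_pos by (subst circuit_depth_def, subst last_conv_nth) auto

lemma fst_last_blocks: "fst (last bl) = out"
proof -
  have l: "length bl = length (gates C)" by (simp add: blocks_def)
  with gates_nonempty have "bl \<noteq> []" by auto
  then have "last bl = bl ! (length (gates C) - 1)" by (simp add: last_conv_nth l)
  also have "\<dots> = (ni + (length (gates C) - 1), gates C ! (length (gates C) - 1))"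
    using gates_nonempty by (simp add: blocks_def nth_enumerate_eq)
  finally show ?thesis using gates_nonempty by (cases "gates C") (auto simp: csize_def)
qed

definition used :: "nat set" where
  "used = set (used_inputs bl)"

lemma used_eq: "used = {c \<in> set V. c < ni}"
proof -
  have "c < N" if c: "c \<in> set (arg_names bl)" for c
  proof -
    obtain b where b: "b \<in> set bl" "c \<in> set (gate_args (snd b))"
      using c by (auto simp: arg_names_def)
    show ?thesis using block_args(2,5)[of "fst b" "snd b"] b by fastforce
  qed
  then show ?thesis unfolding used_def used_inputs_def by (auto simp: fst_blocks set_wire_names not_le)
qed

definition gate_loss :: "(nat \<Rightarrow> real) \<Rightarrow> nat \<times> gate \<Rightarrow> real" where
  "gate_loss v b = (case snd b of
     AndG cs \<Rightarrow> (\<Sum>c\<leftarrow>cs. (relu (v c - v (fst b)))\<^sup>2)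
   | OrG cs \<Rightarrow> (relu ((\<Sum>c\<in>set cs. v c) - v (fst b)))\<^sup>2)"

text \<open>The loss in terms of wire values. By \<open>relu_loss_eq\<close> the loss of the samples
  depends on the weights only through \<open>wval\<close>, and by \<open>ex_wval\<close> and
  \<open>loss_cong\<close> every assignment \<open>v\<close> is realized, so the minimization may
  range over \<open>v\<close>.\<close>

definition loss :: "real \<Rightarrow> (nat \<Rightarrow> real) \<Rightarrow> real" where
  "loss y v = (\<Sum>c\<in>used. (relu (v c) - y)\<^sup>2) + (\<Sum>b\<leftarrow>bl. gate_loss v b) + (relu (- v out) - 1)\<^sup>2"

definition wval :: "real list \<Rightarrow> nat \<Rightarrow> real" where
  "wval w c = (\<Sum>j<length V. if V ! j = c then w ! j else 0)"

text \<open>Interchange the sums over coordinates and over names. Disjointness matters because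
  \<open>sample_vector\<close> gives \<open>P\<close> precedence over \<open>M\<close>.\<close>

lemma dot_sample_vector:
  assumes "finite P" "finite M" "P \<inter> M = {}"
  shows "(\<Sum>j<length V. w ! j * real_of_rat (sample_vector V P M ! j)) = (\<Sum>c\<in>P. wval w c) - (\<Sum>c\<in>M. wval w c)"
proof -
  have s: "(\<Sum>c\<in>P. wval w c) = (\<Sum>j<length V. if V ! j \<in> P then w ! j else 0)" if "finite P" for P
    unfolding wval_def using that by (subst sum.swap) (intro sum.cong, auto simp: sum.delta)
  have "(\<Sum>j<length V. w ! j * real_of_rat (sample_vector V P M ! j)) =
      (\<Sum>j<length V. (if V ! j \<in> P then w ! j else 0) - (if V ! j \<in> M then w ! j else 0))"
    using assms(3) by (intro sum.cong) (auto simp: sample_vector_def of_rat_minus)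
  then show ?thesis using s[OF assms(1)] s[OF assms(2)] by (simp add: sum_subtractf)
qed

lemma relu_loss_eq:
  "relu_loss (length V) (circuit_samples bl y) w = loss (real_of_rat y) (wval w)"
proof -
  let ?f = "\<lambda>(x, y). (relu (\<Sum>j<length V. w ! j * real_of_rat (x ! j)) - real_of_rat y)\<^sup>2"
  have paid: "(\<Sum>s\<leftarrow>map (\<lambda>c. (sample_vector V {c} {}, y)) (used_inputs bl). ?f s) =
      (\<Sum>c\<in>used. (relu (wval w c) - real_of_rat y)\<^sup>2)"
  proof -
    have "distinct (used_inputs bl)" by (simp add: used_inputs_def)
    then show ?thesis unfolding used_def
      by (simp add: comp_def dot_sample_vector sum_list_distinct_conv_sum_set)
  qed
  have concat: "(\<Sum>s\<leftarrow>concat (map g bs). h s) = (\<Sum>b\<leftarrow>bs. \<Sum>s\<leftarrow>g b. h s)"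
    for g and h :: "rat list \<times> rat \<Rightarrow> real" and bs :: "(nat \<times> gate) list"
    by (induction bs) auto
  have "(\<Sum>s\<leftarrow>gate_samples V b. ?f s) = gate_loss (wval w) b" if "b \<in> set bl" for b
  proof (cases b)
    case (Pair nm g)
    have nm: "nm \<notin> set (gate_args g)" using block_args(2)[of nm g nm] that Pair by auto
    show ?thesis
    proof (cases g)
      case (AndG cs)
      have "(relu (\<Sum>j<length V. w ! j * real_of_rat (sample_vector V {c} {nm} ! j)))\<^sup>2 =
          (relu (wval w c - wval w nm))\<^sup>2" if "c \<in> set cs" for c
        using that nm AndG by (subst dot_sample_vector) auto
      then show ?thesis using Pair AndG
        by (auto simp: gate_samples_def gate_loss_def comp_def intro!: arg_cong[where f = sum_list])
    next
      case (OrG cs)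
      then show ?thesis using Pair nm by (simp add: gate_samples_def gate_loss_def dot_sample_vector)
    qed
  qed
  then have "(\<Sum>s\<leftarrow>concat (map (gate_samples V) bl). ?f s) = (\<Sum>b\<leftarrow>bl. gate_loss (wval w) b)"
    by (simp add: concat cong: map_cong)
  with paid show ?thesis
    by (simp add: relu_loss_def circuit_samples_def loss_def fst_last_blocks dot_sample_vector)
qed

lemma ex_wval: "\<exists>w. length w = length V \<and> (\<forall>c\<in>set V. wval w c = v c)"
proof -
  define n where "n c = card {j. j < length V \<and> V ! j = c}" for c
  \<comment> \<open>The value of a wire is spread evenly over its occurrences.\<close>
  define w where "w = map (\<lambda>c. v c / real (n c)) V"
  have "wval w c = v c" if "c \<in> set V" for c
  proof -
    have "{j. j < length V \<and> V ! j = c} \<noteq> {}" using that by (auto simp: in_set_conv_nth)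
    then have n: "n c \<noteq> 0" by (simp add: n_def)
    have "wval w c = (\<Sum>j<length V. if V ! j = c then v c / real (n c) else 0)"
      unfolding wval_def w_def by (intro sum.cong) auto
    also have "\<dots> = (\<Sum>j\<in>{j. j < length V \<and> V ! j = c}. v c / real (n c))"
      by (simp add: sum.If_cases Collect_conj_eq[symmetric] Int_def)
    also have "\<dots> = v c" using n by (simp add: n_def[symmetric])
    finally show ?thesis .
  qed
  then show ?thesis by (intro exI[of _ w]) (simp add: w_def)
qed

lemma loss_cong:
  assumes "\<And>c. c \<in> set V \<Longrightarrow> u c = v c"
  shows "loss y u = loss y v"
proof -
  have out: "out \<in> set V" using fst_blocks N_pos ni_le_out by (simp add: set_wire_names)
  have "gate_loss u b = gate_loss v b" if "b \<in> set bl" for b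
  proof (cases b)
    case (Pair nm g)
    then have a: "u nm = v nm" "\<And>c. c \<in> set (gate_args g) \<Longrightarrow> u c = v c"
      using that block_args(3,4) assms by metis+
    then show ?thesis using Pair
      by (cases g) (auto simp: gate_loss_def cong: map_cong sum.cong)
  qed
  then have "(\<Sum>b\<leftarrow>bl. gate_loss u b) = (\<Sum>b\<leftarrow>bl. gate_loss v b)" by (simp cong: map_cong)
  moreover have "(\<Sum>c\<in>used. (relu (u c) - y)\<^sup>2) = (\<Sum>c\<in>used. (relu (v c) - y)\<^sup>2)"
    using assms by (intro sum.cong) (auto simp: used_eq)
  ultimately show ?thesis using assms[OF out] by (simp add: loss_def)
qed

section \<open>The optimum and its attainment\<close>

abbreviation "sols \<equiv> {card S | S. S \<subseteq> {..<ni} \<and> circuit_eval C (\<lambda>i. i \<in> S)}"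

lemma finite_sols: "finite sols"
proof -
  have "finite (card ` Pow {..<ni})" by simp
  then show ?thesis by (rule finite_subset[rotated]) auto
qed

lemma opt_le: "S \<subseteq> {..<ni} \<Longrightarrow> circuit_eval C (\<lambda>i. i \<in> S) \<Longrightarrow> opt C \<le> card S"
  unfolding opt_def by (rule Min_le[OF finite_sols]) auto

text \<open>The minimum is over a nonempty set: with all inputs True every wire is True, by
  monotonicity and because every gate has an argument.\<close>

lemma opt_attained:
  obtains S where "S \<subseteq> {..<ni}" "circuit_eval C (\<lambda>i. i \<in> S)" "opt C = card S"
proof -
  have "wire_vals C (\<lambda>i. i \<in> {..<ni}) ! c" if "c < N" for c
    using that
  proof (induction c rule: less_induct)
    case (less c)
    show ?case
    proof (cases "c < ni")
      case False
      then have b: "(c, gates C ! (c - ni)) \<in> set bl" using less by (simp add: mem_blocks)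
      note a = block_args(1,2)[OF b]
      have "\<forall>d\<in>set (gate_args (gates C ! (c - ni))). wire_vals C (\<lambda>i. i \<in> {..<ni}) ! d"
        using less a(2) by fastforce
      then show ?thesis using a(1) unfolding block_val[OF b]
        by (cases "gates C ! (c - ni)") (auto simp: list_all_iff list_ex_iff neq_Nil_conv)
    qed (simp add: wire_vals_input)
  qed
  then have "circuit_eval C (\<lambda>i. i \<in> {..<ni})" using N_pos by (simp add: circuit_eval_out)
  then have "sols \<noteq> {}" by blast
  then have "opt C \<in> sols" unfolding opt_def by (rule Min_in[OF finite_sols])
  then show ?thesis using that by auto
qed

lemma opt_le_N: "opt C \<le> N"
proof -
  obtain S where "S \<subseteq> {..<ni}" "opt C = card S" using opt_attained .
  then show ?thesis using card_mono[of "{..<ni}" S] ni_le_N by simp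
qed

lemma card_args: "(nm, g) \<in> set bl \<Longrightarrow> card (set (gate_args g)) \<le> N"
  using card_mono[of "{..<N}" "set (gate_args g)"] block_args(2,5)[of nm g] by fastforce

text \<open>An OR gate divides a negative margin among its at most \<open>N\<close> arguments, so that the margin may
  shrink by a factor of \<open>N\<close> with every layer.\<close>
lemma small_value_true:
  assumes d: "0 \<le> d"
    and AndG: "\<And>nm cs c. (nm, AndG cs) \<in> set bl \<Longrightarrow> c \<in> set cs \<Longrightarrow> v c - v nm \<le> d"
    and OrG: "\<And>nm cs. (nm, OrG cs) \<in> set bl \<Longrightarrow> (\<Sum>c\<in>set cs. v c) - v nm \<le> d"
    and "c \<in> set V" "c < N" "v c \<le> - (((2 * real N) ^ (wire_depths C ! c) - 1) * d)"
  shows "wire_vals C (\<lambda>i. i \<in> {c \<in> used. v c \<le> 0}) ! c"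
  using assms(4-6)
proof (induction c rule: less_induct)
  case (less c)
  let ?dp = "\<lambda>c. wire_depths C ! c"
  \<comment> \<open>The margin required at wire \<open>c\<close>: if \<open>v c\<close> is at most
    \<open>- B c\<close>, then \<open>c\<close> is True. The \<open>- 1\<close> makes it vanish at
    depth 0.\<close>
  define B where "B c = ((2 * real N) ^ (?dp c) - 1) * d" for c
  have prem: "v c \<le> - B c" using less.prems(3) by (simp only: B_def)
  have N1: "1 \<le> real N" using N_pos by simp
  have pow1: "1 \<le> (2 * real N) ^ i" for i using N1 by (intro one_le_power) simp
  have b0: "0 \<le> B c" for c unfolding B_def by (intro mult_nonneg_nonneg d) (use pow1 in simp)
  show ?case
  proof (cases "c < ni")
    case True
    have "v c \<le> 0" using prem b0[of c] by linarith
    then show ?thesis using True less.prems(1) by (simp add: wire_vals_input used_eq)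
  next
    case False
    then have b: "(c, gates C ! (c - ni)) \<in> set bl" using less.prems by (simp add: mem_blocks)
    \<comment> \<open>The error \<open>d\<close> of the gate sample and a division by
      \<open>N\<close> both fit into one more factor \<open>2 * N\<close>. With \<open>p\<close> the
      power for \<open>i\<close>, the claim is \<open>N * (p - 1) + 1\<close> at most
      \<open>2 * N * p - 1\<close>, which holds since \<open>N * p\<close> and \<open>N\<close> are
      at least 1.\<close>
    have step: "real N * B i + d \<le> B c" if "i \<in> set (gate_args (gates C ! (c - ni)))" for i
    proof -
      define p where "p = (2 * real N) ^ (?dp i)"
      have "(2 * real N) ^ Suc (?dp i) \<le> (2 * real N) ^ (?dp c)"
        using block_depth[OF b that] N1 by (intro power_increasing) auto
      then have "2 * (real N * p) \<le> (2 * real N) ^ (?dp c)" by (simp only: p_def power_Suc mult.assoc)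
      moreover have "real N * 1 \<le> real N * p" unfolding p_def by (intro mult_left_mono pow1) simp
      ultimately have "real N * (p - 1) + 1 \<le> (2 * real N) ^ (?dp c) - 1"
        using N1 unfolding right_diff_distrib by linarith
      from mult_right_mono[OF this d] show ?thesis unfolding B_def p_def[symmetric]
        by (simp only: distrib_right mult.assoc mult_1)
    qed
    have IH: "wire_vals C (\<lambda>i. i \<in> {c \<in> used. v c \<le> 0}) ! i"
      if "i \<in> set (gate_args (gates C ! (c - ni)))" "v i \<le> - B i" for i
      using less.IH[of i] block_args(2,3)[OF b that(1)] less.prems(2) that(2) unfolding B_def by linarith
    show ?thesis
    proof (cases "gates C ! (c - ni)")
      case g: (AndG cs)
      have "v i \<le> - B i" if "i \<in> set cs" for i
      proof -
        have "v i \<le> v c + d" using AndG[of c cs i] b g that by simp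
        moreover have "B i \<le> real N * B i" using N1 b0[of i] by (simp add: mult_le_cancel_right1)
        ultimately show ?thesis using step[of i] g that prem by simp
      qed
      then show ?thesis using IH g unfolding block_val[OF b] by (simp add: list_all_iff)
    next
      case g: (OrG cs)
      \<comment> \<open>If every argument missed its margin, the sum would exceed \<open>- N\<close>
        times the largest margin, against the OR sample. The maximum is taken because the arguments
        may have different depths.\<close>
      have "\<exists>i\<in>set cs. v i \<le> - B i"
      proof (rule ccontr)
        assume "\<not> ?thesis"
        then have gt: "- B i < v i" if "i \<in> set cs" for i using that by force
        have cs: "set cs \<noteq> {}" using block_args(1)[OF b] g by simp
        define m where "m = Max (B ` set cs)"
        have m: "B i \<le> m" if "i \<in> set cs" for i unfolding m_def by (rule Max_ge) (use that in auto)
        have "m \<in> B ` set cs" unfolding m_def by (rule Max_in) (use cs in auto)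
        then obtain i where i: "i \<in> set cs" "m = B i" by blast
        have "(\<Sum>i\<in>set cs. - m) < (\<Sum>i\<in>set cs. v i)"
        proof (rule sum_strict_mono)
          show "- m < v i" if "i \<in> set cs" for i using gt[OF that] m[OF that] by linarith
        qed (use cs in auto)
        then have "- (real (card (set cs)) * m) < v c + d"
          using OrG[of c cs] b g by simp
        moreover have "real (card (set cs)) * m \<le> real N * m"
          using card_args[OF b] g b0[of i] i by (intro mult_right_mono) auto
        ultimately show False using step[of i] g i prem by simp
      qed
      then show ?thesis using IH g unfolding block_val[OF b] by (auto simp: list_ex_iff)
    qed
  qed
qed

section \<open>Lower bound on the loss\<close>

lemma member_le_sum_list_nonneg:
  fixes f :: "'a \<Rightarrow> real"
  assumes "x \<in> set xs" "\<And>y. 0 \<le> f y"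
  shows "f x \<le> (\<Sum>y\<leftarrow>xs. f y)"
  using assms(1)
proof (induction xs)
  case (Cons z xs)
  have "0 \<le> (\<Sum>y\<leftarrow>xs. f y)" by (intro sum_list_nonneg) (auto simp: assms(2))
  with Cons assms(2)[of z] show ?case by fastforce
qed simp

lemma gate_loss_nonneg: "0 \<le> gate_loss v b"
  by (cases b; cases "snd b") (auto simp: gate_loss_def intro!: sum_list_nonneg)

lemma relu_square_le: "(relu z)\<^sup>2 < d\<^sup>2 \<Longrightarrow> 0 \<le> d \<Longrightarrow> z \<le> d"
  using power2_less_imp_less[of "relu z" d] by (simp add: relu_def)

lemma loss_lower:
  assumes l: "circuit_depth C = l" and y: "y = 1 / (10 * real N) ^ Suc l"
  shows "real (opt C) * y\<^sup>2 \<le> loss y v"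
proof (rule ccontr)
  assume "\<not> ?thesis"
  then have less: "loss y v < real (opt C) * y\<^sup>2" by simp
  \<comment> \<open>All loss terms are nonnegative, so a loss below \<open>d^2\<close> bounds every
    single error by \<open>d\<close>. Here \<open>opt\<close> is at most \<open>N\<close>, hence at
    most \<open>N^2\<close>.\<close>
  define d where "d = real N * y"
  have N1: "1 \<le> real N" using N_pos by simp
  have y0: "0 < y" using N1 y by simp
  have d0: "0 \<le> d" using y0 by (simp add: d_def)
  have "real (opt C) * y\<^sup>2 \<le> d\<^sup>2"
  proof -
    have "real N * 1 \<le> real N * real N" by (intro mult_left_mono N1) simp
    moreover have "real (opt C) \<le> real N" using opt_le_N by simp
    ultimately have "real (opt C) \<le> (real N)\<^sup>2" unfolding power2_eq_square by linarith
    then show ?thesis unfolding d_def power_mult_distrib by (rule mult_right_mono) simp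
  qed
  with less have ld: "loss y v < d\<^sup>2" by simp
  have p1: "0 \<le> (\<Sum>c\<in>used. (relu (v c) - y)\<^sup>2)" by (intro sum_nonneg) simp
  have p2: "0 \<le> (\<Sum>b\<leftarrow>bl. gate_loss v b)" by (intro sum_list_nonneg) (auto simp: gate_loss_nonneg)
  have gl: "gate_loss v b < d\<^sup>2" if "b \<in> set bl" for b
  proof -
    have "gate_loss v b \<le> (\<Sum>b\<leftarrow>bl. gate_loss v b)"
      by (rule member_le_sum_list_nonneg[OF that gate_loss_nonneg])
    moreover have "0 \<le> (relu (- v out) - 1)\<^sup>2" by simp
    ultimately show ?thesis using ld p1 unfolding loss_def by linarith
  qed
  have A: "v c - v nm \<le> d" if "(nm, AndG cs) \<in> set bl" "c \<in> set cs" for nm cs c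
  proof -
    have "(relu (v c - v nm))\<^sup>2 \<le> (\<Sum>c\<leftarrow>cs. (relu (v c - v nm))\<^sup>2)"
      by (rule member_le_sum_list_nonneg[OF that(2)]) simp
    also have "\<dots> < d\<^sup>2" using gl[OF that(1)] by (simp add: gate_loss_def)
    finally show ?thesis by (rule relu_square_le) (rule d0)
  qed
  have O: "(\<Sum>c\<in>set cs. v c) - v nm \<le> d" if "(nm, OrG cs) \<in> set bl" for nm cs
  proof (rule relu_square_le[OF _ d0])
    show "(relu ((\<Sum>c\<in>set cs. v c) - v nm))\<^sup>2 < d\<^sup>2" using gl[OF that] by (simp add: gate_loss_def)
  qed
  have "(relu (- v out) - 1)\<^sup>2 < d\<^sup>2" using ld p1 p2 unfolding loss_def by linarith
  then have "\<bar>relu (- v out) - 1\<bar> < d"     by (intro power2_less_imp_less[OF _ d0]) simp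
  then have r: "1 - d < relu (- v out)" by linarith
  \<comment> \<open>This inequality dictates the size of \<open>y\<close>:
    \<open>(2 * N)^l * N\<close> must not exceed \<open>(10 * N)^(l+1)\<close>.\<close>
  have pd: "(2 * real N) ^ l * d \<le> 1"
  proof -
    have "(2 * real N) ^ l * real N \<le> (10 * real N) ^ l * (10 * real N)"
      using N1 by (intro mult_mono power_mono) auto
    then show ?thesis using N1 unfolding d_def y by (simp add: field_simps)
  qed
  have pow1: "1 \<le> (2 * real N) ^ l" using N1 by (intro one_le_power) simp
  have "d \<le> (2 * real N) ^ l * d" using pow1 d0 by (simp add: mult_le_cancel_right1)
  with pd r have "relu (- v out) = - v out" by (simp add: relu_def split: if_splits)
  \<comment> \<open>From \<open>v out < d - 1\<close> and \<open>(2 * N)^l * d\<close> at most 1,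
    the output has the margin required at depth \<open>l\<close>.\<close>
  with r pd have "v out \<le> - (((2 * real N) ^ (wire_depths C ! out) - 1) * d)"
    unfolding circuit_depth_out[symmetric] l left_diff_distrib by linarith
  moreover have "out \<in> set V" using fst_blocks N_pos ni_le_out by (simp add: set_wire_names)
  ultimately have "wire_vals C (\<lambda>i. i \<in> {c \<in> used. v c \<le> 0}) ! out"
    by - (rule small_value_true[OF d0 A O], use N_pos in simp_all)
  \<comment> \<open>The read inputs of nonpositive value satisfy the circuit; \<open>relu\<close> is
    0 on each of them, so each costs exactly \<open>y^2\<close>.\<close>
  then have "opt C \<le> card {c \<in> used. v c \<le> 0}"
    by (intro opt_le) (auto simp: circuit_eval_out used_eq)
  then have "real (opt C) * y\<^sup>2 \<le> real (card {c \<in> used. v c \<le> 0}) * y\<^sup>2"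
    by (intro mult_right_mono) auto
  also have "\<dots> = (\<Sum>c\<in>{c \<in> used. v c \<le> 0}. (relu (v c) - y)\<^sup>2)"
    by (simp add: relu_def)
  also have "\<dots> \<le> (\<Sum>c\<in>used. (relu (v c) - y)\<^sup>2)"
    by (rule sum_mono2) (auto simp: used_def)
  also have "\<dots> \<le> loss y v" using p2 unfolding loss_def by simp
  finally show False using less by simp
qed

section \<open>An assignment attaining the optimum\<close>

lemma loss_upper:
  assumes y: "0 < y"
  shows "\<exists>v. loss y v \<le> real (opt C) * y\<^sup>2"
proof -
  obtain S where S: "S \<subseteq> {..<ni}" "circuit_eval C (\<lambda>i. i \<in> S)" "opt C = card S" using opt_attained .
  define t where "t c = wire_vals C (\<lambda>i. i \<in> S) ! c" for c
  \<comment> \<open>Values of False wires grow by the factor \<open>N + 1\<close> per gate, which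
    exceeds the sum over the at most \<open>N\<close> arguments of a False OR gate.\<close>
  define ff where "ff k = y * (real N + 1) ^ k" for k :: nat
  define F where "F = ff N"
  \<comment> \<open>True wires gain \<open>N * F\<close> in depth with every step towards smaller
    numbers, so one True argument of an OR gate outweighs all the others, each at most
    \<open>F\<close>. The output gets exactly \<open>-1\<close>. By truncated subtraction the
    exponent is 0 for every input wire, so a False input has exactly the value \<open>y\<close>,
    while the first gate gets exponent 1.\<close>
  define v where "v c = (if t c then - (1 + real (out - c) * (real N * F)) else ff (Suc c - ni))" for c
  have ff0: "0 < ff k" for k using y by (simp add: ff_def)
  have ff_mono: "ff i \<le> ff j" if "i \<le> j" for i j
    unfolding ff_def using that y by (intro mult_left_mono power_increasing) auto
  have F0: "0 < F" by (simp add: F_def ff0)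
  have NF0: "0 \<le> real N * F" using F0 by simp
  have neg: "v c \<le> - 1" if "t c" for c using that NF0 by (simp add: v_def)
  have leF: "v c \<le> F" if "c < N" for c
  proof (cases "t c")
    case True
    with neg[OF True] F0 show ?thesis by simp
  next
    case False
    then show ?thesis using that unfolding v_def F_def by (auto intro!: ff_mono)
  qed
  have tin: "t c \<longleftrightarrow> c \<in> S" if "c < ni" for c using that by (simp add: t_def wire_vals_input)
  have g0: "gate_loss v b = 0" if "b \<in> set bl" for b
  proof (cases b)
    case (Pair nm g)
    with that have b: "(nm, g) \<in> set bl" by simp
    note a = block_args[OF b]
    have tv: "t nm = gate_val (wire_vals C (\<lambda>i. i \<in> S)) g" unfolding t_def by (rule block_val[OF b])
    have nm: "ni \<le> nm" "nm \<le> out" using b mem_blocks by auto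
    show ?thesis
    proof (cases g)
      case g: (AndG cs)
      have "v c \<le> v nm" if c: "c \<in> set cs" for c
      proof (cases "t nm")
        case True
        then have "t c" using tv g c by (simp add: list_all_iff t_def)
        moreover have "real (out - nm) * (real N * F) \<le> real (out - c) * (real N * F)"
          using a(2)[of c] c g NF0 by (intro mult_right_mono) auto
        ultimately show ?thesis using True by (simp add: v_def)
      next
        case False
        then have vn: "v nm = ff (Suc nm - ni)" by (simp add: v_def)
        show ?thesis
        proof (cases "t c")
          case True
          then show ?thesis using neg[OF True] vn ff0[of "Suc nm - ni"] by linarith
        next
          case False
          then show ?thesis using a(2)[of c] c g unfolding vn by (auto simp: v_def intro!: ff_mono)
        qed
      qed
      then have "relu (v c - v nm) = 0" if "c \<in> set cs" for c using that by (simp add: relu_def)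
      then show ?thesis using Pair g by (simp add: gate_loss_def cong: map_cong)
    next
      case g: (OrG cs)
      have cN: "card (set cs) \<le> N" using card_args[OF b] g by simp
      have "(\<Sum>c\<in>set cs. v c) \<le> v nm"
      proof (cases "t nm")
        case True
        then obtain c0 where c0: "c0 \<in> set cs" "t c0" using tv g by (auto simp: list_ex_iff t_def)
        have "(\<Sum>c\<in>set cs. v c) = v c0 + (\<Sum>c\<in>set cs - {c0}. v c)"
          by (rule sum.remove) (use c0 in auto)
        also have "(\<Sum>c\<in>set cs - {c0}. v c) \<le> (\<Sum>c\<in>set cs - {c0}. F)"
          using a(2,5) g by (intro sum_mono leF) fastforce
        also have "\<dots> \<le> real N * F"
        proof -
          have "card (set cs - {c0}) \<le> N" using cN by (meson card_Diff1_le le_trans)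
          then show ?thesis using F0 by simp
        qed
        also have "v c0 + real N * F \<le> v nm"
        proof -
          have "real (out - nm) + 1 \<le> real (out - c0)" using a(2)[of c0] c0 g nm by simp
          from mult_right_mono[OF this NF0] show ?thesis
            using True c0(2) by (simp add: v_def algebra_simps)
        qed
        finally show ?thesis by simp
      next
        case False
        then have vn: "v nm = ff (Suc (nm - ni))" using nm by (simp add: v_def Suc_diff_le)
        have "(\<Sum>c\<in>set cs. v c) \<le> (\<Sum>c\<in>set cs. ff (nm - ni))"
        proof (rule sum_mono)
          fix c assume c: "c \<in> set cs"
          then have "\<not> t c" using False tv g by (auto simp: list_ex_iff t_def)
          then show "v c \<le> ff (nm - ni)" using a(2)[of c] c g by (auto simp: v_def intro!: ff_mono)
        qed
        also have "\<dots> = real (card (set cs)) * ff (nm - ni)" by simp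
        also have "\<dots> \<le> (real N + 1) * ff (nm - ni)"
          using cN ff0[of "nm - ni"] by (intro mult_right_mono) auto
        also have "\<dots> = v nm" by (simp add: vn ff_def)
        finally show ?thesis .
      qed
      then show ?thesis using Pair g by (simp add: gate_loss_def relu_def)
    qed
  qed
  have "(\<Sum>b\<leftarrow>bl. gate_loss v b) = 0" using g0 by (simp cong: map_cong)
  moreover have "v out = - 1" using S(2) by (simp add: v_def t_def circuit_eval_out)
  \<comment> \<open>An inequality suffices, since \<open>loss_lower\<close> supplies the other
    direction; inputs in \<open>S\<close> that no gate reads cost nothing.\<close>
  moreover have "(\<Sum>c\<in>used. (relu (v c) - y)\<^sup>2) \<le> real (card S) * y\<^sup>2"
  proof -
    have "(relu (v c) - y)\<^sup>2 = (if c \<in> S then y\<^sup>2 else 0)" if "c \<in> used" for c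
    proof -
      have c: "c < ni" using that by (simp add: used_eq)
      show ?thesis
      proof (cases "c \<in> S")
        case True
        then show ?thesis using neg[of c] tin[OF c] by (simp add: relu_def)
      next
        case False
        then have "v c = y" using tin[OF c] c by (simp add: v_def ff_def)
        then show ?thesis using False y by (simp add: relu_def)
      qed
    qed
    then have "(\<Sum>c\<in>used. (relu (v c) - y)\<^sup>2) = (\<Sum>c\<in>used. if c \<in> S then y\<^sup>2 else 0)"
      by (intro sum.cong) auto
    also have "\<dots> = real (card (used \<inter> S)) * y\<^sup>2"
      by (simp add: sum.If_cases used_def Int_def)
    also have "\<dots> \<le> real (card S) * y\<^sup>2"
      using finite_subset[OF S(1)] by (intro mult_right_mono) (auto intro: card_mono)
    finally show ?thesis .
  qed
  ultimately have "loss y v \<le> real (opt C) * y\<^sup>2" by (simp add: loss_def S(3) relu_def)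
  then show ?thesis by blast
qed

theorem relu_min:
  assumes l: "circuit_depth C = l"
  shows "relu_min_is (length V) (circuit_samples bl (1 / of_nat ((10 * N) ^ Suc l)))
    (real (opt C) / (10 * real N) ^ (2 * l + 2))"
proof -
  define y where "y = 1 / (10 * real N) ^ Suc l"
  have y0: "0 < y" using N_pos by (simp add: y_def)
  have ry: "real_of_rat (1 / of_nat ((10 * N) ^ Suc l)) = y"
    unfolding y_def by (simp add: of_rat_divide of_rat_mult of_rat_power)
  have val: "real (opt C) / (10 * real N) ^ (2 * l + 2) = real (opt C) * y\<^sup>2"
  proof -
    have "(10 * real N) ^ (2 * l + 2) = ((10 * real N) ^ Suc l)\<^sup>2"
      by (simp only: power_mult[symmetric]) (simp add: mult.commute)
    then show ?thesis by (simp add: y_def power_divide)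
  qed
  have lower: "real (opt C) * y\<^sup>2 \<le> relu_loss (length V) (circuit_samples bl (1 / of_nat ((10 * N) ^ Suc l))) w" for w
    unfolding relu_loss_eq ry by (rule loss_lower[OF l y_def])
  obtain v where v: "loss y v \<le> real (opt C) * y\<^sup>2" using loss_upper[OF y0] by blast
  obtain w where w: "length w = length V" "\<forall>c\<in>set V. wval w c = v c" using ex_wval by blast
  have "loss y (wval w) = loss y v" by (rule loss_cong) (use w(2) in blast)
  then have "relu_loss (length V) (circuit_samples bl (1 / of_nat ((10 * N) ^ Suc l))) w \<le> real (opt C) * y\<^sup>2"
    unfolding relu_loss_eq ry using v by simp
  with lower[of w] have "relu_loss (length V) (circuit_samples bl (1 / of_nat ((10 * N) ^ Suc l))) w = real (opt C) * y\<^sup>2"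
    by (rule antisym[rotated])
  then show ?thesis unfolding relu_min_is_def val using w(1) lower by blast
qed

lemma samples_ok: "samples_ok (length V) (circuit_samples bl y)"
proof -
  have "length (sample_vector V P M) = length V" for P M by (simp add: sample_vector_def)
  moreover have "length x = length V" if "(x, z) \<in> set (gate_samples V b)" for x z b
    using that by (cases b; cases "snd b") (auto simp: gate_samples_def sample_vector_def)
  ultimately show ?thesis unfolding samples_ok_def circuit_samples_def by auto
qed

end

theorem theorem6:
  fixes l :: nat
  assumes "l > 0"
  shows "\<exists>M c k. tm_wf M \<and>
     (\<forall>C. circuit_wf C \<and> circuit_depth C = l \<longrightarrow>
        (\<exists>t out n S. t \<le> c * (length (enc_circuit C) + 1) ^ k \<and>
           tm_halts_with M (enc_circuit C) t out \<and>
           out = enc_output n S \<and> samples_ok n S \<and>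
           relu_min_is n S (real (opt C) / (10 * real (csize C)) ^ (2 * l + 2))))"
proof -
  \<comment> \<open>The additional \<open>rev\<close> compensates for the reversed word that
    \<open>FP_machine\<close> hands to the function.\<close>
  have "FP 1 (\<lambda>e. reduce l (rev (e ! 0)))" by (intro FP_reduce FP_intros) simp
  from FP_machine[OF this] obtain M c k where M: "tm_wf M"
    "\<And>w. valid w \<Longrightarrow> \<exists>t\<le>c * (length w + 1) ^ k. tm_halts_with M w t (reduce l w)"
    by auto
  have "\<exists>t out n S. t \<le> c * (length (enc_circuit C) + 1) ^ k \<and>
      tm_halts_with M (enc_circuit C) t out \<and> out = enc_output n S \<and> samples_ok n S \<and>
      relu_min_is n S (real (opt C) / (10 * real (csize C)) ^ (2 * l + 2))"
    if C: "circuit_wf C" "circuit_depth C = l" for C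
  proof -
    interpret reduction C by unfold_locales (rule C)
    show ?thesis using M(2)[OF valid_enc_circuit] reduce_correct[OF C(1), of l] samples_ok relu_min[OF C(2)]
      by metis
  qed
  with M(1) show ?thesis by blast
qed

end
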